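(* Let $d\ge 2$ be an integer. There is a sequence $(\gamma_t)_{t\ge1}$ such that, for every positive integer $t$, $\gamma_t$ is a $t$-design curve in $\mathbb{S}^d$, and $$\ell(\gamma_t)\lesssim t^{\frac{d(d-1)}{2}},$$ i.e. there is a constant $C>0$ independent of $t$ (possibly depending on $d$) with $\ell(\gamma_t)\le C\,t^{d(d-1)/2}$ for all $t\ge1$. Furthermore, the trajectory $\gamma_t([0,1])$ of every $\gamma_t$ consists of a union of Euclidean circles.
   Context: $\mathbb{S}^d=\{x\in\mathbb{R}^{d+1}:\|x\|=1\}$, and $\int_{\mathbb{S}^d}$ denotes integration with respect to the surface measure normalized so that $\int_{\mathbb{S}^d}1=1$. $\Pi_t$ is the space of algebraic polynomials in $d+1$ real variables of total degree at most $t$. A curve is a continuous, piecewise smooth map $\gamma:[0,1]\to\mathbb{S}^d$ with at most finitely many self-intersections (all but finitely many points of $\gamma([0,1))$ are attained exactly once on $[0,1)$); all curves are closed, i.e. $\gamma(0)=\gamma(1)$. Its length is $\ell(\gamma)=\int_0^1\|\dot\gamma(s)\|\,ds$, assumed positive, and $\int_\gamma f=\int_0^1 f(\gamma(s))\|\dot\gamma(s)\|\,ds$. A curve $\gamma$ is a $t$-design curve in $\mathbb{S}^d$ if $\frac{1}{\ell(\gamma)}\int_\gamma f=\int_{\mathbb{S}^d}f$ for all $f\in\Pi_t$. A Euclidean circle in $\mathbb{S}^d$ is a circle of positive radius, i.e. the intersection of $\mathbb{S}^d$ with a $2$-dimensional affine plane of $\mathbb{R}^{d+1}$ when this intersection has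 more than one point. *)

theory Defs
  imports "HOL-Analysis.Analysis"
begin

text \<open>
  The sphere \<open>S\<^sup>d\<close> is \<^term>\<open>sphere (0 :: real ^ 'n) 1\<close> with \<open>CARD('n) = d + 1\<close>.
\<close>

subsection \<open>Polynomials of bounded total degree\<close>

text \<open>
  Polynomials in the coordinates \<open>x $ i\<close> are represented by the functions they induce on
  \<open>real ^ 'n\<close>; a multi-index is a function \<open>'n \<Rightarrow> nat\<close>.
\<close>

lemma finite_multi_indices: "finite {a :: 'n::finite \<Rightarrow> nat. sum a UNIV \<le> t}"
proof (rule finite_subset)
  have "a i \<le> t" if "sum a UNIV \<le> t" for a :: "'n \<Rightarrow> nat" and i
    using member_le_sum[of i UNIV a] that by simp
  then show "{a :: 'n \<Rightarrow> nat. sum a UNIV \<le> t} \<subseteq> (UNIV :: 'n set) \<rightarrow>\<^sub>E {..t}"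
    by auto
  show "finite ((UNIV :: 'n set) \<rightarrow>\<^sub>E {..t})"
    by (rule finite_PiE) auto
qed

definition polys_upto :: "nat \<Rightarrow> (real ^ 'n \<Rightarrow> real) set" where
  "polys_upto t = {f. \<exists>c :: ('n \<Rightarrow> nat) \<Rightarrow> real.
     f = (\<lambda>x. \<Sum>a | sum a UNIV \<le> t. c a * (\<Prod>i\<in>UNIV. (x $ i) ^ a i))}"

subsection \<open>Surface measure of the unit sphere\<close>

text \<open>
  The surface measure is the one of the polar-coordinates formula: a Borel set \<open>E\<close> of directions
  has measure \<open>CARD('n)\<close> times the Lebesgue measure of the cone
  \<open>{r *\<^sub>R u | r u. 0 < r \<and> r \<le> 1 \<and> u \<in> E \<and> norm u = 1}\<close>.  It is regarded as a Borel measure on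
  the whole space \<open>real ^ 'n\<close>, concentrated on the sphere.
\<close>

definition sphere_surface :: "(real ^ 'n) measure" where
  "sphere_surface =
     distr (density lborel (\<lambda>x. ennreal (real CARD('n) * indicat_real (cball 0 1 - {0}) x)))
       borel (\<lambda>x. x /\<^sub>R norm x)"

definition sphere_average :: "(real ^ 'n \<Rightarrow> real) \<Rightarrow> real" where
  "sphere_average f =
     integral\<^sup>L sphere_surface f / measure (sphere_surface :: (real ^ 'n) measure) (sphere 0 1)"

lemma emeasure_sphere_surface:
  fixes E :: "(real ^ 'n) set"
  assumes "E \<in> sets borel"
  shows "emeasure sphere_surface E =
    ennreal (real CARD('n)) * emeasure lborel {x \<in> cball 0 1 - {0}. x /\<^sub>R norm x \<in> E}"
proof -
  have m: "(\<lambda>x :: real ^ 'n. x /\<^sub>R norm x) \<in> borel_measurable borel"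
    by measurable
  have v: "(\<lambda>x :: real ^ 'n. x /\<^sub>R norm x) -` E \<in> sets borel"
    using measurable_sets[OF m assms] by simp
  have "emeasure sphere_surface E = emeasure (density lborel
      (\<lambda>x. ennreal (real CARD('n) * indicat_real (cball 0 1 - {0}) x))) ((\<lambda>x. x /\<^sub>R norm x) -` E)"
    unfolding sphere_surface_def using assms m by (subst emeasure_distr) auto
  also have "\<dots> = (\<integral>\<^sup>+x. ennreal (real CARD('n) * indicat_real (cball 0 1 - {0}) x) *
      indicator ((\<lambda>x. x /\<^sub>R norm x) -` E) x \<partial>lborel)"
    using v by (intro emeasure_density) (auto intro!: borel_measurable_times borel_measurable_indicator)
  also have "\<dots> = (\<integral>\<^sup>+x. ennreal (real CARD('n)) *
      indicator {x \<in> cball 0 1 - {0}. x /\<^sub>R norm x \<in> E} x \<partial>lborel)"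
    by (intro nn_integral_cong) (auto simp: indicator_def)
  finally have "emeasure sphere_surface E = (\<integral>\<^sup>+x. ennreal (real CARD('n)) *
      indicator {x \<in> cball 0 1 - {0}. x /\<^sub>R norm x \<in> E} x \<partial>lborel)" .
  moreover have "{x \<in> cball 0 1 - {0}. x /\<^sub>R norm x \<in> E} =
      (cball 0 1 - {0}) \<inter> (\<lambda>x. x /\<^sub>R norm x) -` E"
    by auto
  ultimately show ?thesis
    using v by (simp add: nn_integral_cmult_indicator)
qed

lemma measure_sphere_surface_sphere:
  "measure (sphere_surface :: (real ^ 'n) measure) (sphere 0 1) =
     real CARD('n) * measure lborel (cball (0 :: real ^ 'n) 1)"
proof -
  have "{x \<in> cball 0 1 - {0}. x /\<^sub>R norm x \<in> sphere 0 1} = cball (0 :: real ^ 'n) 1 - {0}"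
    by auto
  moreover have "emeasure lborel (cball (0 :: real ^ 'n) 1 - {0}) = emeasure lborel (cball (0 :: real ^ 'n) 1)"
    by (rule emeasure_Diff_null_set) auto
  ultimately show ?thesis
    by (simp add: measure_def emeasure_sphere_surface enn2real_mult)
qed

lemma sphere_average_const: "sphere_average (\<lambda>_ :: real ^ 'n. c) = c"
proof -
  have "{x \<in> cball 0 1 - {0}. x /\<^sub>R norm x \<in> UNIV} =
      {x \<in> cball 0 1 - {0}. x /\<^sub>R norm x \<in> sphere (0 :: real ^ 'n) 1}"
    by auto
  then have "measure (sphere_surface :: (real ^ 'n) measure) UNIV =
      measure (sphere_surface :: (real ^ 'n) measure) (sphere 0 1)"
    by (simp only: measure_def emeasure_sphere_surface borel_closed closed_UNIV closed_sphere)
  moreover have "space (sphere_surface :: (real ^ 'n) measure) = UNIV"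
    by (simp add: sphere_surface_def)
  moreover have "measure lborel (cball (0 :: real ^ 'n) 1) > 0"
    by simp
  ultimately show ?thesis
    by (simp add: sphere_average_def measure_sphere_surface_sphere)
qed

subsection \<open>Design curves\<close>

text \<open>Smoothness on a closed interval, with one-sided derivatives of all orders at the end points.\<close>

definition smooth_on_interval :: "real \<Rightarrow> real \<Rightarrow> (real \<Rightarrow> 'a::real_normed_vector) \<Rightarrow> bool" where
  "smooth_on_interval a b f \<longleftrightarrow>
     (\<exists>D :: nat \<Rightarrow> real \<Rightarrow> 'a. D 0 = f \<and>
       (\<forall>k. \<forall>s\<in>{a..b}. (D k has_vector_derivative D (Suc k) s) (at s within {a..b})))"

definition piecewise_smooth :: "(real \<Rightarrow> 'a::real_normed_vector) \<Rightarrow> bool" where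
  "piecewise_smooth g \<longleftrightarrow>
     (\<exists>(m :: nat) u. u 0 = 0 \<and> u m = 1 \<and>
       (\<forall>i<m. u i < u (Suc i) \<and> smooth_on_interval (u i) (u (Suc i)) g))"

text \<open>
  The derivative may fail to exist at the finitely many break points of a piecewise smooth curve;
  its value there does not affect the integrals.
\<close>

definition curve_integral :: "(real \<Rightarrow> 'a::real_normed_vector) \<Rightarrow> ('a \<Rightarrow> real) \<Rightarrow> real" where
  "curve_integral g f =
     integral {0..1} (\<lambda>s. f (g s) * norm (vector_derivative g (at s within {0..1})))"

definition curve_length :: "(real \<Rightarrow> 'a::real_normed_vector) \<Rightarrow> real" where
  "curve_length g = integral {0..1} (\<lambda>s. norm (vector_derivative g (at s within {0..1})))"

definition finite_self_intersections :: "(real \<Rightarrow> 'a) \<Rightarrow> bool" where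
  "finite_self_intersections g \<longleftrightarrow> finite {p \<in> g ` {0..<1}. \<not> (\<exists>!s. s \<in> {0..<1} \<and> g s = p)}"

definition sphere_curve :: "(real \<Rightarrow> real ^ 'n) \<Rightarrow> bool" where
  "sphere_curve g \<longleftrightarrow>
     path g \<and> piecewise_smooth g \<and> path_image g \<subseteq> sphere 0 1 \<and>
     finite_self_intersections g \<and> pathstart g = pathfinish g \<and> curve_length g > 0"

definition design_curve :: "nat \<Rightarrow> (real \<Rightarrow> real ^ 'n) \<Rightarrow> bool" where
  "design_curve t g \<longleftrightarrow>
     sphere_curve g \<and>
     (\<forall>f\<in>polys_upto t. 1 / curve_length g * curve_integral g f = sphere_average f)"

definition euclidean_circle :: "(real ^ 'n) set \<Rightarrow> bool" where
  "euclidean_circle c \<longleftrightarrow>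
     (\<exists>P. affine P \<and> aff_dim P = 2 \<and> c = sphere 0 1 \<inter> P \<and> (\<exists>x\<in>c. \<exists>y\<in>c. x \<noteq> y))"

end

theory Submission
  imports Defs
begin

text \<open>
  The curve runs through circles that are obtained by iterating latitudes.  The sphere \<open>S\<^sup>k\<close> is
  swept out by its parallels \<open>x\<^sub>k = z\<close>; such a parallel is a copy of \<open>S\<^sup>k\<^sup>-\<^sup>1\<close> scaled by
  \<open>sqrt (1 - z\<^sup>2)\<close>, and the surface measure gives the heights the density
  \<open>(1 - z\<^sup>2) powr ((k - 2) / 2)\<close>.  Suppose that finitely many heights \<open>Z\<close> satisfy
  \<open>(\<Sum>z\<in>Z. sqrt (1 - z\<^sup>2) * p z) = c * (\<integral>z. p z * (1 - z\<^sup>2) powr ((k - 2) / 2))\<close> for all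
  polynomials \<open>p\<close> of degree at most \<open>t\<close>.  If a family of circles integrates polynomials of degree
  \<open>t\<close> over \<open>S\<^sup>k\<^sup>-\<^sup>1\<close> exactly with respect to length, then its scaled copies at the heights in \<open>Z\<close> do the
  same for \<open>S\<^sup>k\<close>, since \<open>sqrt (1 - z\<^sup>2)\<close> is precisely the factor by which lengths shrink.  The total
  length grows at most by the factor \<open>card Z\<close>.  Starting from the circle \<open>S\<^sup>1\<close>, with about \<open>t ^ (k - 1)\<close>
  heights for \<open>k = 2, \<dots>, d\<close>, the length has the order \<open>t ^ (1 + 2 + \<dots> + (d - 1))\<close>, which is the
  bound claimed.

  So few heights suffice (lemma \<open>quadrature_nodes_exist\<close>) for the following reason.  With
  \<open>z = cos \<theta>\<close> the functions in question are the odd trigonometric polynomials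
  \<open>f \<theta> = sin \<theta> * p (cos \<theta>)\<close> of mean zero for the weight \<open>sin \<theta> ^ (k - 2)\<close>.
  For given \<open>f\<close>, let the nodes be the quantiles of a density that is essentially the positive part
  of \<open>f\<close> times the weight.  They depend continuously on \<open>f\<close>, and they make the sum of \<open>f\<close> over the
  nodes positive as soon as their number exceeds a multiple of the variation of \<open>f\<close> divided by its
  weighted integral norm.  A vector field that points outward on the boundary of a cube has a zero
  (\<open>zero_on_cube\<close>), and the nodes of a zero integrate all \<open>f\<close> correctly (\<open>equal_weight_nodes\<close>).
  The quotient is of order \<open>t ^ (k - 1)\<close> by Bernstein's inequality in the integral norm
  (\<open>bernstein_L1_weighted\<close>).

  Exactness of the family is verified on monomials.  Its integrals factor into one-dimensional
  moments, and so do the moments of the sphere, because rotation invariance forces a recursion on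
  them (\<open>cone_integral_monomial_rec\<close>, \<open>sphere_average_monomial\<close>).

  Circles at different heights are disjoint, so the family has to be connected before a curve can
  run through it.  For this purpose \<open>2 ^ (d - 1)\<close> copies are used, turned in the planes of the
  coordinates \<open>1\<close> and \<open>k\<close> by an angle so close to a right angle that the turned equator meets every
  parallel (\<open>parallel_meets_turned_equator\<close>).  The circles of different copies lie in planes with
  different directions, hence any two circles have only finitely many common points.  A connected
  finite family of this kind is run through by a closed curve that traverses each circle
  exactly once: whenever the curve meets a new circle, a full turn around it is inserted
  (\<open>tour_insert\<close>).
\<close>

section \<open>Zeros of vector fields on the cube\<close>

lemma compact_cube_fun: "compact {a :: nat \<Rightarrow> real. \<forall>i. \<bar>a i\<bar> \<le> 1}"
proof -
  have "compactin (product_topology (\<lambda>i::nat. euclidean :: real topology) UNIV) (PiE UNIV (\<lambda>i. {-1..1}))"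
    by (subst compactin_PiE) auto
  moreover have "PiE UNIV (\<lambda>i::nat. {-1..1::real}) = {a. \<forall>i. \<bar>a i\<bar> \<le> 1}"
    by (auto simp: PiE_def Pi_def abs_le_iff minus_le_iff)
  ultimately show ?thesis by (simp add: euclidean_product_topology)
qed

lemma LIMSEQ_fun_iff: "(X \<longlonglongrightarrow> a) \<longleftrightarrow> (\<forall>i. (\<lambda>m. X m i) \<longlonglongrightarrow> a i)" for a :: "nat \<Rightarrow> real"
  unfolding limitin_canonical_iff[symmetric] euclidean_product_topology[symmetric]
  by (simp add: limitin_componentwise)

text \<open>
  A version of Brouwer's theorem in which the dimension \<open>n\<close> is a number: points are
  sequences, of which the first \<open>n\<close> entries count. The grid points of the cube are
  labelled by the signs of the components of \<open>G\<close>. Kuhn's lemma gives arbitrarily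
  small grid cells on which every component takes both labels. At a limit point \<open>a\<close>
  of such cells, \<open>a i * G a i \<le> 0\<close> for every \<open>i\<close>, so
  \<open>a\<close> is not on the boundary, and then all components of \<open>G\<close> vanish at
  \<open>a\<close>.
\<close>

lemma zero_on_cube:
  fixes G :: "(nat \<Rightarrow> real) \<Rightarrow> nat \<Rightarrow> real"
  assumes cont: "\<And>i. i < n \<Longrightarrow> continuous_on {a. \<forall>i. \<bar>a i\<bar> \<le> 1} (\<lambda>a. G a i)"
    and pos: "\<And>a. \<lbrakk>\<forall>i. \<bar>a i\<bar> \<le> 1; \<exists>i<n. \<bar>a i\<bar> = 1\<rbrakk> \<Longrightarrow> 0 < (\<Sum>i<n. a i * G a i)"
  shows "\<exists>a. (\<forall>i. \<bar>a i\<bar> \<le> 1) \<and> (\<forall>i<n. G a i = 0)"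
proof -
  define Q where "Q = {a :: nat \<Rightarrow> real. \<forall>i. \<bar>a i\<bar> \<le> 1}"
  define pt where "pt p x = (\<lambda>i. if i < n then 2 * real (x i) / real p - 1 else 0)" for p and x :: "nat \<Rightarrow> nat"
  \<comment> \<open>On the faces of the grid Kuhn's lemma prescribes the labels; elsewhere \<open>0\<close> marks a negative component.\<close>
  define label where "label p x i = (if x i = 0 then 0 else if x i = p then 1 else if G (pt p x) i < 0 then 0 else 1 :: nat)"
    for p x i
  have ptQ: "pt p x \<in> Q" if "p > 0" "\<forall>i<n. x i \<le> p" for p x
    using that by (auto simp: Q_def pt_def abs_le_iff field_simps)
  have ex: "\<exists>q. (\<forall>i<n. q i < p) \<and> (\<forall>i<n. \<exists>r s. (\<forall>j<n. q j \<le> r j \<and> r j \<le> q j + 1) \<and>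
      (\<forall>j<n. q j \<le> s j \<and> s j \<le> q j + 1) \<and> label p r i = 0 \<and> label p s i = 1)" if p: "p > 0" for p
  proof -
    obtain q where q: "\<forall>i<n. q i < p" and q2: "\<forall>i<n. \<exists>r s. (\<forall>j<n. q j \<le> r j \<and> r j \<le> q j + 1) \<and>
      (\<forall>j<n. q j \<le> s j \<and> s j \<le> q j + 1) \<and> label p r i \<noteq> label p s i"
      by (rule kuhn_lemma[of p n "label p"]) (use p in \<open>auto simp: label_def\<close>)
    have "\<forall>i<n. \<exists>r s. (\<forall>j<n. q j \<le> r j \<and> r j \<le> q j + 1) \<and>
      (\<forall>j<n. q j \<le> s j \<and> s j \<le> q j + 1) \<and> label p r i = 0 \<and> label p s i = 1"
    proof (intro allI impI)
      fix i assume "i < n"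
      with q2 obtain r s where "(\<forall>j<n. q j \<le> r j \<and> r j \<le> q j + 1)"
        "(\<forall>j<n. q j \<le> s j \<and> s j \<le> q j + 1)" "label p r i \<noteq> label p s i" by blast
      moreover have "label p r i \<in> {0,1}" "label p s i \<in> {0,1}" by (auto simp: label_def)
      ultimately show "\<exists>r s. (\<forall>j<n. q j \<le> r j \<and> r j \<le> q j + 1) \<and>
      (\<forall>j<n. q j \<le> s j \<and> s j \<le> q j + 1) \<and> label p r i = 0 \<and> label p s i = 1"
        by (metis empty_iff insert_iff)
    qed
    with q show ?thesis by blast
  qed
  have "\<forall>m. \<exists>q. (\<forall>i<n. q i < Suc m) \<and> (\<forall>i<n. \<exists>r s. (\<forall>j<n. q j \<le> r j \<and> r j \<le> q j + 1) \<and>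
      (\<forall>j<n. q j \<le> s j \<and> s j \<le> q j + 1) \<and> label (Suc m) r i = 0 \<and> label (Suc m) s i = 1)"
    using ex by simp
  then obtain q where q: "\<And>m i. i < n \<Longrightarrow> q m i < Suc m"
    and q2: "\<And>m i. i < n \<Longrightarrow> \<exists>r s. (\<forall>j<n. q m j \<le> r j \<and> r j \<le> q m j + 1) \<and>
      (\<forall>j<n. q m j \<le> s j \<and> s j \<le> q m j + 1) \<and> label (Suc m) r i = 0 \<and> label (Suc m) s i = 1"
    by metis
  obtain r s where rs: "\<And>m i j. i < n \<Longrightarrow> j < n \<Longrightarrow> q m j \<le> r m i j \<and> r m i j \<le> q m j + 1 \<and>
       q m j \<le> s m i j \<and> s m i j \<le> q m j + 1"
     and lab: "\<And>m i. i < n \<Longrightarrow> label (Suc m) (r m i) i = 0 \<and> label (Suc m) (s m i) i = 1"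
  proof -
    have "\<forall>m i. \<exists>rs. i < n \<longrightarrow> (\<forall>j<n. q m j \<le> fst rs j \<and> fst rs j \<le> q m j + 1) \<and>
      (\<forall>j<n. q m j \<le> snd rs j \<and> snd rs j \<le> q m j + 1) \<and> label (Suc m) (fst rs) i = 0 \<and> label (Suc m) (snd rs) i = 1"
      using q2 by (metis fst_conv snd_conv)
    then obtain F where F: "\<forall>m i. i < n \<longrightarrow> (\<forall>j<n. q m j \<le> fst (F m i) j \<and> fst (F m i) j \<le> q m j + 1) \<and>
      (\<forall>j<n. q m j \<le> snd (F m i) j \<and> snd (F m i) j \<le> q m j + 1) \<and> label (Suc m) (fst (F m i)) i = 0 \<and> label (Suc m) (snd (F m i)) i = 1"
      unfolding choice_iff by blast
    then show ?thesis using that[of "\<lambda>m i. fst (F m i)" "\<lambda>m i. snd (F m i)"] by blast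
  qed
  have "seq_compact Q"
    using compact_cube_fun compact_imp_seq_compact unfolding Q_def by blast
  moreover have "\<forall>m. pt (Suc m) (q m) \<in> Q"
    using q by (auto intro!: ptQ simp: less_imp_le)
  ultimately obtain a \<sigma> where a: "a \<in> Q" and mono: "strict_mono \<sigma>"
    and lim: "((\<lambda>m. pt (Suc m) (q m)) \<circ> \<sigma>) \<longlonglongrightarrow> a"
    unfolding seq_compact_def by metis
  have inv: "(\<lambda>m. 2 / real (Suc (\<sigma> m))) \<longlonglongrightarrow> 0"
    using LIMSEQ_subseq_LIMSEQ[OF tendsto_mult_right[OF LIMSEQ_inverse_real_of_nat, of 2] mono]
    by (simp add: o_def divide_simps)
  have near: "(\<lambda>m. pt (Suc (\<sigma> m)) (v m)) \<longlonglongrightarrow> a"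
    if v: "\<And>m j. j < n \<Longrightarrow> q (\<sigma> m) j \<le> v m j \<and> v m j \<le> q (\<sigma> m) j + 1" for v
  proof -
    have "(\<lambda>m. pt (Suc (\<sigma> m)) (v m) j) \<longlonglongrightarrow> a j" for j
    proof (cases "j < n")
      case True
      have l: "(\<lambda>m. pt (Suc (\<sigma> m)) (q (\<sigma> m)) j) \<longlonglongrightarrow> a j"
        using lim by (simp add: LIMSEQ_fun_iff o_def)
      have "(\<lambda>m. pt (Suc (\<sigma> m)) (v m) j - pt (Suc (\<sigma> m)) (q (\<sigma> m)) j) \<longlonglongrightarrow> 0"
      proof (rule Lim_null_comparison[OF _ inv], intro always_eventually allI)
        fix m
        have "real (q (\<sigma> m) j) \<le> real (v m j)" "real (v m j) \<le> real (q (\<sigma> m) j) + 1"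
          using v[OF True, of m] by linarith+
        then have "\<bar>real (v m j) - real (q (\<sigma> m) j)\<bar> \<le> 1" by linarith
        moreover have "pt (Suc (\<sigma> m)) (v m) j - pt (Suc (\<sigma> m)) (q (\<sigma> m)) j =
            2 / real (Suc (\<sigma> m)) * (real (v m j) - real (q (\<sigma> m) j))"
          using True by (simp add: pt_def diff_divide_distrib right_diff_distrib)
        ultimately show "norm (pt (Suc (\<sigma> m)) (v m) j - pt (Suc (\<sigma> m)) (q (\<sigma> m)) j) \<le> 2 / real (Suc (\<sigma> m))"
          by (simp only: real_norm_def abs_mult abs_divide abs_numeral abs_of_nat) (intro mult_left_le, auto)
      qed
      from tendsto_add[OF this l] show ?thesis by simp
    next
      case False
      then show ?thesis using lim[unfolded LIMSEQ_fun_iff, rule_format, of j] by (simp add: o_def pt_def)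
    qed
    then show ?thesis by (simp add: LIMSEQ_fun_iff)
  qed
  \<comment> \<open>The points \<open>r\<close> with label \<open>0\<close> give \<open>a i = - 1\<close> or \<open>G a i \<le> 0\<close> in the limit, the points \<open>s\<close> with
    label \<open>1\<close> give \<open>a i = 1\<close> or \<open>G a i \<ge> 0\<close>; the products with \<open>max\<close> and \<open>min\<close> encode these alternatives.\<close>
  have sign: "a i * G a i \<le> 0 \<and> (\<bar>a i\<bar> < 1 \<longrightarrow> G a i = 0)" if i: "i < n" for i
  proof -
    have lr: "(\<lambda>m. pt (Suc (\<sigma> m)) (r (\<sigma> m) i)) \<longlonglongrightarrow> a" "(\<lambda>m. pt (Suc (\<sigma> m)) (s (\<sigma> m) i)) \<longlonglongrightarrow> a"
      using rs[OF i] by (intro near; blast)+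
    have rQ: "pt (Suc (\<sigma> m)) (r (\<sigma> m) i) \<in> Q" "pt (Suc (\<sigma> m)) (s (\<sigma> m) i) \<in> Q" for m
    proof -
      have "j < n \<Longrightarrow> r (\<sigma> m) i j \<le> Suc (\<sigma> m)" "j < n \<Longrightarrow> s (\<sigma> m) i j \<le> Suc (\<sigma> m)" for j
        using rs[OF i, of j "\<sigma> m"] q[of j "\<sigma> m"] by linarith+
      then show "pt (Suc (\<sigma> m)) (r (\<sigma> m) i) \<in> Q" "pt (Suc (\<sigma> m)) (s (\<sigma> m) i) \<in> Q"
        by (auto intro!: ptQ)
    qed
    have lG: "(\<lambda>m. G (pt (Suc (\<sigma> m)) (r (\<sigma> m) i)) i) \<longlonglongrightarrow> G a i"
         "(\<lambda>m. G (pt (Suc (\<sigma> m)) (s (\<sigma> m) i)) i) \<longlonglongrightarrow> G a i"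
      by (rule continuous_on_tendsto_compose[OF cont[OF i, folded Q_def] lr(1) a], simp add: rQ,
          rule continuous_on_tendsto_compose[OF cont[OF i, folded Q_def] lr(2) a], simp add: rQ)
    have la: "(\<lambda>m. pt (Suc (\<sigma> m)) (r (\<sigma> m) i) i) \<longlonglongrightarrow> a i" "(\<lambda>m. pt (Suc (\<sigma> m)) (s (\<sigma> m) i) i) \<longlonglongrightarrow> a i"
      using lr by (simp_all add: LIMSEQ_fun_iff)
    have r0: "(pt (Suc (\<sigma> m)) (r (\<sigma> m) i) i + 1) * max 0 (G (pt (Suc (\<sigma> m)) (r (\<sigma> m) i)) i) = 0" for m
      using lab[OF i, of "\<sigma> m"] i by (auto simp: label_def pt_def split: if_splits)
    have s0: "(pt (Suc (\<sigma> m)) (s (\<sigma> m) i) i - 1) * min 0 (G (pt (Suc (\<sigma> m)) (s (\<sigma> m) i)) i) = 0" for m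
      using lab[OF i, of "\<sigma> m"] i by (auto simp: label_def pt_def divide_simps split: if_splits)
    have "(\<lambda>m. (pt (Suc (\<sigma> m)) (r (\<sigma> m) i) i + 1) * max 0 (G (pt (Suc (\<sigma> m)) (r (\<sigma> m) i)) i)) \<longlonglongrightarrow> (a i + 1) * max 0 (G a i)"
      by (intro tendsto_intros la lG)
    then have 1: "(a i + 1) * max 0 (G a i) = 0" unfolding r0 by (simp add: LIMSEQ_const_iff)
    have "(\<lambda>m. (pt (Suc (\<sigma> m)) (s (\<sigma> m) i) i - 1) * min 0 (G (pt (Suc (\<sigma> m)) (s (\<sigma> m) i)) i)) \<longlonglongrightarrow> (a i - 1) * min 0 (G a i)"
      by (intro tendsto_intros la lG)
    then have 2: "(a i - 1) * min 0 (G a i) = 0" unfolding s0 by (simp add: LIMSEQ_const_iff)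
    show ?thesis
    proof (cases "G a i" "0 :: real" rule: linorder_cases)
      case less
      with 2 have "a i = 1" by simp
      with less show ?thesis by simp
    next
      case greater
      with 1 have "a i = -1" by simp
      with greater show ?thesis by simp
    qed simp
  qed
  have "\<not> (\<exists>i<n. \<bar>a i\<bar> = 1)"
  proof
    assume "\<exists>i<n. \<bar>a i\<bar> = 1"
    with pos[of a] a have "0 < (\<Sum>i<n. a i * G a i)" by (auto simp: Q_def)
    moreover have "(\<Sum>i<n. a i * G a i) \<le> 0" using sign by (intro sum_nonpos) auto
    ultimately show False by simp
  qed
  then have "\<forall>i<n. \<bar>a i\<bar> < 1" using a by (fastforce simp: Q_def order_less_le)
  with sign a show ?thesis by (auto simp: Q_def)
qed

section \<open>The Bernstein inequality in the integral norm for odd sine sums\<close>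

text \<open>
  The nodes and weights of M. Riesz's interpolation formula for the derivative of a
  trigonometric polynomial of degree \<open>n\<close>; the nodes are the zeros of \<open>cos (n
  * x)\<close> between \<open>0\<close> and \<open>pi\<close>.
\<close>

definition riesz_node :: "nat \<Rightarrow> nat \<Rightarrow> real" where
  "riesz_node n j = (2 * real j + 1) * pi / (2 * real n)"

definition riesz_weight :: "nat \<Rightarrow> nat \<Rightarrow> real" where
  "riesz_weight n j = (-1) ^ j / (4 * real n * (sin (riesz_node n j / 2))\<^sup>2)"

lemma riesz_node_bounds: "j < n \<Longrightarrow> 0 < riesz_node n j \<and> riesz_node n j < pi"
proof -
  assume j: "j < n"
  then have "2 * real j + 1 < 2 * real n" by linarith
  then have "(2 * real j + 1) * pi < pi * (2 * real n)" by simp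
  then show ?thesis using j by (simp add: riesz_node_def divide_simps)
qed

lemma sum_alternating_telescope:
  fixes g :: "nat \<Rightarrow> real"
  shows "(\<Sum>j<N. (-1) ^ j * (g (Suc j) + g j)) = g 0 - (-1) ^ N * g N"
  by (induction N) (auto simp: algebra_simps)

text \<open>
  Multiplication by \<open>2 * cos (k * pi / (2 * n))\<close> makes the sum telescope.
\<close>

lemma alternating_sum_sin_nodes:
  assumes "0 < k" "k < n"
  shows "(\<Sum>j<n. (-1) ^ j * sin (real k * riesz_node n j)) = 0"
proof -
  define a where "a = real k * pi / (2 * real n)"
  have a: "0 < a" "a < pi / 2" using assms by (auto simp: a_def field_simps)
  have "2 * cos a * (\<Sum>j<n. (-1) ^ j * sin (real k * riesz_node n j))
     = (\<Sum>j<n. (-1) ^ j * (sin (real (Suc j) * (2 * a)) + sin (real j * (2 * a))))"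
    unfolding sum_distrib_left
  proof (rule sum.cong[OF refl])
    fix j assume "j \<in> {..<n}"
    have e: "real k * riesz_node n j = (2 * real j + 1) * a"
      by (simp add: riesz_node_def a_def)
    have "2 * cos a * sin ((2 * real j + 1) * a) = sin (real (Suc j) * (2 * a)) + sin (real j * (2 * a))"
    proof -
      have *: "real (Suc j) * (2 * a) = (2 * real j + 1) * a + a" "real j * (2 * a) = (2 * real j + 1) * a - a"
        by (simp_all add: algebra_simps)
      show ?thesis unfolding * sin_add sin_diff by simp
    qed
    then show "2 * cos a * ((-1) ^ j * sin (real k * riesz_node n j)) =
       (-1) ^ j * (sin (real (Suc j) * (2 * a)) + sin (real j * (2 * a)))"
      unfolding e by (simp add: mult.left_commute mult.assoc)
  qed
  also have "\<dots> = - ((-1) ^ n * sin (real n * (2 * a)))"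
    using sum_alternating_telescope[of "\<lambda>j. sin (real j * (2 * a))" n] by simp
  also have "real n * (2 * a) = real k * pi" using assms by (simp add: a_def)
  finally have "2 * cos a * (\<Sum>j<n. (-1) ^ j * sin (real k * riesz_node n j)) = 0" by simp
  moreover have "cos a > 0" using a by (intro cos_gt_zero_pi) auto
  ultimately show ?thesis by auto
qed

lemma sin_n_riesz_node: "j < n \<Longrightarrow> sin (real n * riesz_node n j) = (-1) ^ j \<and> cos (real n * riesz_node n j) = 0"
proof -
  assume "j < n"
  then have "real n * riesz_node n j = real j * pi + pi / 2"
    by (simp add: riesz_node_def field_simps)
  then show ?thesis by (simp add: sin_add cos_add)
qed

text \<open>
  As a function of \<open>k\<close>, the left-hand side has second difference zero below
  \<open>n\<close>, because the factor \<open>sin\<^sup>2\<close> cancels and an alternating sum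
  of sines remains. So it is linear in \<open>k\<close>. Its slope is read off from the second
  difference at \<open>n\<close>: the values at \<open>n - 1\<close> and \<open>n + 1\<close>
  agree, as the nodes are zeros of \<open>cos (n * x)\<close>.
\<close>

lemma sum_riesz_weight_sin:
  assumes "k \<le> n" "0 < n"
  shows "(\<Sum>j<n. 2 * riesz_weight n j * sin (real k * riesz_node n j)) = real k"
proof -
  let ?t = "riesz_node n"
  define S where "S k = (\<Sum>j<n. 2 * riesz_weight n j * sin (real k * ?t j))" for k
  have diff: "S (k + 2) - 2 * S (k + 1) + S k = - (2 / real n) * (\<Sum>j<n. (-1) ^ j * sin (real (k + 1) * ?t j))" for k
  proof -
    have "S (k + 2) - 2 * S (k + 1) + S k = (\<Sum>j<n. 2 * riesz_weight n j *
       (sin (real (k + 2) * ?t j) - 2 * sin (real (k + 1) * ?t j) + sin (real k * ?t j)))"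
      by (simp add: S_def sum.distrib sum_subtractf sum_distrib_left algebra_simps)
    also have "\<dots> = (\<Sum>j<n. - (2 / real n) * ((-1) ^ j * sin (real (k + 1) * ?t j)))"
    proof (rule sum.cong[OF refl])
      fix j assume "j \<in> {..<n}"
      then have b: "0 < ?t j / 2" "?t j / 2 < pi" using riesz_node_bounds[of j n] by auto
      then have s: "sin (?t j / 2) \<noteq> 0" using sin_gt_zero[OF b] by simp
      define x where "x = ?t j / 2"
      have t: "?t j = 2 * x" by (simp add: x_def)
      have *: "real (k + 2) * (2 * x) = real (k + 1) * (2 * x) + 2 * x" "real k * (2 * x) = real (k + 1) * (2 * x) - 2 * x"
        by (simp_all add: algebra_simps)
      have "sin (real (k + 2) * ?t j) - 2 * sin (real (k + 1) * ?t j) + sin (real k * ?t j)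
         = - 4 * (sin x)\<^sup>2 * sin (real (k + 1) * ?t j)"
        unfolding t * sin_add sin_diff cos_double_sin by (simp add: algebra_simps)
      then show "2 * riesz_weight n j *
         (sin (real (k + 2) * ?t j) - 2 * sin (real (k + 1) * ?t j) + sin (real k * ?t j))
         = - (2 / real n) * ((-1) ^ j * sin (real (k + 1) * ?t j))"
        using s by (simp add: riesz_weight_def x_def)
    qed
    finally show ?thesis by (simp add: sum_distrib_left)
  qed
  have step: "S (k + 1) - S k = S 1" if "k < n" for k
    using that
  proof (induction k)
    case 0
    then show ?case by (simp add: S_def)
  next
    case (Suc k)
    have "S (k + 2) - 2 * S (k + 1) + S k = 0"
      using diff[of k] alternating_sum_sin_nodes[of "k + 1" n] Suc.prems by simp
    then show ?case using Suc by simp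
  qed
  have "S 1 = 1"
  proof -
    obtain m where m: "n = Suc m" using assms(2) not0_implies_Suc by blast
    have "S (m + 2) - 2 * S (m + 1) + S m = -2"
    proof -
      have "(\<Sum>j<n. (-1) ^ j * sin (real n * ?t j)) = (\<Sum>j<n. 1)"
        by (intro sum.cong) (auto simp: sin_n_riesz_node simp flip: power_add)
      then have "(\<Sum>j<n. (-1) ^ j * sin (real (m + 1) * ?t j)) = real n" using m by simp
      with diff[of m] assms(2) show ?thesis by simp
    qed
    moreover have "S (m + 2) = S m"
      unfolding S_def
    proof (intro sum.cong refl arg_cong2[where f="(*)"])
      fix j assume "j \<in> {..<n}"
      then have c: "cos (real n * ?t j) = 0" using sin_n_riesz_node by auto
      have "real (m + 2) * ?t j = real n * ?t j + ?t j" "real m * ?t j = real n * ?t j - ?t j"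
        by (simp_all add: m algebra_simps)
      then show "sin (real (m + 2) * ?t j) = sin (real m * ?t j)"
        using c by (simp only: sin_add sin_diff)
    qed
    ultimately have "S (m + 1) - S m = 1" by simp
    then show ?thesis using step[of m] m by simp
  qed
  then have "k \<le> n \<Longrightarrow> S k = real k" for k
  proof (induction k)
    case 0 then show ?case by (simp add: S_def)
  next
    case (Suc k)
    then show ?case using step[of k] \<open>S 1 = 1\<close> by simp
  qed
  then show ?thesis using assms by (simp add: S_def)
qed

text \<open>
  At the frequency \<open>n\<close> the sines at the nodes are the signs of the weights.
\<close>

lemma sum_abs_riesz_weight: "0 < n \<Longrightarrow> (\<Sum>j<n. \<bar>riesz_weight n j\<bar>) = real n / 2"
proof -
  assume n: "0 < n"
  have "(\<Sum>j<n. 2 * riesz_weight n j * sin (real n * riesz_node n j)) = (\<Sum>j<n. 2 * \<bar>riesz_weight n j\<bar>)"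
    by (intro sum.cong refl)
      (auto simp: sin_n_riesz_node riesz_weight_def abs_mult power_abs simp flip: power_add)
  then show ?thesis using sum_riesz_weight_sin[of n n] n by (simp flip: sum_distrib_left)
qed

lemma riesz_interpolation:
  fixes b :: "nat \<Rightarrow> real"
  assumes "finite K" "\<And>k. k \<in> K \<Longrightarrow> k \<le> n" "0 < n"
  defines "f \<equiv> \<lambda>x. \<Sum>k\<in>K. b k * sin (real k * x)"
  shows "(\<Sum>k\<in>K. b k * (real k * cos (real k * x))) =
    (\<Sum>j<n. riesz_weight n j * (f (x + riesz_node n j) - f (x - riesz_node n j)))"
proof -
  have "(\<Sum>j<n. riesz_weight n j * (f (x + riesz_node n j) - f (x - riesz_node n j)))
    = (\<Sum>j<n. \<Sum>k\<in>K. b k * cos (real k * x) * (2 * riesz_weight n j * sin (real k * riesz_node n j)))"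
    by (intro sum.cong refl)
      (simp add: f_def sum_distrib_left ring_distribs sin_add sin_diff flip: sum_subtractf, simp add: mult_ac)
  also have "\<dots> = (\<Sum>k\<in>K. b k * cos (real k * x) * (\<Sum>j<n. 2 * riesz_weight n j * sin (real k * riesz_node n j)))"
    by (subst sum.swap) (simp only: sum_distrib_left)
  also have "\<dots> = (\<Sum>k\<in>K. b k * cos (real k * x) * real k)"
    by (intro sum.cong refl) (simp add: sum_riesz_weight_sin assms(2,3))
  finally show ?thesis by (simp add: mult_ac)
qed

lemma sin_ge_two_div_pi:
  assumes "0 \<le> x" "x \<le> pi / 2"
  shows "2 / pi * x \<le> sin x"
proof -
  have "convex_on {0..pi/2} (\<lambda>x. - sin x)"
    by (rule f''_ge0_imp_convex[where f' = "\<lambda>x. - cos x" and f'' = sin])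
       (auto intro!: derivative_eq_intros sin_ge_zero)
  from convex_onD[OF this, of "2 / pi * x" 0 "pi / 2"] assms show ?thesis
    by (simp add: divide_simps)
qed

lemma integral_periodic_shift:
  fixes g :: "real \<Rightarrow> real"
  assumes cont: "continuous_on UNIV g" and per: "\<And>x. g (x + p) = g x" and t: "0 \<le> t" "t \<le> p"
  shows "integral {0..p} (\<lambda>x. g (x + t)) = integral {0..p} g"
proof -
  have int: "g integrable_on {a..b}" for a b
    by (intro integrable_continuous_real continuous_on_subset[OF cont]) auto
  have sh: "integral {a..b} (\<lambda>x. g (x + c)) = integral {a + c..b + c} g" for a b c
    using integral_shift_real_ivl[of "a + c" c "b + c" g] by simp
  have "integral {0..p} (\<lambda>x. g (x + t)) = integral {t..p + t} g"
    using sh[of 0 p t] by simp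
  also have "\<dots> = integral {t..p} g + integral {p..p + t} g"
    using t by (intro Henstock_Kurzweil_Integration.integral_combine[symmetric] int) auto
  also have "integral {p..p + t} g = integral {0..t} g"
    using sh[of 0 t p] per by (simp add: add.commute)
  also have "integral {t..p} g + integral {0..t} g = integral {0..p} g"
    using Henstock_Kurzweil_Integration.integral_combine[of 0 t p g] t int by simp
  finally show ?thesis .
qed

lemma integral_reflect_half:
  fixes g :: "real \<Rightarrow> real"
  assumes cont: "continuous_on UNIV g" and refl: "\<And>x. g (p - x) = g x" and "0 \<le> p"
  shows "integral {0..p} g = 2 * integral {0..p / 2} g"
proof -
  have int: "g integrable_on {a..b}" for a b
    by (intro integrable_continuous_real continuous_on_subset[OF cont]) auto
  have "integral {0..p} g = integral {0..p / 2} g + integral {p / 2..p} g"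
    using assms(3) by (intro Henstock_Kurzweil_Integration.integral_combine[symmetric] int) auto
  also have "integral {p / 2..p} g = integral {-p..-p/2} (\<lambda>x. g (-x))"
    using integral_reflect_real[of p "p/2" g] by simp
  also have "\<dots> = integral {-p..-p/2} (\<lambda>x. g (x + p))"
    using refl by (metis add.commute diff_minus_eq_add minus_minus)
  also have "\<dots> = integral {0..p / 2} g"
    using integral_shift_real_ivl[of 0 p "p / 2" g] by simp
  finally show ?thesis by simp
qed

text \<open>
  The derivative is a combination of translates of \<open>f\<close> whose coefficients have
  absolute sum \<open>n\<close>, and translation does not change the integral of a periodic
  function over a period. Since only odd frequencies occur, \<open>\<bar>f\<bar>\<close> has
  period \<open>pi\<close> and is symmetric about \<open>pi / 2\<close>, so that integrals over
  a quarter of the circle suffice.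
\<close>

lemma bernstein_L1_sine:
  fixes b :: "nat \<Rightarrow> real"
  assumes K: "finite K" "\<And>k. k \<in> K \<Longrightarrow> odd k" "\<And>k. k \<in> K \<Longrightarrow> k \<le> n" and n: "0 < n"
  defines "f \<equiv> \<lambda>x. \<Sum>k\<in>K. b k * sin (real k * x)"
    and "f' \<equiv> \<lambda>x. \<Sum>k\<in>K. b k * (real k * cos (real k * x))"
  shows "integral {0..pi / 2} (\<lambda>x. \<bar>f' x\<bar>) \<le> real n * integral {0..pi / 2} (\<lambda>x. \<bar>f x\<bar>)"
proof -
  have cf: "continuous_on A f" "continuous_on A f'" for A
    unfolding f_def f'_def by (intro continuous_intros)+
  have per: "sin (real k * (x + pi)) = - sin (real k * x)" "sin (real k * (pi - x)) = sin (real k * x)"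
    "cos (real k * (pi - x)) = - cos (real k * x)" if "k \<in> K" for k x
  proof -
    have s: "sin (real k * pi) = 0" "cos (real k * pi) = -1"
      using K(2)[OF that] by (simp_all add: sin_npi cos_npi)
    show "sin (real k * (x + pi)) = - sin (real k * x)" "sin (real k * (pi - x)) = sin (real k * x)"
       "cos (real k * (pi - x)) = - cos (real k * x)"
      unfolding distrib_left right_diff_distrib sin_add sin_diff cos_diff s by simp_all
  qed
  have fper: "f (x + pi) = - f x" for x
    unfolding f_def sum_negf[symmetric] by (intro sum.cong refl) (simp add: per)
  have frefl: "f (pi - x) = f x" for x
    unfolding f_def by (intro sum.cong refl) (simp add: per)
  have f'refl: "f' (pi - x) = - f' x" for x
    unfolding f'_def sum_negf[symmetric] by (intro sum.cong refl) (simp add: per)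
  let ?I = "integral {0..pi} (\<lambda>x. \<bar>f x\<bar>)"
  have sh1: "integral {0..pi} (\<lambda>x. \<bar>f (x + riesz_node n j)\<bar>) = ?I" if "j < n" for j
    using riesz_node_bounds[OF that] by (intro integral_periodic_shift continuous_intros cf) (auto simp: fper)
  have sh2: "integral {0..pi} (\<lambda>x. \<bar>f (x - riesz_node n j)\<bar>) = ?I" if "j < n" for j
  proof -
    have "\<bar>f (x - riesz_node n j)\<bar> = \<bar>f (x + (pi - riesz_node n j))\<bar>" for x
      using fper[of "x - riesz_node n j"] by (simp add: algebra_simps)
    then show ?thesis
      using riesz_node_bounds[OF that] integral_periodic_shift[of "\<lambda>x. \<bar>f x\<bar>" pi "pi - riesz_node n j"]
      by (simp add: fper continuous_intros cf)
  qed
  have cs: "continuous_on A (\<lambda>x. f (x + c))" "continuous_on A (\<lambda>x. f (x - c))" for A c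
    unfolding f_def by (intro continuous_intros)+
  have "integral {0..pi} (\<lambda>x. \<bar>f' x\<bar>) \<le> integral {0..pi} (\<lambda>x. \<Sum>j<n. \<bar>riesz_weight n j\<bar> *
      (\<bar>f (x + riesz_node n j)\<bar> + \<bar>f (x - riesz_node n j)\<bar>))"
  proof (intro integral_le integrable_continuous_real continuous_intros cf cs)
    fix x
    have "f' x = (\<Sum>j<n. riesz_weight n j * (f (x + riesz_node n j) - f (x - riesz_node n j)))"
      using riesz_interpolation[of K n b x] K n unfolding f_def f'_def by simp
    also have "\<bar>\<dots>\<bar> \<le> (\<Sum>j<n. \<bar>riesz_weight n j * (f (x + riesz_node n j) - f (x - riesz_node n j))\<bar>)"
      by (rule sum_abs)
    also have "\<dots> \<le> (\<Sum>j<n. \<bar>riesz_weight n j\<bar> * (\<bar>f (x + riesz_node n j)\<bar> + \<bar>f (x - riesz_node n j)\<bar>))"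
      by (intro sum_mono) (auto simp: abs_mult intro!: mult_left_mono)
    finally show "\<bar>f' x\<bar> \<le> (\<Sum>j<n. \<bar>riesz_weight n j\<bar> * (\<bar>f (x + riesz_node n j)\<bar> + \<bar>f (x - riesz_node n j)\<bar>))" .
  qed
  also have "\<dots> = (\<Sum>j<n. \<bar>riesz_weight n j\<bar> * (?I + ?I))"
  proof -
    have "integral {0..pi} (\<lambda>x. \<bar>riesz_weight n j\<bar> * (\<bar>f (x + riesz_node n j)\<bar> + \<bar>f (x - riesz_node n j)\<bar>))
       = \<bar>riesz_weight n j\<bar> * (?I + ?I)" if "j < n" for j
      using sh1[OF that] sh2[OF that]
      by (simp add: Henstock_Kurzweil_Integration.integral_add integrable_continuous_real continuous_intros cs)
    note * = this
    have "integral {0..pi} (\<lambda>x. \<Sum>j<n. \<bar>riesz_weight n j\<bar> * (\<bar>f (x + riesz_node n j)\<bar> + \<bar>f (x - riesz_node n j)\<bar>))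
      = (\<Sum>j<n. integral {0..pi} (\<lambda>x. \<bar>riesz_weight n j\<bar> * (\<bar>f (x + riesz_node n j)\<bar> + \<bar>f (x - riesz_node n j)\<bar>)))"
      by (intro integral_sum integrable_continuous_real continuous_intros cs) auto
    from trans[OF this, OF sum.cong[OF refl]] * show ?thesis by (simp only: lessThan_iff)
  qed
  also have "\<dots> = real n * ?I"
    using sum_abs_riesz_weight[OF n] by (simp flip: sum_distrib_right)
  finally have "integral {0..pi} (\<lambda>x. \<bar>f' x\<bar>) \<le> real n * ?I" .
  moreover have "?I = 2 * integral {0..pi / 2} (\<lambda>x. \<bar>f x\<bar>)"
    by (rule integral_reflect_half) (auto intro!: continuous_intros cf simp: frefl)
  moreover have "integral {0..pi} (\<lambda>x. \<bar>f' x\<bar>) = 2 * integral {0..pi / 2} (\<lambda>x. \<bar>f' x\<bar>)"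
    by (rule integral_reflect_half) (auto intro!: continuous_intros cf simp: f'refl)
  ultimately show ?thesis by simp
qed

lemma abs_diff_le_integral_deriv:
  fixes f f' :: "real \<Rightarrow> real"
  assumes "\<And>x. (f has_real_derivative f' x) (at x)" "continuous_on UNIV f'" "x \<le> y"
  shows "\<bar>f y - f x\<bar> \<le> integral {x..y} (\<lambda>s. \<bar>f' s\<bar>)"
proof -
  have "(f' has_integral (f y - f x)) {x..y}"
    using assms(3) by (intro fundamental_theorem_of_calculus)
      (auto intro: has_field_derivative_at_within[OF assms(1)] simp flip: has_real_derivative_iff_has_vector_derivative)
  then have "f y - f x = integral {x..y} f'" by (simp add: integral_unique)
  moreover have "norm (integral {x..y} f') \<le> integral {x..y} (\<lambda>s. \<bar>f' s\<bar>)"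
    by (intro integral_norm_bound_integral integrable_continuous_real continuous_intros
         continuous_on_subset[OF assms(2)]) auto
  ultimately show ?thesis by simp
qed

text \<open>
  As \<open>f 0 = 0\<close>, the values of \<open>\<bar>f\<bar>\<close> are at most the integral
  of \<open>\<bar>f'\<bar>\<close>, hence at most \<open>n\<close> times the integral of
  \<open>\<bar>f\<bar>\<close>. The interval of length \<open>1 / (2 * n)\<close> at
  \<open>0\<close> therefore carries at most half of this integral, and on the rest the sine is
  at least \<open>1 / (pi * n)\<close>.
\<close>

lemma bernstein_L1_weighted:
  fixes b :: "nat \<Rightarrow> real"
  assumes K: "finite K" "\<And>k. k \<in> K \<Longrightarrow> odd k" "\<And>k. k \<in> K \<Longrightarrow> k \<le> n" and n: "0 < n"
  defines "f \<equiv> \<lambda>x. \<Sum>k\<in>K. b k * sin (real k * x)"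
    and "f' \<equiv> \<lambda>x. \<Sum>k\<in>K. b k * (real k * cos (real k * x))"
  shows "integral {0..pi / 2} (\<lambda>x. \<bar>f' x\<bar>) \<le> 2 * pi ^ e * real n ^ (e + 1) * integral {0..pi / 2} (\<lambda>x. \<bar>f x\<bar> * sin x ^ e)"
proof -
  let ?V = "integral {0..pi / 2} (\<lambda>x. \<bar>f' x\<bar>)" and ?I = "integral {0..pi / 2} (\<lambda>x. \<bar>f x\<bar>)"
  have cf: "continuous_on A f" "continuous_on A f'" for A
    unfolding f_def f'_def by (intro continuous_intros)+
  have B: "?V \<le> real n * ?I" unfolding f_def f'_def by (rule bernstein_L1_sine[OF K n])
  have der: "(f has_real_derivative f' x) (at x)" for x
    unfolding f_def f'_def by (auto intro!: derivative_eq_intros sum.cong)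
  define \<delta> where "\<delta> = 1 / (2 * real n)"
  have "1 \<le> real n * pi" using n pi_gt3 mult_mono[of 1 "real n" 1 pi] by simp
  then have \<delta>: "0 < \<delta>" "\<delta> \<le> pi / 2" using n by (auto simp: \<delta>_def field_simps)
  have int: "(\<lambda>x. \<bar>f x\<bar>) integrable_on {u..v}" "(\<lambda>x. \<bar>f x\<bar> * sin x ^ e) integrable_on {u..v}" "(\<lambda>x. \<bar>f' x\<bar>) integrable_on {u..v}" for u v
    by (intro integrable_continuous_real continuous_intros cf)+
  have fV: "\<bar>f x\<bar> \<le> ?V" if "0 \<le> x" "x \<le> pi / 2" for x
  proof -
    have "\<bar>f x - f 0\<bar> \<le> integral {0..x} (\<lambda>s. \<bar>f' s\<bar>)"
      by (rule abs_diff_le_integral_deriv[OF der cf(2)]) (use that in auto)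
    also have "\<dots> \<le> ?V" using that by (intro integral_subset_le int) auto
    finally show ?thesis by (simp add: f_def)
  qed
  have "?I = integral {0..\<delta>} (\<lambda>x. \<bar>f x\<bar>) + integral {\<delta>..pi / 2} (\<lambda>x. \<bar>f x\<bar>)"
    using \<delta> by (intro Henstock_Kurzweil_Integration.integral_combine[symmetric] int) auto
  also have "integral {0..\<delta>} (\<lambda>x. \<bar>f x\<bar>) \<le> integral {0..\<delta>} (\<lambda>x. ?V)"
    using \<delta> by (intro integral_le int fV) auto
  also have "integral {0..\<delta>} (\<lambda>x. ?V) = \<delta> * ?V" using \<delta> by simp
  also have "\<delta> * ?V \<le> ?I / 2" using mult_left_mono[OF B, of \<delta>] \<delta> n by (simp add: \<delta>_def)
  also have "integral {\<delta>..pi / 2} (\<lambda>x. \<bar>f x\<bar>) \<le> integral {\<delta>..pi / 2} (\<lambda>x. (pi * real n) ^ e * (\<bar>f x\<bar> * sin x ^ e))"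
  proof (intro integral_le int integrable_continuous_real continuous_intros cf)
    fix x assume x: "x \<in> {\<delta>..pi / 2}"
    have "2 / pi * \<delta> \<le> 2 / pi * x" using x by (intro mult_left_mono) auto
    also have "\<dots> \<le> sin x" using x \<delta> by (intro sin_ge_two_div_pi) auto
    finally have "1 \<le> pi * real n * sin x" using n by (simp add: \<delta>_def field_simps)
    then have "1 \<le> (pi * real n * sin x) ^ e" by (rule one_le_power)
    then have "\<bar>f x\<bar> * 1 \<le> \<bar>f x\<bar> * (pi * real n * sin x) ^ e" by (intro mult_left_mono) auto
    then show "\<bar>f x\<bar> \<le> (pi * real n) ^ e * (\<bar>f x\<bar> * sin x ^ e)" by (simp add: power_mult_distrib mult_ac)
  qed
  also have "\<dots> = (pi * real n) ^ e * integral {\<delta>..pi / 2} (\<lambda>x. \<bar>f x\<bar> * sin x ^ e)" by simp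
  also have "\<dots> \<le> (pi * real n) ^ e * integral {0..pi / 2} (\<lambda>x. \<bar>f x\<bar> * sin x ^ e)"
    using \<delta> by (intro mult_left_mono integral_subset_le int) (auto intro!: mult_nonneg_nonneg zero_le_power sin_ge_zero)
  finally have "?I \<le> 2 * (pi * real n) ^ e * integral {0..pi / 2} (\<lambda>x. \<bar>f x\<bar> * sin x ^ e)" by simp
  then have "real n * ?I \<le> real n * (2 * (pi * real n) ^ e * integral {0..pi / 2} (\<lambda>x. \<bar>f x\<bar> * sin x ^ e))"
    by (intro mult_left_mono) auto
  with B show ?thesis by (simp add: power_mult_distrib mult_ac)
qed

section \<open>Equal-weight quadrature with prescribed density\<close>

text \<open>
  The quantiles of a density depend continuously on parameters of the density by this lemma.
\<close>

lemma continuous_on_root_of_strict_mono: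
  fixes H :: "'a::topological_space \<Rightarrow> real \<Rightarrow> real"
  assumes mono: "\<And>a. a \<in> Q \<Longrightarrow> strict_mono_on {0..b} (H a)"
    and cont: "\<And>x. x \<in> {0..b} \<Longrightarrow> continuous_on Q (\<lambda>a. H a x)"
    and root: "\<And>a. a \<in> Q \<Longrightarrow> r a \<in> {0..b} \<and> H a (r a) = 0"
  shows "continuous_on Q r"
  unfolding continuous_on_def
proof (intro ballI, unfold order_tendsto_iff, intro conjI allI impI)
  fix a l assume a: "a \<in> Q" and l: "l < r a"
  show "\<forall>\<^sub>F x in at a within Q. l < r x"
  proof (cases "l < 0")
    case True
    then have "\<forall>x\<in>Q. l < r x" using root by fastforce
    then show ?thesis by (simp add: eventually_at_filter)
  next
    case False
    then have lb: "l \<in> {0..b}" using l root[OF a] by auto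
    then have "H a l < 0" using strict_mono_onD[OF mono[OF a], of l "r a"] root[OF a] l by auto
    then have "\<forall>\<^sub>F x in at a within Q. H x l < 0"
      using cont[OF lb] a by (auto simp: continuous_on_def intro: order_tendstoD)
    moreover have "\<forall>\<^sub>F x in at a within Q. x \<in> Q" by (simp add: eventually_at_filter)
    ultimately show ?thesis
    proof eventually_elim
      case (elim x)
      show ?case
      proof (rule ccontr)
        assume "\<not> l < r x"
        then have "H x (r x) \<le> H x l"
          using strict_mono_onD[OF mono[OF elim(2)], of "r x" l] root[OF elim(2)] lb by (cases "r x = l") auto
        with root[OF elim(2)] elim(1) show False by simp
      qed
    qed
  qed
next
  fix a l assume a: "a \<in> Q" and l: "r a < l"
  show "\<forall>\<^sub>F x in at a within Q. r x < l"
  proof (cases "l > b")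
    case True
    then have "\<forall>x\<in>Q. r x < l" using root by fastforce
    then show ?thesis by (simp add: eventually_at_filter)
  next
    case False
    then have lb: "l \<in> {0..b}" using l root[OF a] by auto
    then have "H a l > 0" using strict_mono_onD[OF mono[OF a], of "r a" l] root[OF a] l by auto
    then have "\<forall>\<^sub>F x in at a within Q. H x l > 0"
      using cont[OF lb] a by (auto simp: continuous_on_def intro: order_tendstoD)
    moreover have "\<forall>\<^sub>F x in at a within Q. x \<in> Q" by (simp add: eventually_at_filter)
    ultimately show ?thesis
    proof eventually_elim
      case (elim x)
      show ?case
      proof (rule ccontr)
        assume "\<not> r x < l"
        then have "H x l \<le> H x (r x)"
          using strict_mono_onD[OF mono[OF elim(2)], of l "r x"] root[OF elim(2)] lb by (cases "r x = l") auto
        with root[OF elim(2)] elim(1) show False by simp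
      qed
    qed
  qed
qed

lemma sum_integral_cells:
  fixes h :: "real \<Rightarrow> real"
  assumes "continuous_on UNIV h" "\<And>j. j < M \<Longrightarrow> y j \<le> y (Suc j)"
  shows "(\<Sum>j<M. integral {y j..y (Suc j)} h) = integral {y 0..y M} h \<and> y 0 \<le> y M"
  using assms(2)
proof (induction M)
  case (Suc M)
  have int: "h integrable_on {a..b}" for a b
    by (intro integrable_continuous_real continuous_on_subset[OF assms(1)]) auto
  have "y M \<le> y (Suc M)" "y 0 \<le> y M" using Suc by auto
  moreover from this have "y 0 \<le> y (Suc M)" by simp
  ultimately show ?case using Suc Henstock_Kurzweil_Integration.integral_combine[OF _ _ int, of "y 0" "y M" "y (Suc M)"] by auto
qed auto

lemma integral_pos_continuous:
  fixes h :: "real \<Rightarrow> real"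
  assumes "continuous_on UNIV h" "x < y" "\<And>s. x < s \<Longrightarrow> s \<le> y \<Longrightarrow> 0 < h s"
  shows "0 < integral {x..y} h"
proof -
  have c: "continuous_on {x..y} h" using assms(1) continuous_on_subset by blast
  have cl: "0 \<le> h s" if "s \<in> {x..y}" for s
  proof -
    have "closure {x<..<y} = {x..y}" using assms(2) by simp
    with that show ?thesis
      using continuous_ge_on_closure[of "{x<..<y}" h s 0] c assms(3) by (auto simp: less_imp_le)
  qed
  then have "integral {x..y} h \<ge> 0" by (intro Henstock_Kurzweil_Integration.integral_nonneg integrable_continuous_real c)
  moreover have "integral {x..y} h \<noteq> 0"
    using integral_eq_0_iff[OF c assms(2) cl] assms(2,3) by force
  ultimately show ?thesis by simp
qed

text \<open>
  The numbers \<open>y j\<close> together with half the end point \<open>b\<close> form an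
  equal-weight quadrature formula for the span of the functions \<open>e i\<close>. For a
  coefficient vector \<open>a\<close> the candidates \<open>y a j\<close> are the quantiles at
  \<open>j / (N + 1)\<close> of the density \<open>(max 0 (f a) + \<epsilon> a) * w\<close>. On
  each of the \<open>N + 1\<close> cells of equal mass between them, \<open>f a\<close> differs
  from its value at the left end by at most its variation there. So the sum of \<open>f
  a\<close> over the quantiles is at least \<open>N + 1\<close> times the mean of \<open>f
  a\<close> for the density, minus the total variation of \<open>f a\<close>. As \<open>f
  a\<close> has mean zero for \<open>w\<close>, the constant \<open>\<epsilon> a\<close>
  contributes nothing to the integral of \<open>f a\<close> against the density, and the
  Cauchy-Schwarz inequality bounds that mean from below by a multiple of the integral of the
  positive part. Under the assumption on \<open>N\<close> the sum is positive on the boundary of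
  the cube of coefficient vectors, and \<open>zero_on_cube\<close> applies.
\<close>

lemma equal_weight_nodes:
  fixes e e' :: "nat \<Rightarrow> real \<Rightarrow> real" and w :: "real \<Rightarrow> real"
  assumes b: "0 < b"
    and der: "\<And>i x. (e i has_real_derivative e' i x) (at x)" and ce': "\<And>i. continuous_on UNIV (e' i)"
    and e0: "\<And>i. e i 0 = 0"
    and cw: "continuous_on UNIV w" and w: "\<And>x. 0 < x \<Longrightarrow> x \<le> b \<Longrightarrow> 0 < w x" and w0: "0 \<le> w 0"
    and mean: "\<And>i. i < n \<Longrightarrow> integral {0..b} (\<lambda>x. e i x * w x) = 0"
  defines "f \<equiv> \<lambda>a x. \<Sum>i<n. a i * e i x" and "f' \<equiv> \<lambda>a x. \<Sum>i<n. a i * e' i x"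
  assumes indep: "\<And>a. \<exists>i<n. a i \<noteq> 0 \<Longrightarrow> \<exists>x\<in>{0..b}. f a x \<noteq> 0"
    and var: "\<And>a. integral {0..b} (\<lambda>x. \<bar>f' a x\<bar>) \<le> K * integral {0..b} (\<lambda>x. \<bar>f a x\<bar> * w x)"
    and N: "6 * integral {0..b} w * K < real (N + 1)"
  shows "\<exists>y. (\<forall>j\<in>{1..N}. 0 < y j \<and> y j < b) \<and> inj_on y {1..N} \<and>
      (\<forall>i<n. (\<Sum>j=1..N. e i (y j)) + e i b / 2 = 0)"
proof -
  define Q where "Q = {a :: nat \<Rightarrow> real. \<forall>i. \<bar>a i\<bar> \<le> 1}"
  define M where "M = N + 1"
  define \<mu> where "\<mu> = integral {0..b} w"
  define B where "B a = integral {0..b} (\<lambda>x. max 0 (f a x) * w x)" for a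
  \<comment> \<open>The product vanishes exactly on the boundary of the cube and keeps \<open>\<epsilon> a\<close> positive inside it,
    so that the quantiles are well defined also for \<open>a = 0\<close>.\<close>
  define \<epsilon> where "\<epsilon> a = B a / \<mu> + (\<Prod>i<n. 1 - (a i)\<^sup>2)" for a
  define dens where "dens a x = (max 0 (f a x) + \<epsilon> a) * w x" for a x
  define \<Phi> where "\<Phi> a x = integral {0..x} (dens a)" for a x
  have cR: "continuous_on A (e i)" "continuous_on A (e' i)" "continuous_on A w" for A i
    using continuous_on_subset[OF ce'] continuous_on_subset[OF cw]
      DERIV_continuous_on[OF has_field_derivative_at_within[OF der]] by auto
  have cf: "continuous_on A (f a)" "continuous_on A (f' a)" for A a
    unfolding f_def f'_def by (intro continuous_intros cR)+
  have derf: "(f a has_real_derivative f' a x) (at x)" for a x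
    unfolding f_def f'_def by (auto intro!: derivative_eq_intros der simp: mult.commute)
  have f0: "f a 0 = 0" for a by (simp add: f_def e0)
  have w_nn: "0 \<le> w x" if "0 \<le> x" "x \<le> b" for x using w[of x] w0 that by (cases "x = 0") (auto simp: less_imp_le)
  have \<mu>: "0 < \<mu>" unfolding \<mu>_def by (intro integral_pos_continuous cw b w)
  have B_nn: "0 \<le> B a" for a
    unfolding B_def by (intro Henstock_Kurzweil_Integration.integral_nonneg integrable_continuous_real continuous_intros cf cR)
       (auto intro!: mult_nonneg_nonneg w_nn)
  have int: "(\<lambda>x. \<bar>f a x\<bar> * w x) integrable_on {x..y}" "(\<lambda>x. f a x * w x) integrable_on {x..y}"
    "(\<lambda>x. max 0 (f a x) * w x) integrable_on {x..y}" "w integrable_on {x..y}"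
    "dens a integrable_on {x..y}" "(\<lambda>x. \<bar>f' a x\<bar>) integrable_on {x..y}"
    "(\<lambda>x. f a x * dens a x) integrable_on {x..y}" "(\<lambda>x. (max 0 (f a x))\<^sup>2 * w x) integrable_on {x..y}" for a x y
    unfolding dens_def by (intro integrable_continuous_real continuous_intros cf cR)+
  have fw: "integral {0..b} (\<lambda>x. f a x * w x) = 0" for a
  proof -
    have "integral {0..b} (\<lambda>x. f a x * w x) = (\<Sum>i<n. integral {0..b} (\<lambda>x. a i * (e i x * w x)))"
      unfolding f_def sum_distrib_right mult.assoc
      by (intro integral_sum integrable_continuous_real continuous_intros cR) auto
    also have "\<dots> = 0" by (intro sum.neutral) (simp add: mean)
    finally show ?thesis .
  qed
  have absf: "integral {0..b} (\<lambda>x. \<bar>f a x\<bar> * w x) = 2 * B a" for a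
  proof -
    have "\<bar>f a x\<bar> * w x = 2 * (max 0 (f a x) * w x) - f a x * w x" for x by (auto simp: max_def)
    then have "integral {0..b} (\<lambda>x. \<bar>f a x\<bar> * w x) = integral {0..b} (\<lambda>x. 2 * (max 0 (f a x) * w x) - f a x * w x)"
      by presburger
    also have "\<dots> = integral {0..b} (\<lambda>x. 2 * (max 0 (f a x) * w x)) - integral {0..b} (\<lambda>x. f a x * w x)"
      by (intro Henstock_Kurzweil_Integration.integral_diff integrable_on_mult_right int)
    also have "\<dots> = 2 * B a" by (simp add: fw B_def)
    finally show ?thesis .
  qed
  have B_pos: "0 < B a" if "\<exists>i<n. a i \<noteq> 0" for a
  proof (rule ccontr)
    assume "\<not> 0 < B a"
    with B_nn[of a] have "B a = 0" by simp
    then have "integral {0..b} (\<lambda>x. \<bar>f a x\<bar> * w x) = 0" using absf by simp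
    then have z: "\<forall>x\<in>{0..b}. \<bar>f a x\<bar> * w x = 0"
      using integral_eq_0_iff[OF _ b, of "\<lambda>x. \<bar>f a x\<bar> * w x"] w_nn by (simp add: continuous_intros cf cR)
    from indep[OF that] obtain x where "x \<in> {0..b}" "f a x \<noteq> 0" by blast
    with z w[of x] f0[of a] show False by (cases "x = 0") force+
  qed
  have \<epsilon>_pos: "0 < \<epsilon> a" if a: "a \<in> Q" for a
  proof (cases "\<exists>i<n. \<bar>a i\<bar> = 1")
    case True
    then have "\<exists>i<n. a i \<noteq> 0" by fastforce
    then have "0 < B a / \<mu>" using B_pos \<mu> by simp
    moreover have "0 \<le> (\<Prod>i<n. 1 - (a i)\<^sup>2)" using a by (intro prod_nonneg) (auto simp: Q_def abs_square_le_1)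
    ultimately show ?thesis by (simp add: \<epsilon>_def)
  next
    case False
    then have "\<forall>i<n. \<bar>a i\<bar> < 1" using a unfolding Q_def by (fastforce simp: order_less_le)
    then have "0 < (\<Prod>i<n. 1 - (a i)\<^sup>2)" by (intro prod_pos) (auto simp: abs_square_less_1)
    then show ?thesis using B_nn[of a] \<mu> by (simp add: \<epsilon>_def add_nonneg_pos)
  qed
  have dens_pos: "0 < dens a x" if "a \<in> Q" "0 < x" "x \<le> b" for a x
    using \<epsilon>_pos[OF that(1)] w[OF that(2,3)] by (auto simp: dens_def intro!: mult_pos_pos add_nonneg_pos)
  have cd: "continuous_on A (dens a)" for A a unfolding dens_def by (intro continuous_intros cf cR)
  have \<Phi>_diff: "\<Phi> a y - \<Phi> a x = integral {x..y} (dens a)" if "0 \<le> x" "x \<le> y" for a x y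
    using Henstock_Kurzweil_Integration.integral_combine[OF that int(5)[of a]] by (simp add: \<Phi>_def)
  have \<Phi>_mono: "strict_mono_on {0..b} (\<Phi> a)" if "a \<in> Q" for a
  proof (rule strict_mono_onI)
    fix x y assume xy: "x \<in> {0..b}" "y \<in> {0..b}" "x < y"
    have "0 < integral {x..y} (dens a)" by (rule integral_pos_continuous) (use xy dens_pos[OF that] cd in auto)
    with \<Phi>_diff[of x y a] xy show "\<Phi> a x < \<Phi> a y" by simp
  qed
  have pc: "continuous_on A (\<lambda>p :: (nat \<Rightarrow> real) \<times> real. fst p i)" for A i
    by (rule continuous_on_product_then_coordinatewise[OF continuous_on_fst[OF continuous_on_id]])
  have ac: "continuous_on A (\<lambda>a :: nat \<Rightarrow> real. a i)" for A i
    by (rule continuous_on_product_then_coordinatewise[OF continuous_on_id])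
  have fc: "continuous_on A (\<lambda>p. f (fst p) (snd p))" and wc: "continuous_on A (\<lambda>p. w (snd p))"
    for A :: "((nat \<Rightarrow> real) \<times> real) set"
    unfolding f_def by (intro continuous_intros pc continuous_on_compose2[OF cR(1), of _ snd] 
        continuous_on_compose2[OF cR(3), of _ snd], auto)+
  have Bc: "continuous_on A B" for A
    unfolding B_def box_real(2)[symmetric]
    by (rule integral_continuous_on_param) (auto simp: split_beta intro!: continuous_intros fc wc)
  have \<epsilon>c: "continuous_on A \<epsilon>" for A
    unfolding \<epsilon>_def using \<mu> by (intro continuous_intros Bc ac) auto
  have \<epsilon>c2: "continuous_on A (\<lambda>p. \<epsilon> (fst p))" for A :: "((nat \<Rightarrow> real) \<times> real) set"
    by (rule continuous_on_compose2[OF \<epsilon>c[of UNIV] continuous_on_fst[OF continuous_on_id]]) auto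
  have \<Phi>c: "continuous_on A (\<lambda>a. \<Phi> a x)" for A x
    unfolding \<Phi>_def box_real(2)[symmetric] dens_def
    by (rule integral_continuous_on_param) (auto simp: split_beta intro!: continuous_intros fc wc \<epsilon>c2)
  define y where "y a j = (SOME x. x \<in> {0..b} \<and> \<Phi> a x = real j / real M * \<Phi> a b)" for a j
  have \<Phi>0: "\<Phi> a 0 = 0" for a by (simp add: \<Phi>_def)
  have \<Phi>b: "0 < \<Phi> a b" if "a \<in> Q" for a using strict_mono_onD[OF \<Phi>_mono[OF that], of 0 b] b \<Phi>0 by simp
  have y: "y a j \<in> {0..b} \<and> \<Phi> a (y a j) = real j / real M * \<Phi> a b" if a: "a \<in> Q" and j: "j \<le> M" for a j
    unfolding y_def
  proof (rule someI_ex)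
    have "\<exists>x\<ge>0. x \<le> b \<and> \<Phi> a x = real j / real M * \<Phi> a b"
    proof (rule IVT')
      show "\<Phi> a 0 \<le> real j / real M * \<Phi> a b" using \<Phi>b[OF a] by (simp add: \<Phi>0)
      show "real j / real M * \<Phi> a b \<le> \<Phi> a b" using \<Phi>b[OF a] j by (simp add: M_def divide_simps)
      show "continuous_on {0..b} (\<Phi> a)" unfolding \<Phi>_def by (rule indefinite_integral_continuous_1[OF int(5)])
    qed (use b in auto)
    then show "\<exists>x. x \<in> {0..b} \<and> \<Phi> a x = real j / real M * \<Phi> a b" by auto
  qed
  have y_less: "y a i < y a j" if a: "a \<in> Q" and ij: "i < j" "j \<le> M" for a i j
  proof (rule ccontr)
    assume "\<not> y a i < y a j"
    then have "\<Phi> a (y a j) \<le> \<Phi> a (y a i)"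
      using strict_mono_onD[OF \<Phi>_mono[OF a], of "y a j" "y a i"] y[OF a, of i] y[OF a, of j] ij
      by (cases "y a j = y a i") (auto simp: less_imp_le)
    then have "real j / real M * \<Phi> a b \<le> real i / real M * \<Phi> a b" using y[OF a, of i] y[OF a, of j] ij by simp
    then show False using \<Phi>b[OF a] ij by (simp add: M_def divide_simps)
  qed
  have y_ends: "y a 0 = 0" "y a M = b" if a: "a \<in> Q" for a
    using strict_mono_onD[OF \<Phi>_mono[OF a], of 0 "y a 0"] y[OF a, of 0]
      strict_mono_onD[OF \<Phi>_mono[OF a], of "y a M" b] y[OF a, of M] b
    by (force simp: \<Phi>0 M_def)+
  have yc: "continuous_on Q (\<lambda>a. y a j)" if j: "j \<le> M" for j
  proof (rule continuous_on_root_of_strict_mono[where H = "\<lambda>a x. \<Phi> a x - real j / real M * \<Phi> a b" and b = b])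
    show "strict_mono_on {0..b} (\<lambda>x. \<Phi> a x - real j / real M * \<Phi> a b)" if "a \<in> Q" for a
      using \<Phi>_mono[OF that] by (simp add: strict_mono_on_def)
    show "continuous_on Q (\<lambda>a. \<Phi> a x - real j / real M * \<Phi> a b)" for x
      by (intro continuous_intros \<Phi>c)
    show "y a j \<in> {0..b} \<and> \<Phi> a (y a j) - real j / real M * \<Phi> a b = 0" if "a \<in> Q" for a
      using y[OF that j] by simp
  qed
  define G where "G a i = (\<Sum>j=1..N. e i (y a j)) + e i b / 2" for a i
  have "\<exists>a. (\<forall>i. \<bar>a i\<bar> \<le> 1) \<and> (\<forall>i<n. G a i = 0)"
  proof (rule zero_on_cube)
    show "continuous_on {a. \<forall>i. \<bar>a i\<bar> \<le> 1} (\<lambda>a. G a i)" for i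
      unfolding G_def Q_def[symmetric]
      by (intro continuous_intros continuous_on_compose2[OF cR(1)[of UNIV]] yc) (auto simp: M_def)
    fix a :: "nat \<Rightarrow> real" assume "\<forall>i. \<bar>a i\<bar> \<le> 1" and bd: "\<exists>i<n. \<bar>a i\<bar> = 1"
    then have a: "a \<in> Q" by (simp add: Q_def)
    have "\<exists>i<n. a i \<noteq> 0" using bd by fastforce
    note Bp = B_pos[OF this]
    let ?V = "integral {0..b} (\<lambda>x. \<bar>f' a x\<bar>)"
    let ?S = "integral {0..b} (\<lambda>x. (max 0 (f a x))\<^sup>2 * w x)"
    have "(\<Prod>i<n. 1 - (a i)\<^sup>2) = 0" using bd by (intro prod_zero) (auto simp: abs_square_eq_1)
    then have \<epsilon>a: "\<epsilon> a = B a / \<mu>" by (simp add: \<epsilon>_def)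
    have \<Phi>2: "\<Phi> a b = 2 * B a"
    proof -
      have "\<Phi> a b = integral {0..b} (\<lambda>x. max 0 (f a x) * w x + \<epsilon> a * w x)"
        by (simp add: \<Phi>_def dens_def[abs_def] ring_distribs)
      also have "\<dots> = B a + \<epsilon> a * \<mu>"
        unfolding B_def \<mu>_def
        by (subst Henstock_Kurzweil_Integration.integral_add) (auto intro!: int integrable_on_mult_right)
      finally show ?thesis using \<mu> by (simp add: \<epsilon>a)
    qed
    have fd: "integral {0..b} (\<lambda>x. f a x * dens a x) = ?S"
    proof -
      have "f a x * dens a x = (max 0 (f a x))\<^sup>2 * w x + \<epsilon> a * (f a x * w x)" for x
        by (auto simp: dens_def max_def power2_eq_square algebra_simps)
      then have "integral {0..b} (\<lambda>x. f a x * dens a x) = ?S + integral {0..b} (\<lambda>x. \<epsilon> a * (f a x * w x))"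
        by (simp only:, intro Henstock_Kurzweil_Integration.integral_add int integrable_on_mult_right)
      then show ?thesis by (simp add: fw)
    qed
    \<comment> \<open>the Cauchy-Schwarz inequality, as the nonnegativity of a variance\<close>
    have S: "(B a)\<^sup>2 / \<mu> \<le> ?S"
    proof -
      have "0 \<le> integral {0..b} (\<lambda>x. (max 0 (f a x) - \<epsilon> a)\<^sup>2 * w x)"
        by (intro Henstock_Kurzweil_Integration.integral_nonneg integrable_continuous_real continuous_intros cf cR)
          (auto intro!: mult_nonneg_nonneg w_nn)
      also have "(\<lambda>x. (max 0 (f a x) - \<epsilon> a)\<^sup>2 * w x) =
          (\<lambda>x. (max 0 (f a x))\<^sup>2 * w x + ((\<epsilon> a)\<^sup>2 * w x - 2 * \<epsilon> a * (max 0 (f a x) * w x)))"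
        by (auto simp: power2_eq_square algebra_simps)
      also have "integral {0..b} \<dots> = ?S + integral {0..b} (\<lambda>x. (\<epsilon> a)\<^sup>2 * w x - 2 * \<epsilon> a * (max 0 (f a x) * w x))"
        by (intro Henstock_Kurzweil_Integration.integral_add int integrable_on_mult_right Henstock_Kurzweil_Integration.integrable_diff)
      also have "integral {0..b} (\<lambda>x. (\<epsilon> a)\<^sup>2 * w x - 2 * \<epsilon> a * (max 0 (f a x) * w x)) = (\<epsilon> a)\<^sup>2 * \<mu> - 2 * \<epsilon> a * B a"
        unfolding B_def \<mu>_def
        by (subst Henstock_Kurzweil_Integration.integral_diff) (auto intro!: int integrable_on_mult_right)
      finally show ?thesis using \<mu> by (simp add: \<epsilon>a power2_eq_square field_simps)
    qed
    \<comment> \<open>Each cell between consecutive quantiles has the mass \<open>\<Phi> a b / M\<close>.\<close>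
    have cell: "integral {y a j..y a (Suc j)} (\<lambda>x. f a x * dens a x)
        \<le> (f a (y a j) + integral {y a j..y a (Suc j)} (\<lambda>x. \<bar>f' a x\<bar>)) * (\<Phi> a b / real M)" if "j < M" for j
    proof -
      let ?l = "y a j" and ?r = "y a (Suc j)"
      have lr: "0 \<le> ?l" "?l < ?r" "?r \<le> b" using y_less[OF a, of j "Suc j"] y[OF a, of j] y[OF a, of "Suc j"] that by auto
      let ?c = "f a ?l + integral {?l..?r} (\<lambda>x. \<bar>f' a x\<bar>)"
      have "integral {?l..?r} (\<lambda>x. f a x * dens a x) \<le> integral {?l..?r} (\<lambda>x. ?c * dens a x)"
      proof (intro integral_le int integrable_on_mult_right mult_right_mono)
        fix x assume x: "x \<in> {?l..?r}"
        have "\<bar>f a x - f a ?l\<bar> \<le> integral {?l..x} (\<lambda>s. \<bar>f' a s\<bar>)"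
          using x by (intro abs_diff_le_integral_deriv[OF derf cf(2)]) auto
        also have "\<dots> \<le> integral {?l..?r} (\<lambda>s. \<bar>f' a s\<bar>)" using x by (intro integral_subset_le int) auto
        finally show "f a x \<le> ?c" by simp
        show "0 \<le> dens a x" using x lr \<epsilon>_pos[OF a] w_nn[of x] by (simp add: dens_def)
      qed
      also have "\<dots> = ?c * (\<Phi> a ?r - \<Phi> a ?l)" using \<Phi>_diff[of ?l ?r a] lr by simp
      also have "\<Phi> a ?r - \<Phi> a ?l = \<Phi> a b / real M"
        using y[OF a, of j] y[OF a, of "Suc j"] that by (simp add: divide_simps algebra_simps)
      finally show ?thesis .
    qed
    have mono: "y a j \<le> y a (Suc j)" if "j < M" for j using y_less[OF a, of j "Suc j"] that by simp
    have "?S = (\<Sum>j<M. integral {y a j..y a (Suc j)} (\<lambda>x. f a x * dens a x))"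
      using sum_integral_cells[of "\<lambda>x. f a x * dens a x" M "y a"] mono y_ends[OF a] fd by (simp add: continuous_intros cf cd)
    also have "\<dots> \<le> (\<Sum>j<M. (f a (y a j) + integral {y a j..y a (Suc j)} (\<lambda>x. \<bar>f' a x\<bar>)) * (\<Phi> a b / real M))"
      by (intro sum_mono cell) auto
    also have "\<dots> = ((\<Sum>j<M. f a (y a j)) + ?V) * (\<Phi> a b / real M)"
    proof -
      have "(\<Sum>j<M. integral {y a j..y a (Suc j)} (\<lambda>x. \<bar>f' a x\<bar>)) = ?V"
        using sum_integral_cells[of "\<lambda>x. \<bar>f' a x\<bar>" M "y a"] mono y_ends[OF a] by (simp add: continuous_intros cf)
      then show ?thesis by (simp only: sum_distrib_right[symmetric] sum.distrib)
    qed
    \<comment> \<open>The left end of the first cell is \<open>0\<close>, where \<open>f a\<close> vanishes.\<close>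
    also have "(\<Sum>j<M. f a (y a j)) = (\<Sum>j=1..N. f a (y a j))"
    proof -
      have "{..<M} = insert 0 {1..N}" by (auto simp: M_def)
      then show ?thesis using y_ends[OF a] by (simp add: f0)
    qed
    finally have "(B a)\<^sup>2 / \<mu> \<le> ((\<Sum>j=1..N. f a (y a j)) + ?V) * (2 * B a / real M)"
      using S \<Phi>2 by simp
    then have "B a * real M / (2 * \<mu>) \<le> (\<Sum>j=1..N. f a (y a j)) + ?V"
    proof -
      define T where "T = (\<Sum>j=1..N. f a (y a j)) + ?V"
      assume "(B a)\<^sup>2 / \<mu> \<le> ((\<Sum>j=1..N. f a (y a j)) + ?V) * (2 * B a / real M)"
      then have "B a * (B a * real M / (2 * \<mu>)) \<le> B a * T"
        unfolding T_def[symmetric] using \<mu> by (simp add: M_def power2_eq_square field_simps)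
      then show ?thesis by (simp only: mult_le_cancel_left_pos[OF Bp] T_def)
    qed
    moreover have "\<bar>f a b\<bar> \<le> ?V" using abs_diff_le_integral_deriv[OF derf cf(2), of 0 b a] b f0 by simp
    moreover have "?V \<le> 2 * K * B a" using var[of a] absf[of a] by simp
    moreover have "3 * K * B a < B a * real M / (2 * \<mu>)"
    proof -
      have "B a * (6 * \<mu> * K) < B a * real M" using N Bp by (simp add: M_def \<mu>_def)
      then show ?thesis using \<mu> by (simp add: field_simps)
    qed
    ultimately have "0 < (\<Sum>j=1..N. f a (y a j)) + f a b / 2" by linarith
    also have "\<dots> = (\<Sum>i<n. a i * G a i)"
    proof -
      have "(\<Sum>j=1..N. f a (y a j)) = (\<Sum>i<n. a i * (\<Sum>j=1..N. e i (y a j)))"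
        unfolding f_def sum_distrib_left by (rule sum.swap)
      then show ?thesis by (simp add: f_def G_def ring_distribs sum.distrib sum_divide_distrib)
    qed
    finally show "0 < (\<Sum>i<n. a i * G a i)" .
  qed
  then obtain a where a: "a \<in> Q" and G0: "\<forall>i<n. G a i = 0" by (auto simp: Q_def)
  have "0 < y a j \<and> y a j < b" if "j \<in> {1..N}" for j
    using y_less[OF a, of 0 j] y_less[OF a, of j M] y_ends[OF a] that by (auto simp: M_def)
  moreover have "inj_on (y a) {1..N}"
    using y_less[OF a] by (intro linorder_inj_onI) (auto simp: M_def, metis le_SucI less_irrefl)
  moreover have "\<forall>i<n. (\<Sum>j=1..N. e i (y a j)) + e i b / 2 = 0" using G0 by (simp add: G_def)
  ultimately show ?thesis by (intro exI[of _ "y a"]) blast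
qed

section \<open>Quadrature nodes for the latitudes\<close>

text \<open>
  All frequencies have the parity of \<open>n\<close>, so that multiplication by the cosine
  leads from \<open>n\<close> to \<open>n + 1\<close>.
\<close>

definition sine_sums :: "nat \<Rightarrow> (real \<Rightarrow> real) set" where
  "sine_sums n = {f. \<exists>b. f = (\<lambda>x. \<Sum>k | k \<le> n \<and> even (k + n). b k * sin (real k * x))}"

lemma sine_sums_sin: "k \<le> n \<Longrightarrow> even (k + n) \<Longrightarrow> (\<lambda>x. c * sin (real k * x)) \<in> sine_sums n"
  unfolding sine_sums_def
  by (intro CollectI exI[of _ "\<lambda>i. if i = k then c else 0"] ext)
     (simp add: if_distrib[of "\<lambda>c. c * _"] sum.delta cong: if_cong)

lemma sine_sums_add: "f \<in> sine_sums n \<Longrightarrow> g \<in> sine_sums n \<Longrightarrow> (\<lambda>x. f x + g x) \<in> sine_sums n"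
proof -
  assume "f \<in> sine_sums n" "g \<in> sine_sums n"
  then obtain b c where "f = (\<lambda>x. \<Sum>k | k \<le> n \<and> even (k + n). b k * sin (real k * x))"
    "g = (\<lambda>x. \<Sum>k | k \<le> n \<and> even (k + n). c k * sin (real k * x))" by (auto simp: sine_sums_def)
  then show ?thesis unfolding sine_sums_def
    by (intro CollectI exI[of _ "\<lambda>i. b i + c i"]) (simp add: ring_distribs sum.distrib)
qed

lemma sine_sums_scale: "f \<in> sine_sums n \<Longrightarrow> (\<lambda>x. c * f x) \<in> sine_sums n"
proof -
  assume "f \<in> sine_sums n"
  then obtain b where "f = (\<lambda>x. \<Sum>k | k \<le> n \<and> even (k + n). b k * sin (real k * x))" by (auto simp: sine_sums_def)
  then show ?thesis unfolding sine_sums_def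
    by (intro CollectI exI[of _ "\<lambda>i. c * b i"]) (simp add: sum_distrib_left mult.assoc)
qed

lemma sine_sums_sum: "(\<And>i. i \<in> I \<Longrightarrow> f i \<in> sine_sums n) \<Longrightarrow> (\<lambda>x. \<Sum>i\<in>I. f i x) \<in> sine_sums n"
proof (induction I rule: infinite_finite_induct)
  case (insert i I)
  then show ?case by (simp add: sine_sums_add)
qed (auto simp: sine_sums_def intro!: exI[of _ "\<lambda>_. 0"])

lemma sine_sums_mult_cos: "f \<in> sine_sums n \<Longrightarrow> (\<lambda>x. cos x * f x) \<in> sine_sums (Suc n)"
proof -
  assume "f \<in> sine_sums n"
  then obtain b where b: "f = (\<lambda>x. \<Sum>k | k \<le> n \<and> even (k + n). b k * sin (real k * x))" by (auto simp: sine_sums_def)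
  have "(\<lambda>x. cos x * (b k * sin (real k * x))) \<in> sine_sums (Suc n)" if k: "k \<le> n" "even (k + n)" for k
  proof (cases k)
    case 0
    then show ?thesis using sine_sums_sum[of "{}"] by simp
  next
    case (Suc j)
    have "cos x * (b k * sin (real k * x)) = b k / 2 * sin (real (Suc k) * x) + b k / 2 * sin (real j * x)" for x
    proof -
      have "real (Suc k) * x = real k * x + x" "real j * x = real k * x - x" by (simp_all add: Suc algebra_simps)
      then show ?thesis by (simp only: sin_add sin_diff) (simp add: algebra_simps)
    qed
    then show ?thesis using k Suc by (simp only:) (intro sine_sums_add sine_sums_sin, auto)
  qed
  then show ?thesis unfolding b sum_distrib_left by (intro sine_sums_sum) auto
qed

lemma sin_cos_power_sine_sums: "(\<lambda>x. sin x * cos x ^ j) \<in> sine_sums (Suc j)"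
proof (induction j)
  case 0
  then show ?case using sine_sums_sin[of 1 1 1] by simp
next
  case (Suc j)
  from sine_sums_mult_cos[OF this] show ?case by (simp add: mult_ac)
qed

lemma sine_sums_mono: "f \<in> sine_sums n \<Longrightarrow> n \<le> m \<Longrightarrow> even (n + m) \<Longrightarrow> f \<in> sine_sums m"
proof -
  assume f: "f \<in> sine_sums n" "n \<le> m" "even (n + m)"
  then obtain b where b: "f = (\<lambda>x. \<Sum>k | k \<le> n \<and> even (k + n). b k * sin (real k * x))" by (auto simp: sine_sums_def)
  show ?thesis unfolding b using f by (intro sine_sums_sum sine_sums_sin) auto
qed

text \<open>
  Up to normalization, \<open>trig_moment p q\<close> is the moment of order \<open>p\<close> of
  the variable \<open>z = cos x\<close> with density \<open>(1 - z\<^sup>2) powr ((q - 1) /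
  2)\<close> on \<open>[0, 1]\<close>.
\<close>

definition trig_moment :: "nat \<Rightarrow> nat \<Rightarrow> real" where
  "trig_moment p q = integral {0..pi / 2} (\<lambda>x. cos x ^ p * sin x ^ q)"

lemma trig_moment_0_pos: "0 < trig_moment 0 q"
  unfolding trig_moment_def
  by (rule integral_pos_continuous) (auto intro!: continuous_intros zero_less_power sin_gt_zero)

text \<open>
  Heights that integrate the even powers up to \<open>2 * t\<close> exactly when a height
  \<open>z\<close> has the weight \<open>sqrt (1 - z\<^sup>2)\<close>; odd powers are integrated
  by symmetry. The height \<open>0\<close> is demanded since the equator will connect the
  parallels.
\<close>

definition quadrature_nodes :: "nat \<Rightarrow> nat \<Rightarrow> real set \<Rightarrow> bool" where
  "quadrature_nodes m t Z \<longleftrightarrow>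
     finite Z \<and> 0 \<in> Z \<and> (\<forall>z\<in>Z. - 1 < z \<and> z < 1 \<and> - z \<in> Z) \<and>
     (\<forall>i\<le>t. (\<Sum>z\<in>Z. sqrt (1 - z\<^sup>2) * z ^ (2 * i)) =
        (\<Sum>z\<in>Z. sqrt (1 - z\<^sup>2)) * (trig_moment (2 * i) m / trig_moment 0 m))"

text \<open>
  The equal-weight nodes \<open>y j\<close> for the functions \<open>sin x * (cos x ^ (2 * i) -
  \<kappa> i)\<close>, \<open>i = 1, \<dots>, t\<close>, on \<open>[0, pi / 2]\<close> give the
  heights \<open>cos (y j)\<close>, \<open>- cos (y j)\<close> and \<open>0\<close>. Here
  \<open>\<kappa> i\<close> is the desired mean value of \<open>z ^ (2 * i)\<close>; the height
  \<open>0\<close> occurs only once, which is why the end point \<open>pi / 2\<close> enters the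
  quadrature formula with half the weight.
\<close>

lemma quadrature_nodes_exist:
  "\<exists>C>0. \<forall>t\<ge>1. \<exists>Z. quadrature_nodes (e + 1) t Z \<and> real (card Z) \<le> C * real t ^ (e + 1)"
proof -
  \<comment> \<open>The number of nodes has to exceed \<open>6 * (\<integral>w) * K\<close>, where the weight has integral at most \<open>2\<close> and
    \<open>K = 2 * pi ^ e * (2 * t + 1) ^ (e + 1)\<close> comes from Bernstein's inequality; moreover \<open>2 * t + 1 \<le> 3 * t\<close>.\<close>
  define C where "C = 24 * pi ^ e * 3 ^ (e + 1)"
  have C: "0 < C" by (simp add: C_def)
  show ?thesis
  proof (intro exI[of _ "2 * C + 3"] conjI allI impI)
    show "0 < 2 * C + 3" using C by simp
    fix t :: nat assume t: "t \<ge> 1"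
    define \<kappa> where "\<kappa> i = trig_moment (2 * i) (e + 1) / trig_moment 0 (e + 1)" for i
    define f where "f i x = sin x * (cos x ^ (2 * Suc i) - \<kappa> (Suc i))" for i x
    define f' where "f' i x = cos x * (cos x ^ (2 * Suc i) - \<kappa> (Suc i)) +
       sin x * (- (real (2 * Suc i) * cos x ^ (2 * Suc i - 1) * sin x))" for i x
    have der: "(f i has_real_derivative f' i x) (at x)" for i x
    proof -
      have "((\<lambda>x. sin x * (cos x ^ m - c)) has_real_derivative
          cos x * (cos x ^ m - c) + sin x * (- (real m * cos x ^ (m - 1) * sin x))) (at x)" for m c
        by (auto intro!: derivative_eq_intros)
      then show ?thesis unfolding f_def f'_def .
    qed
    define N where "N = nat \<lceil>C * real t ^ (e + 1)\<rceil>"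
    have NC: "C * real t ^ (e + 1) \<le> real N" "real N \<le> C * real t ^ (e + 1) + 1"
      using C by (simp_all add: N_def)
    have "\<exists>y. (\<forall>j\<in>{1..N}. 0 < y j \<and> y j < pi / 2) \<and> inj_on y {1..N} \<and>
      (\<forall>i<t. (\<Sum>j=1..N. f i (y j)) + f i (pi / 2) / 2 = 0)"
    proof (rule equal_weight_nodes[where w = "\<lambda>x. sin x ^ e" and K = "2 * pi ^ e * real (2 * t + 1) ^ (e + 1)"])
      show "(f i has_real_derivative f' i x) (at x)" for i x by (rule der)
      show "continuous_on UNIV (f' i)" for i unfolding f'_def by (intro continuous_intros)
      show "integral {0..pi / 2} (\<lambda>x. f i x * sin x ^ e) = 0" for i
      proof -
        have "integral {0..pi / 2} (\<lambda>x. f i x * sin x ^ e) =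
           integral {0..pi / 2} (\<lambda>x. cos x ^ (2 * Suc i) * sin x ^ (e + 1) - \<kappa> (Suc i) * (cos x ^ 0 * sin x ^ (e + 1)))"
          by (simp add: f_def algebra_simps)
        also have "\<dots> = trig_moment (2 * Suc i) (e + 1) - \<kappa> (Suc i) * trig_moment 0 (e + 1)"
          unfolding trig_moment_def
          by (subst Henstock_Kurzweil_Integration.integral_diff)
             (auto intro!: integrable_continuous_real continuous_intros)
        also have "\<dots> = 0" using trig_moment_0_pos[of "e + 1"] by (simp add: \<kappa>_def)
        finally show ?thesis .
      qed
      show "\<exists>x\<in>{0..pi / 2}. (\<Sum>i<t. a i * f i x) \<noteq> 0" if "\<exists>i<t. a i \<noteq> 0" for a
      proof (rule ccontr)
        assume "\<not> ?thesis"
        then have z: "(\<Sum>i<t. a i * f i x) = 0" if "0 \<le> x" "x \<le> pi / 2" for x using that by auto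
        define c where "c i = (case i of 0 \<Rightarrow> - (\<Sum>i<t. a i * \<kappa> (Suc i)) | Suc i \<Rightarrow> a i)" for i
        have "{0<..<1} \<subseteq> {u :: real. (\<Sum>i\<le>t. c i * u ^ i) = 0}"
        proof
          fix u :: real assume "u \<in> {0<..<1}"
          then have u: "0 < u" "u < 1" by auto
          define x where "x = arccos (sqrt u)"
          have su: "0 < sqrt u" "sqrt u < 1" using u by auto
          have cx: "cos x = sqrt u" unfolding x_def by (rule cos_arccos) (use su in linarith)+
          have x: "0 < x" "x < pi / 2"
            using arccos_lt_bounded[of "sqrt u"] arccos_less_arccos[of 0 "sqrt u"] su by (auto simp: x_def)
          have "sin x * (\<Sum>i\<le>t. c i * u ^ i) = (\<Sum>i<t. a i * f i x)"
          proof -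
            have "(\<Sum>i\<le>t. c i * u ^ i) = c 0 + (\<Sum>i<t. a i * u ^ Suc i)"
              by (subst sum.atMost_shift) (simp add: c_def)
            also have "\<dots> = (\<Sum>i<t. a i * (u ^ Suc i - \<kappa> (Suc i)))"
              by (simp add: c_def sum_subtractf right_diff_distrib)
            finally have A: "(\<Sum>i\<le>t. c i * u ^ i) = (\<Sum>i<t. a i * (u ^ Suc i - \<kappa> (Suc i)))" .
            have B: "cos x ^ (2 * m) = u ^ m" for m using u by (simp add: power_mult cx)
            show ?thesis unfolding A f_def sum_distrib_left by (intro sum.cong refl) (simp only: B mult.left_commute)
          qed
          moreover have "sin x > 0" using x by (intro sin_gt_zero) auto
          ultimately show "u \<in> {u. (\<Sum>i\<le>t. c i * u ^ i) = 0}" using z[of x] x by simp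
        qed
        then have "infinite {u :: real. (\<Sum>i\<le>t. c i * u ^ i) = 0}"
          using infinite_Ioo[of "0::real" 1] finite_subset by (metis zero_less_one)
        then have "\<forall>i\<le>t. c i = 0" using polyfun_finite_roots[of c t] by blast
        then have "c (Suc i) = 0" if "i < t" for i using that by (metis Suc_leI)
        then have "\<forall>i<t. a i = 0" by (simp add: c_def)
        with that show False by blast
      qed
      show "integral {0..pi / 2} (\<lambda>x. \<bar>\<Sum>i<t. a i * f' i x\<bar>)
         \<le> 2 * pi ^ e * real (2 * t + 1) ^ (e + 1) * integral {0..pi / 2} (\<lambda>x. \<bar>\<Sum>i<t. a i * f i x\<bar> * sin x ^ e)" for a
      proof -
        have fi: "f i \<in> sine_sums (2 * t + 1)" if "i < t" for i
        proof -
          have "f i = (\<lambda>x. sin x * cos x ^ (2 * Suc i) + (- \<kappa> (Suc i)) * (sin x * cos x ^ 0))"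
            by (auto simp: f_def algebra_simps)
          also have "\<dots> \<in> sine_sums (2 * t + 1)"
            by (intro sine_sums_add sine_sums_scale sine_sums_mono[OF sin_cos_power_sine_sums]) (use that in auto)
          finally show ?thesis .
        qed
        then have "(\<lambda>x. \<Sum>i<t. a i * f i x) \<in> sine_sums (2 * t + 1)"
          by (intro sine_sums_sum sine_sums_scale) auto
        then obtain b where b: "(\<lambda>x. \<Sum>i<t. a i * f i x) =
            (\<lambda>x. \<Sum>k | k \<le> 2 * t + 1 \<and> even (k + (2 * t + 1)). b k * sin (real k * x))"
          unfolding sine_sums_def by blast
        have b': "(\<Sum>i<t. a i * f' i x) = (\<Sum>k | k \<le> 2 * t + 1 \<and> even (k + (2 * t + 1)). b k * (real k * cos (real k * x)))" for x
        proof (rule DERIV_unique)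
          show "((\<lambda>x. \<Sum>i<t. a i * f i x) has_real_derivative (\<Sum>i<t. a i * f' i x)) (at x)"
            by (auto intro!: derivative_eq_intros der simp: mult.commute)
          show "((\<lambda>x. \<Sum>i<t. a i * f i x) has_real_derivative
              (\<Sum>k | k \<le> 2 * t + 1 \<and> even (k + (2 * t + 1)). b k * (real k * cos (real k * x)))) (at x)"
            unfolding b by (auto intro!: derivative_eq_intros sum.cong)
        qed
        show ?thesis unfolding b' fun_cong[OF b]
          by (rule bernstein_L1_weighted) auto
      qed
      show "6 * integral {0..pi / 2} (\<lambda>x. sin x ^ e) * (2 * pi ^ e * real (2 * t + 1) ^ (e + 1)) < real (N + 1)"
      proof -
        have "integral {0..pi / 2} (\<lambda>x. sin x ^ e) \<le> integral {0..pi / 2} (\<lambda>x. 1)"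
          by (intro integral_le integrable_continuous_real continuous_intros) (auto intro!: power_le_one sin_ge_zero)
        also have "\<dots> \<le> 2" using pi_less_4 by simp
        finally have "6 * integral {0..pi / 2} (\<lambda>x. sin x ^ e) * (2 * pi ^ e * real (2 * t + 1) ^ (e + 1)) \<le>
          6 * 2 * (2 * pi ^ e * real (2 * t + 1) ^ (e + 1))"
          by (intro mult_right_mono mult_left_mono) auto
        also have "\<dots> \<le> 6 * 2 * (2 * pi ^ e * (3 * real t) ^ (e + 1))"
          using t by (intro mult_left_mono power_mono) auto
        also have "\<dots> = C * real t ^ (e + 1)" by (simp add: C_def power_mult_distrib)
        finally show ?thesis using NC(1) by simp
      qed
      show "\<And>x. 0 < x \<Longrightarrow> x \<le> pi / 2 \<Longrightarrow> 0 < sin x ^ e" by (intro zero_less_power sin_gt_zero) auto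
    qed (auto simp: f_def intro!: continuous_intros)
    then obtain y where y: "\<And>j. j \<in> {1..N} \<Longrightarrow> 0 < y j \<and> y j < pi / 2" and inj: "inj_on y {1..N}"
      and ys: "\<And>i. i < t \<Longrightarrow> (\<Sum>j=1..N. f i (y j)) + f i (pi / 2) / 2 = 0" by blast
    have cy: "0 < cos (y j)" "cos (y j) < 1" "sqrt (1 - (cos (y j))\<^sup>2) = sin (y j)" if "j \<in> {1..N}" for j
    proof -
      have "0 < y j" "y j < pi / 2" using y[OF that] by auto
      then show "0 < cos (y j)" "cos (y j) < 1" "sqrt (1 - (cos (y j))\<^sup>2) = sin (y j)"
        using cos_gt_zero[of "y j"] cos_monotone_0_pi[of 0 "y j"] sin_gt_zero[of "y j"]
        by (auto simp flip: sin_squared_eq)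
    qed
    define Y where "Y = (\<lambda>j. cos (y j)) ` {1..N}"
    have injc: "inj_on (\<lambda>j. cos (y j)) {1..N}"
    proof (rule inj_onI)
      fix i j assume "i \<in> {1..N}" "j \<in> {1..N}" "cos (y i) = cos (y j)"
      then show "i = j" using y[of i] y[of j] inj cos_inj_pi[of "y i" "y j"] by (auto dest: inj_onD)
    qed
    let ?Z = "insert 0 (Y \<union> uminus ` Y)"
    have Yb: "0 < z" "z < 1" if "z \<in> Y" for z using that cy by (auto simp: Y_def)
    have finY: "finite Y" by (simp add: Y_def)
    have sumZ: "(\<Sum>z\<in>?Z. g z) = g 0 + 2 * (\<Sum>j=1..N. g (cos (y j)))" if g: "\<And>z. g (- z) = g z" for g :: "real \<Rightarrow> real"
    proof -
      have "0 \<notin> Y \<union> uminus ` Y" using Yb by force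
      then have "(\<Sum>z\<in>?Z. g z) = g 0 + (\<Sum>z\<in>Y \<union> uminus ` Y. g z)" using finY by simp
      also have "(\<Sum>z\<in>Y \<union> uminus ` Y. g z) = (\<Sum>z\<in>Y. g z) + (\<Sum>z\<in>uminus ` Y. g z)"
      proof (intro sum.union_disjoint)
        have "z < 0" if "z \<in> uminus ` Y" for z using that Yb(1) by auto
        then show "Y \<inter> uminus ` Y = {}" using Yb(1) by (meson disjoint_iff order_less_asym)
      qed (use finY in auto)
      also have "(\<Sum>z\<in>uminus ` Y. g z) = (\<Sum>z\<in>Y. g z)" by (subst sum.reindex) (auto simp: g)
      also have "(\<Sum>z\<in>Y. g z) = (\<Sum>j=1..N. g (cos (y j)))" unfolding Y_def using injc by (simp add: sum.reindex)
      finally show ?thesis by simp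
    qed
    have "(\<Sum>z\<in>?Z. sqrt (1 - z\<^sup>2) * z ^ (2 * i)) = (\<Sum>z\<in>?Z. sqrt (1 - z\<^sup>2)) * \<kappa> i" if i: "i \<le> t" for i
    proof (cases i)
      case 0
      then show ?thesis using trig_moment_0_pos[of "e + 1"] by (simp add: \<kappa>_def)
    next
      case (Suc k)
      have "(\<Sum>z\<in>?Z. sqrt (1 - z\<^sup>2) * (z ^ (2 * i) - \<kappa> i)) =
         - \<kappa> i + 2 * (\<Sum>j=1..N. sqrt (1 - (cos (y j))\<^sup>2) * (cos (y j) ^ (2 * i) - \<kappa> i))"
        by (subst sumZ) (auto simp: Suc)
      also have "(\<Sum>j=1..N. sqrt (1 - (cos (y j))\<^sup>2) * (cos (y j) ^ (2 * i) - \<kappa> i)) = (\<Sum>j=1..N. f k (y j))"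
        by (intro sum.cong refl) (simp only: cy f_def Suc)
      also have "\<dots> = - f k (pi / 2) / 2" using ys[of k] i Suc by simp
      also have "f k (pi / 2) = - \<kappa> i" by (simp add: f_def Suc)
      finally have "(\<Sum>z\<in>?Z. sqrt (1 - z\<^sup>2) * (z ^ (2 * i) - \<kappa> i)) = 0" by simp
      then show ?thesis by (simp only: right_diff_distrib sum_subtractf sum_distrib_right)
    qed
    moreover have "real (card ?Z) \<le> (2 * C + 3) * real t ^ (e + 1)"
    proof -
      have "card Y \<le> N" using card_image_le[of "{1..N}" "\<lambda>j. cos (y j)"] by (simp add: Y_def)
      moreover have "card (uminus ` Y) \<le> card Y" using finY by (rule card_image_le)
      ultimately have "card (Y \<union> uminus ` Y) \<le> 2 * N" using card_Un_le[of Y "uminus ` Y"] by linarith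
      moreover have "card ?Z \<le> Suc (card (Y \<union> uminus ` Y))" by (rule card_insert_le_m1) auto
      ultimately have "real (card ?Z) \<le> 2 * real N + 1" by linarith
      also have "\<dots> \<le> 2 * C * real t ^ (e + 1) + 3 * 1" using NC(2) by simp
      also have "\<dots> \<le> 2 * C * real t ^ (e + 1) + 3 * real t ^ (e + 1)"
        using t by (intro add_left_mono mult_left_mono one_le_power) auto
      finally show ?thesis by (simp add: ring_distribs)
    qed
    moreover have "\<forall>z\<in>?Z. - 1 < z \<and> z < 1 \<and> - z \<in> ?Z"
    proof
      fix z assume "z \<in> ?Z"
      then consider "z = 0" | "z \<in> Y" | y where "y \<in> Y" "z = - y" by blast
      then show "- 1 < z \<and> z < 1 \<and> - z \<in> ?Z"
      proof cases
        case 2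
        then show ?thesis using Yb[of z] by simp
      next
        case 3
        then show ?thesis using Yb[of y] by simp
      qed simp
    qed
    moreover have "finite ?Z" "0 \<in> ?Z" using finY by simp_all
    ultimately show "\<exists>Z. quadrature_nodes (e + 1) t Z \<and> real (card Z) \<le> (2 * C + 3) * real t ^ (e + 1)"
      unfolding quadrature_nodes_def \<kappa>_def by blast
  qed
qed

section \<open>Rotation invariance of the spherical average\<close>

text \<open>
  By Vitali's covering theorem an open set is a disjoint union of balls and a null set, and an
  orthogonal map takes balls to balls of the same radius.
\<close>

lemma emeasure_orthogonal_image_open:
  fixes g :: "'a::euclidean_space \<Rightarrow> 'a"
  assumes g: "orthogonal_transformation g" and S: "open S"
  shows "emeasure lborel (g ` S) = emeasure lborel S"
proof -
  have null: "N \<in> null_sets lborel" if "negligible N" "N \<in> sets borel" for N :: "'a set"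
    using that by (simp add: negligible_iff_null_sets null_sets_completion_iff)
  define K where "K = {p :: 'a \<times> real. 0 < snd p \<and> ball (fst p) (snd p) \<subseteq> S}"
  have ex: "\<exists>i. i \<in> K \<and> x \<in> ball (fst i) (snd i) \<and> snd i < d" if "x \<in> S" "0 < d" for x d
  proof -
    obtain r where r: "0 < r" "ball x r \<subseteq> S" using S \<open>x \<in> S\<close> openE by blast
    have "ball x (min r (d / 2)) \<subseteq> S" using r(2) subset_ball[of "min r (d / 2)" r x] by simp
    then have "(x, min r (d / 2)) \<in> K" using r(1) that(2) by (simp add: K_def)
    moreover have "x \<in> ball x (min r (d / 2))" "min r (d / 2) < d" using r(1) that(2) by auto
    ultimately show ?thesis by (intro exI[of _ "(x, min r (d / 2))"]) simp
  qed
  obtain C where C: "countable C" "C \<subseteq> K"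
    and pw: "pairwise (\<lambda>i j. disjnt (ball (fst i) (snd i)) (ball (fst j) (snd j))) C"
    and neg: "negligible (S - (\<Union>i\<in>C. ball (fst i) (snd i)))"
    using Vitali_covering_theorem_balls[of S K fst snd, OF ex] by blast
  let ?U = "\<Union>i\<in>C. ball (fst i) (snd i)"
  have lin: "linear g" using g by (rule orthogonal_transformation_linear)
  have inj: "inj g" using g by (rule orthogonal_transformation_inj)
  have gS: "open (g ` S)" 
  proof -
    have "linear (inv g)" using orthogonal_transformation_linear[OF orthogonal_transformation_inv[OF g]] .
    then have "open (inv g -` S)"
      using S by (intro open_vimage linear_continuous_on) (auto simp: linear_conv_bounded_linear)
    moreover have bij: "bij g" using g by (rule orthogonal_transformation_bij)
    then have "inv g -` S = g ` S"
      by (metis bij_imp_bij_inv bij_vimage_eq_inv_image inv_inv_eq)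
    ultimately show ?thesis by simp
  qed
  have gball: "g ` ball c r = ball (g c) r" for c r
    using image_orthogonal_transformation_ball[OF g] by auto
  have gU: "g ` ?U = (\<Union>i\<in>C. ball (g (fst i)) (snd i))" by (simp add: image_UN gball)
  have gneg: "negligible (g ` (S - ?U))"
    using neg by (intro negligible_differentiable_image_negligible[OF order_refl neg])
      (auto intro: linear_imp_differentiable_on lin)
  have "S \<in> sets borel" "?U \<in> sets borel" using S by (auto intro!: borel_open)
  then have N: "S - ?U \<in> null_sets lborel" using neg by (intro null sets.Diff)
  have "g ` S \<in> sets borel" "g ` ?U \<in> sets borel" using gS by (auto simp: gU intro!: borel_open)
  then have "g ` (S - ?U) \<in> sets borel" unfolding image_set_diff[OF inj] by (rule sets.Diff)
  then have gN: "g ` (S - ?U) \<in> null_sets lborel" using gneg by (intro null)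
  have "?U \<subseteq> S" using C(2) by (auto simp: K_def)
  then have S_eq: "S = ?U \<union> (S - ?U)" by blast
  have "emeasure lborel S = emeasure lborel ?U"
    by (subst S_eq, rule emeasure_Un_null_set[OF _ N]) (auto intro!: borel_open open_UN)
  also have "\<dots> = (\<integral>\<^sup>+i. emeasure lborel (ball (fst i) (snd i)) \<partial>count_space C)"
    using C(1) pw by (intro emeasure_UN_countable)
      (auto simp: disjoint_family_on_def pairwise_def disjnt_def)
  also have "\<dots> = (\<integral>\<^sup>+i. emeasure lborel (ball (g (fst i)) (snd i)) \<partial>count_space C)"
    using C(2) by (intro nn_integral_cong) (auto simp: K_def emeasure_ball subset_iff less_imp_le)
  also have "\<dots> = emeasure lborel (\<Union>i\<in>C. ball (g (fst i)) (snd i))"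
  proof (intro emeasure_UN_countable[symmetric])
    show "disjoint_family_on (\<lambda>i. ball (g (fst i)) (snd i)) C"
      unfolding disjoint_family_on_def
    proof (intro ballI impI)
      fix i j assume "i \<in> C" "j \<in> C" "i \<noteq> j"
      then have "ball (fst i) (snd i) \<inter> ball (fst j) (snd j) = {}"
        using pw by (auto simp: pairwise_def disjnt_def)
      then have "g ` ball (fst i) (snd i) \<inter> g ` ball (fst j) (snd j) = {}"
        using inj by (metis image_Int image_empty)
      then show "ball (g (fst i)) (snd i) \<inter> ball (g (fst j)) (snd j) = {}" by (simp add: gball)
    qed
  qed (use C in auto)
  also have "\<dots> = emeasure lborel (g ` ?U \<union> g ` (S - ?U))"
    unfolding gU by (rule emeasure_Un_null_set[OF _ gN, symmetric]) (auto intro!: borel_open)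
  also have "g ` ?U \<union> g ` (S - ?U) = g ` S"
    unfolding image_Un[symmetric] using S_eq by presburger
  finally show ?thesis ..
qed

lemma lborel_distr_orthogonal:
  fixes g :: "'a::euclidean_space \<Rightarrow> 'a"
  assumes g: "orthogonal_transformation g"
  shows "distr lborel borel g = lborel"
proof (rule sym, rule lborel_eqI)
  fix l u :: 'a assume lu: "\<And>b. b \<in> Basis \<Longrightarrow> l \<bullet> b \<le> u \<bullet> b"
  have m: "g \<in> borel_measurable borel"
    using orthogonal_transformation_linear[OF g] by (intro borel_measurable_continuous_onI linear_continuous_on linear_conv_bounded_linear[THEN iffD1])
  have inv: "orthogonal_transformation (inv g)" using g by (rule orthogonal_transformation_inv)
  have "g -` box l u = inv g ` box l u"
    using orthogonal_transformation_bij[OF g] by (simp add: bij_vimage_eq_inv_image)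
  then have "emeasure (distr lborel borel g) (box l u) = emeasure lborel (inv g ` box l u)"
    using m by (simp add: emeasure_distr)
  also have "\<dots> = emeasure lborel (box l u)" by (rule emeasure_orthogonal_image_open[OF inv open_box])
  finally show "emeasure (distr lborel borel g) (box l u) = (\<Prod>b\<in>Basis. (u - l) \<bullet> b)"
    using lu by simp
qed simp

text \<open>
  The integral over the unit ball of the function that is constant on rays and agrees with
  \<open>f\<close> on the sphere; up to a constant factor this is the integral of
  \<open>f\<close> over the sphere.
\<close>

definition cone_integral :: "(real ^ 'n \<Rightarrow> real) \<Rightarrow> real" where
  "cone_integral f = (\<integral>x. indicat_real (cball 0 1 - {0}) x * f (x /\<^sub>R norm x) \<partial>lborel)"

lemma sphere_average_cone_integral:
  fixes f :: "real ^ 'n \<Rightarrow> real"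
  assumes "continuous_on UNIV f"
  shows "sphere_average f = cone_integral f / measure lborel (cball (0 :: real ^ 'n) 1)"
proof -
  have f[measurable]: "f \<in> borel_measurable borel" using assms by (rule borel_measurable_continuous_onI)
  have "integral\<^sup>L sphere_surface f = (\<integral>x. f (x /\<^sub>R norm x)
     \<partial>density lborel (\<lambda>x::real^'n. ennreal (real CARD('n) * indicat_real (cball 0 1 - {0}) x)))"
    unfolding sphere_surface_def by (subst integral_distr) auto
  also have "\<dots> = (\<integral>x. (real CARD('n) * indicat_real (cball 0 1 - {0}) x) *\<^sub>R f (x /\<^sub>R norm x) \<partial>lborel)"
    by (subst integral_density) (auto intro!: borel_measurable_times borel_measurable_indicator)
  also have "\<dots> = real CARD('n) * cone_integral f"
    by (simp add: cone_integral_def mult.assoc)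
  finally show ?thesis by (simp add: sphere_average_def measure_sphere_surface_sphere)
qed

lemma cone_integrable:
  fixes f :: "real ^ 'n \<Rightarrow> real"
  assumes "continuous_on UNIV f"
  shows "integrable lborel (\<lambda>x. indicat_real (cball 0 1 - {0}) x * f (x /\<^sub>R norm x))"
proof -
  have f[measurable]: "f \<in> borel_measurable borel" using assms by (rule borel_measurable_continuous_onI)
  have "compact (f ` sphere 0 1)" using assms by (intro compact_continuous_image) (auto intro: continuous_on_subset)
  then obtain B where B: "\<And>x. x \<in> sphere 0 1 \<Longrightarrow> \<bar>f x\<bar> \<le> B"
    using compact_imp_bounded bounded_iff by (metis imageI real_norm_def)
  have m: "cball (0::real^'n) 1 - {0} \<in> sets borel" by auto
  have "emeasure lborel (cball (0::real^'n) 1 - {0}) < \<infinity>"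
    by (rule le_less_trans[OF emeasure_mono]) (auto intro: emeasure_lborel_cball_finite simp flip: infinity_ennreal_def)
  then have "integrable lborel (\<lambda>x. B * indicat_real (cball (0::real^'n) 1 - {0}) x)"
    using m by (intro integrable_mult_right) (simp add: integrable_indicator_iff)
  then show ?thesis
  proof (rule Bochner_Integration.integrable_bound)
    show "AE x in lborel. norm (indicat_real (cball 0 1 - {0}) x * f (x /\<^sub>R norm x))
        \<le> norm (B * indicat_real (cball 0 1 - {0}) x)"
    proof (intro always_eventually allI)
      fix x :: "real ^ 'n"
      show "norm (indicat_real (cball 0 1 - {0}) x * f (x /\<^sub>R norm x)) \<le> norm (B * indicat_real (cball 0 1 - {0}) x)"
        using B[of "x /\<^sub>R norm x"] by (cases "x = 0") (auto simp: indicator_def)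
    qed
  qed (use m in measurable)
qed

lemma cone_integral_sum:
  fixes f :: "'i \<Rightarrow> real ^ 'n \<Rightarrow> real"
  assumes "\<And>i. i \<in> I \<Longrightarrow> continuous_on UNIV (f i)"
  shows "cone_integral (\<lambda>x. \<Sum>i\<in>I. c i * f i x) = (\<Sum>i\<in>I. c i * cone_integral (f i))"
proof -
  have "cone_integral (\<lambda>x. \<Sum>i\<in>I. c i * f i x) =
    (\<integral>x. (\<Sum>i\<in>I. c i * (indicat_real (cball 0 1 - {0}) x * f i (x /\<^sub>R norm x))) \<partial>lborel)"
    by (simp add: cone_integral_def sum_distrib_left mult_ac)
  also have "\<dots> = (\<Sum>i\<in>I. \<integral>x. c i * (indicat_real (cball 0 1 - {0}) x * f i (x /\<^sub>R norm x)) \<partial>lborel)"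
    by (intro Bochner_Integration.integral_sum integrable_mult_right cone_integrable assms)
  finally show ?thesis by (simp add: cone_integral_def)
qed

lemma cone_integral_orthogonal:
  fixes f :: "real ^ 'n \<Rightarrow> real" and g :: "real ^ 'n \<Rightarrow> real ^ 'n"
  assumes f: "continuous_on UNIV f" and g: "orthogonal_transformation g"
  shows "cone_integral (\<lambda>x. f (g x)) = cone_integral f"
proof -
  have fm[measurable]: "f \<in> borel_measurable borel" using f by (rule borel_measurable_continuous_onI)
  have lin: "linear g" using g by (rule orthogonal_transformation_linear)
  have gm: "g \<in> borel_measurable borel"
    by (intro borel_measurable_continuous_onI linear_continuous_on linear_conv_bounded_linear[THEN iffD1] lin)
  have "cone_integral f = (\<integral>x. indicat_real (cball 0 1 - {0}) x * f (x /\<^sub>R norm x) \<partial>distr lborel borel g)"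
    by (simp add: cone_integral_def lborel_distr_orthogonal[OF g])
  also have "\<dots> = (\<integral>x. indicat_real (cball 0 1 - {0}) (g x) * f (g x /\<^sub>R norm (g x)) \<partial>lborel)"
    using gm by (subst integral_distr) (auto intro!: borel_measurable_times borel_measurable_indicator)
  also have "\<dots> = cone_integral (\<lambda>x. f (g x))"
    unfolding cone_integral_def
  proof (intro Bochner_Integration.integral_cong refl)
    fix x
    have n: "norm (g x) = norm x" using g by (rule orthogonal_transformation_norm)
    then have "g x = 0 \<longleftrightarrow> x = 0" by (metis norm_eq_zero)
    then show "indicat_real (cball 0 1 - {0}) (g x) * f (g x /\<^sub>R norm (g x)) =
       indicat_real (cball 0 1 - {0}) x * f (g (x /\<^sub>R norm x))"
      by (simp add: n indicator_def linear_scale[OF lin])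
  qed
  finally show ?thesis ..
qed

text \<open>
  For \<open>c\<^sup>2 + s\<^sup>2 = 1\<close> this is the rotation with cosine \<open>c\<close>
  and sine \<open>s\<close> in the plane of the coordinates \<open>i\<close> and
  \<open>j\<close>.
\<close>

definition coord_rot :: "'n::finite \<Rightarrow> 'n \<Rightarrow> real \<Rightarrow> real \<Rightarrow> real ^ 'n \<Rightarrow> real ^ 'n" where
  "coord_rot i j c s x =
     (\<chi> k. if k = i then c * x $ i - s * x $ j else if k = j then s * x $ i + c * x $ j else x $ k)"

lemma sum_split_two:
  fixes h :: "'n::finite \<Rightarrow> 'a::comm_monoid_add"
  assumes "i \<noteq> j"
  shows "sum h UNIV = h i + (h j + sum h (UNIV - {i, j}))"
proof -
  have "sum h UNIV = h i + sum h (UNIV - {i})" by (rule sum.remove) auto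
  also have "sum h (UNIV - {i}) = h j + sum h (UNIV - {i} - {j})" using assms by (intro sum.remove) auto
  finally show ?thesis by (simp add: Diff_insert2[symmetric])
qed

lemma prod_split_two:
  fixes h :: "'n::finite \<Rightarrow> 'a::comm_monoid_mult"
  assumes "i \<noteq> j"
  shows "prod h UNIV = h i * (h j * prod h (UNIV - {i, j}))"
proof -
  have "prod h UNIV = h i * prod h (UNIV - {i})" by (rule prod.remove) auto
  also have "prod h (UNIV - {i}) = h j * prod h (UNIV - {i} - {j})" using assms by (intro prod.remove) auto
  finally show ?thesis by (simp add: Diff_insert2[symmetric])
qed

lemma linear_coord_rot: "linear (coord_rot i j c s)"
  by (rule linearI) (auto simp: coord_rot_def vec_eq_iff algebra_simps)

lemma orthogonal_coord_rot:
  fixes i j :: "'n::finite"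
  assumes "i \<noteq> j" "c\<^sup>2 + s\<^sup>2 = 1"
  shows "orthogonal_transformation (coord_rot i j c s)"
  unfolding orthogonal_transformation
proof (intro conjI linear_coord_rot allI)
  fix x :: "real ^ 'n"
  have "(norm (coord_rot i j c s x))\<^sup>2 = (c * x $ i - s * x $ j)\<^sup>2 + ((s * x $ i + c * x $ j)\<^sup>2 + (\<Sum>k\<in>UNIV - {i, j}. (x $ k)\<^sup>2))"
    unfolding power2_norm_eq_inner inner_vec_def inner_real_def power2_eq_square[symmetric]
    using assms(1) by (subst sum_split_two[OF assms(1)]) (auto simp: coord_rot_def intro!: sum.cong)
  also have "\<dots> = (c\<^sup>2 + s\<^sup>2) * (x $ i)\<^sup>2 + ((c\<^sup>2 + s\<^sup>2) * (x $ j)\<^sup>2 + (\<Sum>k\<in>UNIV - {i, j}. (x $ k)\<^sup>2))"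
    by (simp add: power2_eq_square algebra_simps)
  also have "\<dots> = (norm x)\<^sup>2"
    unfolding power2_norm_eq_inner inner_vec_def inner_real_def power2_eq_square[symmetric]
    using assms by (subst sum_split_two[OF assms(1)]) simp
  finally show "norm (coord_rot i j c s x) = norm x" by simp
qed

text \<open>
  The integral of \<open>x $ i ^ p * x $ j ^ q * w x\<close> does not change under rotation in
  the plane of the coordinates \<open>i\<close> and \<open>j\<close>. The identity says that its
  derivative at the angle \<open>0\<close> vanishes; the derivative is taken under the integral
  by dominated convergence.
\<close>

lemma cone_integral_rotation_derivative:
  fixes w :: "real ^ 'n \<Rightarrow> real"
  assumes ij: "i \<noteq> j" and cw: "continuous_on UNIV w"
    and inv: "\<And>c s x. w (coord_rot i j c s x) = w x"
    and bd: "\<And>x. norm x = 1 \<Longrightarrow> \<bar>w x\<bar> \<le> 1"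
  shows "real q * cone_integral (\<lambda>x. x $ i ^ (p + 1) * x $ j ^ (q - 1) * w x) =
     real p * cone_integral (\<lambda>x. x $ i ^ (p - 1) * x $ j ^ (q + 1) * w x)"
proof -
  define F where "F x = x $ i ^ p * x $ j ^ q * w x" for x :: "real ^ 'n"
  define DF where "DF x = real q * (x $ i ^ (p + 1) * x $ j ^ (q - 1) * w x) +
     (- real p) * (x $ i ^ (p - 1) * x $ j ^ (q + 1) * w x)" for x :: "real ^ 'n"
  define R where "R \<phi> = coord_rot i j (cos \<phi>) (sin \<phi>)" for \<phi> :: real
  have oR: "orthogonal_transformation (R \<phi>)" for \<phi> unfolding R_def using ij by (intro orthogonal_coord_rot) auto
  have cF: "continuous_on UNIV F" unfolding F_def by (intro continuous_intros cw)
  have cDF: "continuous_on UNIV DF" unfolding DF_def by (intro continuous_intros cw)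
  have cFR: "continuous_on UNIV (\<lambda>x. F (R \<phi> x))" for \<phi>
    by (rule continuous_on_compose2[OF cF])
      (auto simp: linear_continuous_on linear_conv_bounded_linear[symmetric] orthogonal_transformation_linear[OF oR])
  have Ri: "R \<phi> x $ i = cos \<phi> * x $ i - sin \<phi> * x $ j" "R \<phi> x $ j = sin \<phi> * x $ i + cos \<phi> * x $ j" for \<phi> x
    using ij by (auto simp: R_def coord_rot_def)
  have R0: "R 0 x = x" for x by (auto simp: R_def coord_rot_def vec_eq_iff)
  have der: "((\<lambda>\<phi>. F (R \<phi> x)) has_real_derivative DF (R \<phi> x)) (at \<phi>)" for x \<phi>
  proof -
    have "((\<lambda>\<phi>. (cos \<phi> * x $ i - sin \<phi> * x $ j) ^ p * (sin \<phi> * x $ i + cos \<phi> * x $ j) ^ q * w x) has_real_derivative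
      (real p * (cos \<phi> * x $ i - sin \<phi> * x $ j) ^ (p - 1) * (- (sin \<phi> * x $ i + cos \<phi> * x $ j)) * (sin \<phi> * x $ i + cos \<phi> * x $ j) ^ q +
       (cos \<phi> * x $ i - sin \<phi> * x $ j) ^ p * (real q * (sin \<phi> * x $ i + cos \<phi> * x $ j) ^ (q - 1) * (cos \<phi> * x $ i - sin \<phi> * x $ j))) * w x) (at \<phi>)"
      by (auto intro!: derivative_eq_intros simp: algebra_simps)
    then show ?thesis unfolding F_def DF_def Ri
      by (simp add: R_def inv algebra_simps)
  qed
  have DFb: "\<bar>DF x\<bar> \<le> real (p + q)" if x: "norm x = 1" for x
  proof -
    have c: "\<bar>x $ k\<bar> \<le> 1" for k using component_le_norm_cart[of x k] x by simp
    have B: "\<bar>x $ i ^ a * x $ j ^ b * w x\<bar> \<le> 1" for a b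
      unfolding abs_mult power_abs using c bd[OF x]
      by (intro mult_le_one power_le_one) auto
    have "\<bar>real q * A + (- real p) * A'\<bar> \<le> real (p + q)" if A: "\<bar>A\<bar> \<le> 1" "\<bar>A'\<bar> \<le> 1" for A A'
    proof -
      have "\<bar>real q * A\<bar> \<le> real q" "\<bar>(- real p) * A'\<bar> \<le> real p"
        using mult_left_mono[OF A(1), of "real q"] mult_left_mono[OF A(2), of "real p"] by (simp_all add: abs_mult)
      then show ?thesis by linarith
    qed
    then show ?thesis unfolding DF_def using B by blast
  qed
  define h where "h m = inverse (real (Suc m))" for m
  have h: "0 < h m" for m by (simp add: h_def)
  have h0: "h \<longlonglongrightarrow> 0" unfolding h_def by (rule LIMSEQ_inverse_real_of_nat)
  let ?I = "indicat_real (cball (0::real^'n) 1 - {0})"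
  let ?u = "\<lambda>m x. ?I x * ((F (R (h m) (x /\<^sub>R norm x)) - F (x /\<^sub>R norm x)) / h m)"
  have lim: "(\<lambda>m. \<integral>x. ?u m x \<partial>lborel) \<longlonglongrightarrow> (\<integral>x. ?I x * DF (x /\<^sub>R norm x) \<partial>lborel)"
  proof (rule integral_dominated_convergence[where w = "\<lambda>x. ?I x * real (p + q)"])
    show "(\<lambda>x. ?I x * DF (x /\<^sub>R norm x)) \<in> borel_measurable lborel"
      using cone_integrable[OF cDF] by (rule borel_measurable_integrable)
    have "continuous_on UNIV (\<lambda>x. (F (R (h m) x) - F x) / h m)" for m
      using h[of m] by (intro continuous_intros cF cFR) auto
    then show "?u m \<in> borel_measurable lborel" for m
      using borel_measurable_integrable[OF cone_integrable] by blast
    show "integrable lborel (\<lambda>x. ?I x * real (p + q))"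
      by (rule cone_integrable) (rule continuous_on_const)
    show "AE x in lborel. (\<lambda>m. ?u m x) \<longlonglongrightarrow> ?I x * DF (x /\<^sub>R norm x)"
    proof (intro always_eventually allI tendsto_mult tendsto_const)
      fix x
      have "((\<lambda>\<phi>. (F (R \<phi> (x /\<^sub>R norm x)) - F (R 0 (x /\<^sub>R norm x))) / (\<phi> - 0)) \<longlongrightarrow> DF (R 0 (x /\<^sub>R norm x))) (at 0)"
        using der[of "x /\<^sub>R norm x" 0] by (simp add: has_field_derivative_iff)
      then have "(\<lambda>m. (F (R (h m) (x /\<^sub>R norm x)) - F (x /\<^sub>R norm x)) / (h m - 0)) \<longlonglongrightarrow> DF (x /\<^sub>R norm x)"
        unfolding R0 tendsto_at_iff_sequentially
        by (auto simp: o_def dest!: spec[of _ h] intro: h0 simp: less_imp_neq[OF h, symmetric] h0)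
      then show "(\<lambda>m. (F (R (h m) (x /\<^sub>R norm x)) - F (x /\<^sub>R norm x)) / h m) \<longlonglongrightarrow> DF (x /\<^sub>R norm x)" by simp
    qed
    show "AE x in lborel. norm (?u m x) \<le> ?I x * real (p + q)" for m
    proof (intro always_eventually allI)
      fix x :: "real ^ 'n"
      show "norm (?u m x) \<le> ?I x * real (p + q)"
      proof (cases "x = 0")
        case False
        let ?y = "x /\<^sub>R norm x"
        have y: "norm (R \<phi> ?y) = 1" for \<phi> using False orthogonal_transformation_norm[OF oR] by simp
        have "norm (F (R (h m) ?y) - F (R 0 ?y)) \<le> real (p + q) * norm (h m - 0)"
          by (rule field_differentiable_bound[of UNIV _ "\<lambda>\<phi>. DF (R \<phi> ?y)"]) (use der DFb[OF y] in auto)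
        then have "\<bar>(F (R (h m) ?y) - F ?y) / h m\<bar> \<le> real (p + q)"
          using h[of m] by (simp add: R0 divide_simps abs_mult)
        then show ?thesis by (auto simp: indicator_def)
      qed simp
    qed
  qed
  have zero: "(\<integral>x. ?u m x \<partial>lborel) = 0" for m
  proof -
    have "(\<integral>x. ?u m x \<partial>lborel) = (\<integral>x. (?I x * F (R (h m) (x /\<^sub>R norm x)) - ?I x * F (x /\<^sub>R norm x)) / h m \<partial>lborel)"
      by (simp add: algebra_simps)
    also have "\<dots> = (cone_integral (\<lambda>x. F (R (h m) x)) - cone_integral F) / h m"
      unfolding cone_integral_def
      by (subst integral_divide_zero, subst Bochner_Integration.integral_diff) (auto intro!: cone_integrable[OF cF] cone_integrable[OF cFR])
    also have "\<dots> = 0" using cone_integral_orthogonal[OF cF oR] by simp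
    finally show ?thesis .
  qed
  have "(\<lambda>m. 0 :: real) \<longlonglongrightarrow> cone_integral DF"
    using lim unfolding zero by (simp only: cone_integral_def)
  then have "cone_integral DF = 0" by (simp add: LIMSEQ_const_iff)
  moreover have "cone_integral DF = real q * cone_integral (\<lambda>x. x $ i ^ (p + 1) * x $ j ^ (q - 1) * w x) +
     (- real p) * cone_integral (\<lambda>x. x $ i ^ (p - 1) * x $ j ^ (q + 1) * w x)"
  proof -
    let ?f = "\<lambda>b x. if b then x $ i ^ (p + 1) * x $ j ^ (q - 1) * w x else x $ i ^ (p - 1) * x $ j ^ (q + 1) * w x"
    have "continuous_on UNIV (?f b)" for b by (cases b) (simp_all add: continuous_intros cw)
    from cone_integral_sum[of "{True, False}" ?f "\<lambda>b. if b then real q else - real p", OF this]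
    show ?thesis by (simp add: DF_def[abs_def])
  qed
  ultimately show ?thesis by simp
qed

definition monomial_fun :: "('n::finite \<Rightarrow> nat) \<Rightarrow> real ^ 'n \<Rightarrow> real" where
  "monomial_fun a x = (\<Prod>i\<in>UNIV. x $ i ^ a i)"

lemma continuous_on_monomial_fun: "continuous_on A (monomial_fun a)"
  unfolding monomial_fun_def by (intro continuous_intros)

text \<open>
  The rotation derivative for the monomial in which a factor \<open>x $ i\<close> is replaced by
  \<open>x $ j\<close>.
\<close>

lemma cone_integral_monomial_swap:
  fixes a :: "'n::finite \<Rightarrow> nat"
  assumes ij: "i \<noteq> j" and ai: "1 \<le> a i"
  shows "real (a j + 1) * cone_integral (monomial_fun a) =
    (real (a i) - 1) * cone_integral (\<lambda>x. monomial_fun (a(i := a i - 2)) x * (x $ j)\<^sup>2)"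
proof -
  define w where "w x = (\<Prod>k\<in>UNIV - {i, j}. x $ k ^ a k)" for x :: "real ^ 'n"
  have m: "monomial_fun (a(i := p)) x = x $ i ^ p * (x $ j ^ a j * w x)" for p x
    unfolding monomial_fun_def w_def using ij by (subst prod_split_two[OF ij]) (auto intro!: prod.cong)
  have "real (a j + 1) * cone_integral (\<lambda>x. x $ i ^ ((a i - 1) + 1) * x $ j ^ ((a j + 1) - 1) * w x) =
     real (a i - 1) * cone_integral (\<lambda>x. x $ i ^ ((a i - 1) - 1) * x $ j ^ ((a j + 1) + 1) * w x)"
  proof (rule cone_integral_rotation_derivative[OF ij])
    show "continuous_on UNIV w" unfolding w_def by (intro continuous_intros)
    show "w (coord_rot i j c s x) = w x" for c s x by (simp add: w_def coord_rot_def)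
    show "\<bar>w x\<bar> \<le> 1" if "norm x = 1" for x
      unfolding w_def abs_prod power_abs
    proof (intro prod_le_1 conjI power_le_one)
      show "\<bar>x $ k\<bar> \<le> 1" for k using component_le_norm_cart[of x k] that by simp
    qed auto
  qed
  moreover have "(\<lambda>x. x $ i ^ ((a i - 1) + 1) * x $ j ^ ((a j + 1) - 1) * w x) = monomial_fun a"
    using m[of "a i"] ai by (auto simp: fun_eq_iff)
  moreover have "(\<lambda>x. x $ i ^ ((a i - 1) - 1) * x $ j ^ ((a j + 1) + 1) * w x) =
      (\<lambda>x. monomial_fun (a(i := a i - 2)) x * (x $ j)\<^sup>2)"
    by (auto simp: m fun_eq_iff power2_eq_square power_add mult_ac numeral_2_eq_2)
  ultimately show ?thesis using ai by (simp add: of_nat_diff)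
qed

text \<open>
  Sum the previous identity over all \<open>j \<noteq> i\<close>, and use that the squares of
  the coordinates add up to \<open>1\<close> on the sphere. The recursion determines all
  moments.
\<close>

lemma cone_integral_monomial_rec:
  fixes a :: "'n::finite \<Rightarrow> nat"
  assumes ai: "1 \<le> a i"
  shows "(real (sum a UNIV) + real CARD('n) - 2) * cone_integral (monomial_fun a) =
    (real (a i) - 1) * cone_integral (monomial_fun (a(i := a i - 2)))"
proof -
  let ?L = "cone_integral (monomial_fun a)"
  let ?b = "a(i := a i - 2)"
  let ?J = "\<lambda>j. cone_integral (\<lambda>x. monomial_fun ?b x * (x $ j)\<^sup>2)"
  have own: "(real (a i) - 1) * ?J i = (real (a i) - 1) * ?L"
  proof (cases "a i = 1")
    case False
    then have "a i = Suc (Suc (a i - 2))" using ai by simp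
    then have *: "z ^ (a i - 2) * z\<^sup>2 = z ^ a i" for z :: real
      by (metis add_2_eq_Suc' power_add)
    have "monomial_fun ?b x * (x $ i)\<^sup>2 = monomial_fun a x" for x
    proof -
      have "monomial_fun c x = x $ i ^ c i * (\<Prod>k\<in>UNIV - {i}. x $ k ^ c k)" for c
        unfolding monomial_fun_def by (rule prod.remove) auto
      then show ?thesis using *[of "x $ i"] by (simp add: mult_ac)
    qed
    then show ?thesis by simp
  qed simp
  have "(\<Sum>j\<in>UNIV. ?J j) = cone_integral (\<lambda>x. \<Sum>j\<in>UNIV. 1 * (monomial_fun ?b x * (x $ j)\<^sup>2))"
    by (subst cone_integral_sum) (auto intro!: continuous_intros continuous_on_monomial_fun)
  also have "\<dots> = cone_integral (monomial_fun ?b)"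
    unfolding cone_integral_def
  proof (intro Bochner_Integration.integral_cong refl)
    fix x :: "real ^ 'n"
    have "(\<Sum>j\<in>UNIV. (y $ j)\<^sup>2) = (norm y)\<^sup>2" for y :: "real ^ 'n"
      unfolding power2_norm_eq_inner by (simp add: inner_vec_def power2_eq_square)
    then show "indicat_real (cball 0 1 - {0}) x * (\<Sum>j\<in>UNIV. 1 * (monomial_fun ?b (x /\<^sub>R norm x) * ((x /\<^sub>R norm x) $ j)\<^sup>2)) =
         indicat_real (cball 0 1 - {0}) x * monomial_fun ?b (x /\<^sub>R norm x)"
      by (simp only: sum_distrib_left[symmetric] mult_1) (auto simp: indicator_def)
  qed
  finally have tot: "(\<Sum>j\<in>UNIV. ?J j) = cone_integral (monomial_fun ?b)" .
  have "(\<Sum>j\<in>UNIV - {i}. real (a j + 1)) * ?L = (\<Sum>j\<in>UNIV - {i}. (real (a i) - 1) * ?J j)"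
    unfolding sum_distrib_right
    by (intro sum.cong refl cone_integral_monomial_swap) (use ai in auto)
  also have "\<dots> = (real (a i) - 1) * ((\<Sum>j\<in>UNIV. ?J j) - ?J i)"
    by (simp add: sum_distrib_left[symmetric] sum_diff1)
  also have "\<dots> = (real (a i) - 1) * cone_integral (monomial_fun ?b) - (real (a i) - 1) * ?L"
    by (simp only: tot right_diff_distrib own)
  finally have A: "((\<Sum>j\<in>UNIV - {i}. real (a j + 1)) + (real (a i) - 1)) * ?L = (real (a i) - 1) * cone_integral (monomial_fun ?b)"
    by (simp only: distrib_right)
  have B: "(\<Sum>j\<in>UNIV - {i}. real (a j + 1)) + (real (a i) - 1) = real (sum a UNIV) + real CARD('n) - 2"
    by (simp add: sum_diff1 sum.distrib)
  show ?thesis using A unfolding B .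
qed

section \<open>Moments of the sphere\<close>

text \<open>Integrate the derivative of \<open>cos x ^ (p + 1) * sin x ^ (q + 1)\<close>.\<close>

lemma trig_integral_rec:
  assumes "sin T * cos T = 0" "0 \<le> T"
  defines "I \<equiv> \<lambda>p q. integral {0..T} (\<lambda>x. cos x ^ p * sin x ^ q)"
  shows "real (p + q + 2) * I (p + 2) q = real (p + 1) * I p q"
    and "real (p + q + 2) * I p (q + 2) = real (q + 1) * I p q"
    and "I p (q + 2) = I p q - I (p + 2) q"
proof -
  have int: "(\<lambda>x. c * (cos x ^ p * sin x ^ q)) integrable_on {0..T}" for c p q
    by (intro integrable_continuous_real continuous_intros)
  show A: "I p (q + 2) = I p q - I (p + 2) q"
  proof -
    have "cos x ^ p * sin x ^ (q + 2) = 1 * (cos x ^ p * sin x ^ q) - 1 * (cos x ^ (p + 2) * sin x ^ q)" for x :: real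
    proof -
      have 1: "sin x ^ (q + 2) = sin x ^ q * (1 - (cos x)\<^sup>2)" by (simp only: power_add sin_squared_eq)
      have 2: "cos x ^ (p + 2) = cos x ^ p * (cos x)\<^sup>2" by (simp only: power_add)
      show ?thesis unfolding 1 2 by (simp only: algebra_simps mult_1)
    qed
    then have "I p (q + 2) = integral {0..T} (\<lambda>x. 1 * (cos x ^ p * sin x ^ q) - 1 * (cos x ^ (p + 2) * sin x ^ q))"
      unfolding I_def by presburger
    also have "\<dots> = I p q - I (p + 2) q"
      unfolding I_def by (subst Henstock_Kurzweil_Integration.integral_diff[OF int int]) simp
    finally show ?thesis .
  qed
  have B: "real (q + 1) * I (p + 2) q = real (p + 1) * I p (q + 2)"
  proof -
    have "((\<lambda>x. real (q + 1) * (cos x ^ (p + 2) * sin x ^ q) - real (p + 1) * (cos x ^ p * sin x ^ (q + 2)))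
       has_integral (cos T ^ (p + 1) * sin T ^ (q + 1) - cos 0 ^ (p + 1) * sin 0 ^ (q + 1))) {0..T}"
    proof (rule fundamental_theorem_of_calculus[OF assms(2)])
      fix x
      have "((\<lambda>x. cos x ^ (p + 1) * sin x ^ (q + 1)) has_real_derivative
         (real (p + 1) * cos x ^ p * (- sin x)) * sin x ^ (q + 1) + cos x ^ (p + 1) * (real (q + 1) * sin x ^ q * cos x)) (at x)"
      proof -
        have "((\<lambda>x. cos x ^ m * sin x ^ n) has_real_derivative
          (real m * cos x ^ (m - 1) * (- sin x)) * sin x ^ n + cos x ^ m * (real n * sin x ^ (n - 1) * cos x)) (at x)" for m n
          by (auto intro!: derivative_eq_intros)
        from this[of "p + 1" "q + 1"] show ?thesis by (simp only: add_diff_cancel_right')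
      qed
      also have "(real (p + 1) * cos x ^ p * (- sin x)) * sin x ^ (q + 1) + cos x ^ (p + 1) * (real (q + 1) * sin x ^ q * cos x)
         = real (q + 1) * (cos x ^ (p + 2) * sin x ^ q) - real (p + 1) * (cos x ^ p * sin x ^ (q + 2))"
        by (simp add: algebra_simps power2_eq_square)
      finally show "((\<lambda>x. cos x ^ (p + 1) * sin x ^ (q + 1)) has_vector_derivative
         real (q + 1) * (cos x ^ (p + 2) * sin x ^ q) - real (p + 1) * (cos x ^ p * sin x ^ (q + 2))) (at x within {0..T})"
        by (simp add: has_real_derivative_iff_has_vector_derivative has_vector_derivative_at_within)
    qed
    moreover have "cos T ^ (p + 1) * sin T ^ (q + 1) = 0" using assms(1) by auto
    ultimately have "0 = integral {0..T} (\<lambda>x. real (q + 1) * (cos x ^ (p + 2) * sin x ^ q) - real (p + 1) * (cos x ^ p * sin x ^ (q + 2)))"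
      by (simp add: integral_unique)
    also have "\<dots> = real (q + 1) * I (p + 2) q - real (p + 1) * I p (q + 2)"
      unfolding I_def by (subst Henstock_Kurzweil_Integration.integral_diff[OF int int]) simp
    finally show ?thesis by simp
  qed
  show "real (p + q + 2) * I (p + 2) q = real (p + 1) * I p q"
    using B unfolding A by (simp add: algebra_simps)
  show "real (p + q + 2) * I p (q + 2) = real (q + 1) * I p q"
  proof -
    have "real (q + 1) * I p q = real (q + 1) * I p (q + 2) + real (q + 1) * I (p + 2) q"
      unfolding A by (simp only: right_diff_distrib)
    then show ?thesis unfolding B by (simp add: algebra_simps)
  qed
qed

lemma trig_moment_rec:
  "real (p + q + 2) * trig_moment (p + 2) q = real (p + 1) * trig_moment p q"
  "real (p + q + 2) * trig_moment p (q + 2) = real (q + 1) * trig_moment p q"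
  "trig_moment p (q + 2) = trig_moment p q - trig_moment (p + 2) q"
  unfolding trig_moment_def using trig_integral_rec[of "pi / 2"] by auto

text \<open>
  The integrals over the full circle and over a quarter of it satisfy the same recursion, so it
  is enough to compare exponents below \<open>2\<close>.
\<close>

lemma full_circle_moment:
  "integral {0..2 * pi} (\<lambda>x. cos x ^ p * sin x ^ q) =
     (if even p \<and> even q then 2 * pi * (trig_moment p q / trig_moment 0 0) else 0)"
proof -
  define I where "I = (\<lambda>p q. integral {0..2 * pi} (\<lambda>x. cos x ^ p * sin x ^ q))"
  have rec: "real (p + q + 2) * I (p + 2) q = real (p + 1) * I p q"
    "real (p + q + 2) * I p (q + 2) = real (q + 1) * I p q" for p q
    unfolding I_def using trig_integral_rec[of "2 * pi"] by auto
  have base: "I 0 0 = 2 * pi" "I 1 0 = 0" "I 0 1 = 0" "I 1 1 = 0"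
  proof -
    show "I 0 0 = 2 * pi" by (simp add: I_def)
    have "(cos has_integral (sin (2 * pi) - sin 0)) {0..2 * pi}"
      by (rule fundamental_theorem_of_calculus)
        (auto intro!: derivative_eq_intros simp: has_real_derivative_iff_has_vector_derivative[symmetric])
    then show "I 1 0 = 0" by (simp add: I_def integral_unique)
    have "(sin has_integral ((- cos (2 * pi)) - (- cos 0))) {0..2 * pi}"
      by (rule fundamental_theorem_of_calculus)
        (auto intro!: derivative_eq_intros simp: has_real_derivative_iff_has_vector_derivative[symmetric])
    then show "I 0 1 = 0" by (simp add: I_def integral_unique)
    have "((\<lambda>x. cos x * sin x) has_integral ((sin (2 * pi))\<^sup>2 / 2 - (sin 0)\<^sup>2 / 2)) {0..2 * pi}"
      by (rule fundamental_theorem_of_calculus)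
        (auto intro!: derivative_eq_intros simp: has_real_derivative_iff_has_vector_derivative[symmetric])
    then show "I 1 1 = 0" by (simp add: I_def integral_unique)
  qed
  have pos: "trig_moment 0 0 > 0" by (rule trig_moment_0_pos)
  have aux: "u * (2 * pi * (x / c)) = v * (2 * pi * (y / c))" if "u * x = v * y" for u v x y c :: real
  proof -
    have "u * (2 * pi * (x / c)) = 2 * pi * ((u * x) / c)" by simp
    then show ?thesis using that by simp
  qed
  have "I p q = (if even p \<and> even q then 2 * pi * (trig_moment p q / trig_moment 0 0) else 0)"
  proof (induction "p + q" arbitrary: p q rule: less_induct)
    case less
    consider "p \<ge> 2" | "q \<ge> 2" | "p < 2" "q < 2" by linarith
    then show ?case
    proof cases
      case 1
      then obtain p' where p: "p = p' + 2" by (metis add.commute le_Suc_ex)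
      have "real (p' + q + 2) * I p q = real (p' + 1) * I p' q" unfolding p by (rule rec)
      also have "I p' q = (if even p' \<and> even q then 2 * pi * (trig_moment p' q / trig_moment 0 0) else 0)"
        by (rule less) (simp add: p)
      also have "real (p' + 1) * \<dots> = real (p' + q + 2) * (if even p \<and> even q then 2 * pi * (trig_moment p q / trig_moment 0 0) else 0)"
        using aux[OF trig_moment_rec(1)[of p' q, symmetric]] by (simp add: p)
      finally show ?thesis by (simp only: mult_cancel_left) simp
    next
      case 2
      then obtain q' where q: "q = q' + 2" by (metis add.commute le_Suc_ex)
      have "real (p + q' + 2) * I p q = real (q' + 1) * I p q'" unfolding q by (rule rec)
      also have "I p q' = (if even p \<and> even q' then 2 * pi * (trig_moment p q' / trig_moment 0 0) else 0)"
        by (rule less) (simp add: q)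
      also have "real (q' + 1) * \<dots> = real (p + q' + 2) * (if even p \<and> even q then 2 * pi * (trig_moment p q / trig_moment 0 0) else 0)"
        using aux[OF trig_moment_rec(2)[of p q', symmetric]] by (simp add: q)
      finally show ?thesis by (simp only: mult_cancel_left) simp
    next
      case 3
      then have "p = 0 \<or> p = 1" "q = 0 \<or> q = 1" by auto
      then show ?thesis using base pos by auto
    qed
  qed
  then show ?thesis by (simp add: I_def)
qed

text \<open>
  The normalized moment of the sphere \<open>S\<^sup>d\<close> for even exponents \<open>b 0,
  \<dots>, b d\<close>, computed by iterated latitudes: \<open>sum b {..<k}\<close> is the
  degree of the part of the monomial that lives on the parallels of \<open>S\<^sup>k\<close>,
  which scales like that power of the sine.
\<close>

definition sphere_moment :: "nat \<Rightarrow> (nat \<Rightarrow> nat) \<Rightarrow> real" where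
  "sphere_moment d b = (\<Prod>k=1..d. trig_moment (b k) (sum b {..<k} + (k - 1)) / trig_moment 0 (k - 1))"

text \<open>
  Lowering \<open>b i\<close> changes the factor \<open>k = i\<close> and, through the partial
  sums, all later ones. The denominator that appears at \<open>k\<close> cancels the numerator
  at \<open>k + 1\<close>.
\<close>

lemma sphere_moment_rec:
  assumes "i \<le> d" "2 \<le> b i"
  shows "(real (sum b {..d}) + real d - 1) * sphere_moment d b = (real (b i) - 1) * sphere_moment d (b(i := b i - 2))"
  using assms
proof (induction d)
  case 0
  then show ?case by (simp add: sphere_moment_def)
next
  case (Suc d)
  let ?b' = "b(i := b i - 2)"
  define A where "A = sum b {..d}"
  have step: "sphere_moment (Suc d) c = sphere_moment d c * (trig_moment (c (Suc d)) (sum c {..d} + d) / trig_moment 0 d)" for c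
    by (simp add: sphere_moment_def lessThan_Suc_atMost)
  show ?case
  proof (cases "i = Suc d")
    case True
    have "sphere_moment d ?b' = sphere_moment d b" unfolding sphere_moment_def
      by (intro prod.cong refl) (auto simp: True intro!: arg_cong2[where f = "(/)"] arg_cong2[where f = trig_moment] sum.cong)
    moreover have "sum ?b' {..d} = A" unfolding A_def by (intro sum.cong) (auto simp: True)
    moreover have "real (b i + (A + d)) * trig_moment (b i) (A + d) = (real (b i) - 1) * trig_moment (b i - 2) (A + d)"
    proof -
      have "b i - 2 + 2 = b i" using Suc.prems by simp
      from trig_moment_rec(1)[of "b i - 2" "A + d", unfolded this] show ?thesis
        using Suc.prems by (simp add: of_nat_diff algebra_simps)
    qed
    moreover have "(real (sum b {..Suc d}) + real (Suc d) - 1) * sphere_moment (Suc d) b =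
        sphere_moment d b * ((real (b i + (A + d)) * trig_moment (b i) (A + d)) / trig_moment 0 d)"
      unfolding step by (simp add: A_def[symmetric] True add_ac)
    ultimately show ?thesis unfolding step[of ?b'] by (simp add: True)
  next
    case False
    then have i: "i \<le> d" using Suc.prems by simp
    have Ai: "b i \<le> A" unfolding A_def using i by (intro member_le_sum) auto
    have A': "sum ?b' {..d} = A - 2"
    proof -
      have "A = b i + sum b ({..d} - {i})" unfolding A_def using i by (intro sum.remove) auto
      moreover have "sum ?b' {..d} = (b i - 2) + sum b ({..d} - {i})"
        using i by (subst sum.remove[of _ i]) (auto intro!: sum.cong)
      ultimately show ?thesis using Suc.prems by simp
    qed
    let ?\<beta> = "b (Suc d)"
    have "real (?\<beta> + (A + d)) * trig_moment ?\<beta> (A + d) = (real A + real d - 1) * trig_moment ?\<beta> (A - 2 + d)"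
    proof -
      have "A - 2 + d + 2 = A + d" using Ai Suc.prems by simp
      with trig_moment_rec(2)[of ?\<beta> "A - 2 + d"] show ?thesis using Ai Suc.prems
        by (simp add: of_nat_diff algebra_simps)
    qed
    then have "(real (sum b {..Suc d}) + real (Suc d) - 1) * sphere_moment (Suc d) b
       = ((real A + real d - 1) * sphere_moment d b) * (trig_moment ?\<beta> (A - 2 + d) / trig_moment 0 d)"
    proof -
      assume *: "real (?\<beta> + (A + d)) * trig_moment ?\<beta> (A + d) = (real A + real d - 1) * trig_moment ?\<beta> (A - 2 + d)"
      have "(real (sum b {..Suc d}) + real (Suc d) - 1) * sphere_moment (Suc d) b =
          sphere_moment d b * ((real (?\<beta> + (A + d)) * trig_moment ?\<beta> (A + d)) / trig_moment 0 d)"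
        unfolding step by (simp add: A_def[symmetric] add_ac)
      then show ?thesis unfolding * by simp
    qed
    also have "(real A + real d - 1) * sphere_moment d b = (real (b i) - 1) * sphere_moment d ?b'"
      using Suc.IH[OF i Suc.prems(2)] by (simp only: A_def)
    finally show ?thesis unfolding step[of ?b'] A' using False by (simp add: mult.assoc)
  qed
qed

text \<open>
  Both sides satisfy the recursion forced by rotation invariance; the induction is on the
  degree.
\<close>

lemma sphere_average_monomial:
  fixes a :: "'n::finite \<Rightarrow> nat"
  assumes d: "CARD('n) = d + 1" "1 \<le> d" and e: "bij_betw e {..d} (UNIV :: 'n set)"
  shows "sphere_average (monomial_fun a) = (if \<forall>i. even (a i) then sphere_moment d (\<lambda>k. a (e k)) else 0)"
proof -
  let ?V = "measure lborel (cball (0 :: real ^ 'n) 1)"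
  have V: "?V > 0" by simp
  have "cone_integral (monomial_fun a) = ?V * (if \<forall>i. even (a i) then sphere_moment d (\<lambda>k. a (e k)) else 0)"
  proof (induction "sum a UNIV" arbitrary: a rule: less_induct)
    case less
    show ?case
    proof (cases "\<forall>i. a i = 0")
      case True
      then have m: "monomial_fun a = (\<lambda>x. 1)" by (auto simp: monomial_fun_def)
      have "1 = cone_integral (\<lambda>x :: real ^ 'n. 1) / ?V"
        using sphere_average_cone_integral[where 'n = 'n, OF continuous_on_const, of 1] unfolding sphere_average_const .
      then have "cone_integral (monomial_fun a) = ?V" unfolding m using V by (metis eq_divide_eq less_irrefl mult_1)
      moreover have "sphere_moment d (\<lambda>k. a (e k)) = 1"
        unfolding sphere_moment_def using True trig_moment_0_pos by (intro prod.neutral) (auto simp: less_imp_neq[symmetric])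
      ultimately show ?thesis using True by simp
    next
      case False
      obtain i where i: "a i \<noteq> 0" "\<not> (\<forall>i. even (a i)) \<Longrightarrow> odd (a i)"
      proof (cases "\<forall>i. even (a i)")
        case True
        with False that show ?thesis by blast
      next
        case odd: False
        then obtain i where "odd (a i)" by blast
        moreover from this have "a i \<noteq> 0" by (intro notI) simp
        ultimately show ?thesis using that by blast
      qed
      let ?b = "a(i := a i - 2)"
      have ai: "a i \<le> sum a UNIV" by (intro member_le_sum) auto
      have c: "real (sum a UNIV) + real CARD('n) - 2 > 0" using i(1) ai d by linarith
      have rec: "(real (sum a UNIV) + real CARD('n) - 2) * cone_integral (monomial_fun a) =
          (real (a i) - 1) * cone_integral (monomial_fun ?b)"
        by (rule cone_integral_monomial_rec) (use i in simp)
      have "sum ?b UNIV < sum a UNIV" using i(1) by (intro sum_strict_mono_ex1) auto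
      note IH = less[OF this]
      show ?thesis
      proof (cases "\<forall>i. even (a i)")
        case True
        then have ev: "\<forall>k. even (?b k)" by simp
        have a2: "2 \<le> a i" using True i(1) by (cases "a i = 1") (auto, metis odd_one One_nat_def)
        obtain l where l: "l \<le> d" "e l = i" using e unfolding bij_betw_def by (metis UNIV_I atMost_iff imageE)
        have inj: "k \<le> d \<Longrightarrow> e k = i \<longleftrightarrow> k = l" for k
          using e l unfolding bij_betw_def by (metis atMost_iff inj_onD)
        have "sphere_moment d (\<lambda>k. ?b (e k)) = sphere_moment d ((\<lambda>k. a (e k))(l := a (e l) - 2))"
          unfolding sphere_moment_def using inj l
          by (intro prod.cong refl arg_cong2[where f = "(/)"] arg_cong2[where f = trig_moment] arg_cong2[where f = "(+)"] sum.cong) auto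
        moreover have "sum a UNIV = (\<Sum>k\<le>d. a (e k))" by (rule sum.reindex_bij_betw[OF e, symmetric])
        ultimately have "(real (sum a UNIV) + real CARD('n) - 2) * sphere_moment d (\<lambda>k. a (e k)) = (real (a i) - 1) * sphere_moment d (\<lambda>k. ?b (e k))"
          using sphere_moment_rec[of l d "\<lambda>k. a (e k)"] l a2 d by simp
        then have "(real (sum a UNIV) + real CARD('n) - 2) * (?V * sphere_moment d (\<lambda>k. a (e k))) =
          (real (a i) - 1) * (?V * sphere_moment d (\<lambda>k. ?b (e k)))"
          by (simp only: mult.left_commute)
        also have "\<dots> = (real (sum a UNIV) + real CARD('n) - 2) * cone_integral (monomial_fun a)"
          unfolding rec IH using ev by simp
        finally show ?thesis using c True by simp
      next
        case False
        then have odd: "odd (a i)" by (rule i(2))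
        have zero: "(real (a i) - 1) * cone_integral (monomial_fun ?b) = 0"
        proof (cases "a i = 1")
          case False
          then have "odd (?b i)" using odd by (auto elim!: oddE)
          then show ?thesis unfolding IH by auto
        qed simp
        from rec[unfolded zero] c have "cone_integral (monomial_fun a) = 0" by (metis less_irrefl mult_eq_0_iff)
        then show ?thesis using False by (simp only: if_False mult_zero_right)
      qed
    qed
  qed
  then show ?thesis using V by (simp add: sphere_average_cone_integral continuous_on_monomial_fun)
qed

text \<open>
  Even powers of \<open>sqrt (1 - z\<^sup>2)\<close> are polynomials in
  \<open>z\<^sup>2\<close>; they are removed one at a time.
\<close>

lemma node_sum_moments:
  fixes Z :: "real set"
  assumes nodes: "\<And>i. i \<le> t \<Longrightarrow> (\<Sum>z\<in>Z. sqrt (1 - z\<^sup>2) * z ^ (2 * i)) = W * (trig_moment (2 * i) m / trig_moment 0 m)"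
    and Z: "\<And>z. z \<in> Z \<Longrightarrow> - 1 < z \<and> z < 1" and "i + r \<le> t"
  shows "(\<Sum>z\<in>Z. sqrt (1 - z\<^sup>2) * (sqrt (1 - z\<^sup>2) ^ (2 * r) * z ^ (2 * i))) = W * (trig_moment (2 * i) (2 * r + m) / trig_moment 0 m)"
  using assms(3)
proof (induction r arbitrary: i)
  case 0
  then show ?case using nodes by simp
next
  case (Suc r)
  have "sqrt (1 - z\<^sup>2) * (sqrt (1 - z\<^sup>2) ^ (2 * Suc r) * z ^ (2 * i)) =
    sqrt (1 - z\<^sup>2) * (sqrt (1 - z\<^sup>2) ^ (2 * r) * z ^ (2 * i)) - sqrt (1 - z\<^sup>2) * (sqrt (1 - z\<^sup>2) ^ (2 * r) * z ^ (2 * Suc i))"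
    if "z \<in> Z" for z
  proof -
    have "z\<^sup>2 \<le> 1" using Z[OF that] by (simp add: abs_square_le_1 abs_le_iff less_imp_le)
    then have "sqrt (1 - z\<^sup>2) ^ (2 * Suc r) = sqrt (1 - z\<^sup>2) ^ (2 * r) * (1 - z\<^sup>2)" by simp
    note 1 = this
    have 2: "z ^ (2 * Suc i) = z ^ (2 * i) * z\<^sup>2" by (simp add: power2_eq_square)
    show ?thesis unfolding 1 2 by (simp only: algebra_simps mult_1)
  qed
  then have "(\<Sum>z\<in>Z. sqrt (1 - z\<^sup>2) * (sqrt (1 - z\<^sup>2) ^ (2 * Suc r) * z ^ (2 * i))) =
     W * (trig_moment (2 * i) (2 * r + m) / trig_moment 0 m) - W * (trig_moment (2 * Suc i) (2 * r + m) / trig_moment 0 m)"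
    using Suc.IH[of i] Suc.IH[of "Suc i"] Suc.prems by (simp only: sum_subtractf cong: sum.cong)
  then show ?case using trig_moment_rec(3)[of "2 * i" "2 * r + m"]
    by (simp add: diff_divide_distrib right_diff_distrib)
qed

section \<open>Closed curves through connected families of circles\<close>

text \<open>
  One turn around the circle takes a parameter interval of length \<open>1\<close>.
\<close>

definition circle_param :: "'a::real_normed_vector \<Rightarrow> real \<Rightarrow> 'a \<Rightarrow> 'a \<Rightarrow> real \<Rightarrow> 'a" where
  "circle_param p r u v x = p + (r * cos (2 * pi * x)) *\<^sub>R u + (r * sin (2 * pi * x)) *\<^sub>R v"

lemma has_integral_sum_cells:
  fixes h :: "real \<Rightarrow> real"
  assumes "\<And>k. k < m \<Longrightarrow> t k \<le> t (Suc k)" "\<And>k. k < m \<Longrightarrow> (h has_integral V k) {t k..t (Suc k)}"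
  shows "(h has_integral (\<Sum>k<m. V k)) {t 0..t m} \<and> t 0 \<le> t m"
  using assms
proof (induction m)
  case 0
  show ?case using has_integral_refl(2)[of h "t 0"] by simp
next
  case (Suc m)
  then have IH: "(h has_integral (\<Sum>k<m. V k)) {t 0..t m}" "t 0 \<le> t m" by auto
  moreover have "t m \<le> t (Suc m)" using Suc.prems by simp
  ultimately show ?case
    using has_integral_combine[OF IH(2) _ IH(1) Suc.prems(2)[of m]] by auto
qed

text \<open>
  A finite family of circles on the unit sphere, with centres \<open>p i\<close>, radii \<open>r
  i\<close> and orthonormal frames \<open>u i\<close>, \<open>v i\<close> of their planes.
\<close>

locale circle_family =
  fixes I :: "'i set" and p u v :: "'i \<Rightarrow> real ^ 'n" and r :: "'i \<Rightarrow> real"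
  assumes finite_I: "finite I" and I_ne: "I \<noteq> {}"
    and r_pos: "i \<in> I \<Longrightarrow> 0 < r i"
    and orthonormal: "i \<in> I \<Longrightarrow> norm (u i) = 1" "i \<in> I \<Longrightarrow> norm (v i) = 1" "i \<in> I \<Longrightarrow> u i \<bullet> v i = 0"
    and center: "i \<in> I \<Longrightarrow> p i \<bullet> u i = 0" "i \<in> I \<Longrightarrow> p i \<bullet> v i = 0" "i \<in> I \<Longrightarrow> (norm (p i))\<^sup>2 + (r i)\<^sup>2 = 1"
begin

abbreviation c :: "'i \<Rightarrow> real \<Rightarrow> real ^ 'n" where
  "c i \<equiv> circle_param (p i) (r i) (u i) (v i)"

lemma inner_u: "i \<in> I \<Longrightarrow> c i x \<bullet> u i = r i * cos (2 * pi * x)"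
  and inner_v: "i \<in> I \<Longrightarrow> c i x \<bullet> v i = r i * sin (2 * pi * x)"
  using orthonormal[of i] center[of i]
  by (simp_all add: circle_param_def inner_add_left norm_eq_1 inner_commute[of "v i" "u i"])

lemma c_eq_iff: "i \<in> I \<Longrightarrow> c i x = c i y \<longleftrightarrow> (\<exists>n::int. x = y + of_int n)"
proof
  assume i: "i \<in> I" and eq: "c i x = c i y"
  then have "sin (2 * pi * x) = sin (2 * pi * y) \<and> cos (2 * pi * x) = cos (2 * pi * y)"
    using inner_u[OF i, of x] inner_u[OF i, of y] inner_v[OF i, of x] inner_v[OF i, of y] r_pos[OF i] by simp
  then obtain n :: int where "2 * pi * x = 2 * pi * y + 2 * pi * of_int n"
    unfolding sin_cos_eq_iff by blast
  then have "2 * pi * x = 2 * pi * (y + of_int n)" by (simp only: distrib_left)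
  then have "x = y + of_int n" by simp
  then show "\<exists>n::int. x = y + of_int n" ..
next
  assume "\<exists>n::int. x = y + of_int n"
  then obtain n :: int where "x = y + of_int n" by blast
  then have "2 * pi * x = 2 * pi * y + 2 * pi * of_int n" by (simp add: distrib_left)
  then have "sin (2 * pi * x) = sin (2 * pi * y) \<and> cos (2 * pi * x) = cos (2 * pi * y)"
    unfolding sin_cos_eq_iff by (auto simp: mult_ac)
  then show "c i x = c i y" by (simp add: circle_param_def)
qed

lemma norm_plane: "i \<in> I \<Longrightarrow> (norm (p i + \<alpha> *\<^sub>R u i + \<beta> *\<^sub>R v i))\<^sup>2 = (norm (p i))\<^sup>2 + (\<alpha>\<^sup>2 + \<beta>\<^sup>2)"
  unfolding power2_norm_eq_inner using orthonormal[of i] center(1,2)[of i]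
  by (simp add: inner_add_left inner_add_right norm_eq_1 inner_commute[of "v i" "u i"]
      inner_commute[of "u i" "p i"] inner_commute[of "v i" "p i"] power2_eq_square)

lemma norm_c: "i \<in> I \<Longrightarrow> norm (c i x) = 1"
proof -
  assume i: "i \<in> I"
  have "(norm (c i x))\<^sup>2 = (norm (p i))\<^sup>2 + ((r i * cos (2 * pi * x))\<^sup>2 + (r i * sin (2 * pi * x))\<^sup>2)"
    unfolding circle_param_def by (rule norm_plane[OF i])
  also have "\<dots> = (norm (p i))\<^sup>2 + (r i)\<^sup>2" by (simp add: power_mult_distrib flip: distrib_left)
  also have "\<dots> = 1" using center(3)[OF i] by simp
  finally have "norm (c i x) = 1 \<or> norm (c i x) = - 1" by (simp only: power2_eq_1_iff)
  then show ?thesis using norm_ge_zero[of "c i x"] by linarith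
qed

lemma continuous_on_c: "continuous_on A (c i)"
  unfolding circle_param_def by (intro continuous_intros)

lemma range_c: "range (c i) = c i ` {a..a + 1}" if "i \<in> I"
proof -
  have "c i x \<in> c i ` {a..a + 1}" for x
  proof
    show "c i x = c i (x - of_int \<lfloor>x - a\<rfloor>)"
      unfolding c_eq_iff[OF that] by (rule exI[of _ "\<lfloor>x - a\<rfloor>"]) simp
    show "x - of_int \<lfloor>x - a\<rfloor> \<in> {a..a + 1}" unfolding atLeastAtMost_iff by linarith
  qed
  then show ?thesis by auto
qed

lemma compact_range_c: "i \<in> I \<Longrightarrow> compact (range (c i))"
  by (subst range_c[of i 0]) (auto intro!: compact_continuous_image continuous_on_c)

lemma euclidean_circle_range: "i \<in> I \<Longrightarrow> euclidean_circle (range (c i))"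
proof -
  assume i: "i \<in> I"
  note o = orthonormal[OF i] and ce = center[OF i]
  define P where "P = (+) (p i) ` span {u i, v i}"
  have mem: "x \<in> P \<longleftrightarrow> (\<exists>\<alpha> \<beta>. x = p i + \<alpha> *\<^sub>R u i + \<beta> *\<^sub>R v i)" for x
    by (auto simp: P_def span_insert span_breakdown_eq image_iff algebra_simps eq_diff_eq)
       (metis add.commute add.left_commute diff_add_cancel)+
  have uv: "u i \<noteq> v i" using o by (auto simp: norm_eq_1)
  have "independent {u i, v i}"
    by (rule pairwise_orthogonal_independent)
       (use o in \<open>auto simp: pairwise_def orthogonal_def inner_commute\<close>)
  then have "dim (span {u i, v i}) = 2" using uv by (simp add: dim_span dim_eq_card_independent)
  then have "aff_dim P = 2" unfolding P_def aff_dim_translation_eq by (simp add: aff_dim_subspace subspace_span)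
  moreover have "affine P" unfolding P_def by (metis affine_translation subspace_imp_affine subspace_span)
  moreover have "range (c i) = sphere 0 1 \<inter> P"
  proof (intro equalityI subsetI)
    fix x assume "x \<in> range (c i)"
    then show "x \<in> sphere 0 1 \<inter> P" using norm_c[OF i] by (auto simp: mem circle_param_def)
  next
    fix x assume "x \<in> sphere 0 1 \<inter> P"
    then obtain \<alpha> \<beta> where x: "x = p i + \<alpha> *\<^sub>R u i + \<beta> *\<^sub>R v i" and n: "norm x = 1" by (auto simp: mem)
    have "(norm x)\<^sup>2 = (norm (p i))\<^sup>2 + (\<alpha>\<^sup>2 + \<beta>\<^sup>2)"
      unfolding x by (rule norm_plane[OF i])
    then have "\<alpha>\<^sup>2 + \<beta>\<^sup>2 = (r i)\<^sup>2" using n ce(3) by simp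
    then have "(\<alpha> / r i)\<^sup>2 + (\<beta> / r i)\<^sup>2 = 1" using r_pos[OF i] by (simp add: power_divide flip: add_divide_distrib)
    then obtain t where t: "\<alpha> / r i = cos t" "\<beta> / r i = sin t" by (rule sincos_total_2pi)
    then have "x = c i (t / (2 * pi))" using r_pos[OF i] by (simp add: x circle_param_def field_simps)
    then show "x \<in> range (c i)" by simp
  qed
  moreover have ne: "c i 0 \<noteq> c i (1 / 2)"
  proof
    assume "c i 0 = c i (1 / 2)"
    then show False using inner_u[OF i, of 0] inner_u[OF i, of "1 / 2"] r_pos[OF i] by simp
  qed
  moreover have "\<exists>x\<in>range (c i). \<exists>y\<in>range (c i). x \<noteq> y" using ne by blast
  ultimately show ?thesis unfolding euclidean_circle_def by (intro exI[of _ P] conjI)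
qed

text \<open>
  A triple \<open>(i, a, b)\<close> stands for the arc of the circle \<open>i\<close> with
  parameters from \<open>a\<close> to \<open>b\<close>. The multiplicity with which an arc meets
  a point is additive under subdivision, except at the point of division.
\<close>

definition hits :: "'i \<times> real \<times> real \<Rightarrow> real ^ 'n \<Rightarrow> nat" where
  "hits = (\<lambda>(i, a, b) q. card {x \<in> {a..b}. c i x = q})"

lemma finite_hits: "i \<in> I \<Longrightarrow> finite {x \<in> {a..b}. c i x = q}"
proof (cases "\<exists>x0. c i x0 = q")
  case True
  assume i: "i \<in> I"
  from True obtain x0 where x0: "c i x0 = q" ..
  have "{x \<in> {a..b}. c i x = q} \<subseteq> (\<lambda>n. x0 + of_int n) ` {\<lfloor>a - x0\<rfloor>..\<lceil>b - x0\<rceil>}"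
  proof
    fix x assume "x \<in> {x \<in> {a..b}. c i x = q}"
    then have x: "a \<le> x" "x \<le> b" "c i x = c i x0" using x0 by auto
    from x(3) obtain n :: int where "x = x0 + of_int n" unfolding c_eq_iff[OF i] by blast
    moreover from this x(1,2) have "\<lfloor>a - x0\<rfloor> \<le> n" "n \<le> \<lceil>b - x0\<rceil>" by linarith+
    ultimately show "x \<in> (\<lambda>n. x0 + of_int n) ` {\<lfloor>a - x0\<rfloor>..\<lceil>b - x0\<rceil>}" by auto
  qed
  then show ?thesis by (rule finite_subset) simp
next
  case False
  then have "{x \<in> {a..b}. c i x = q} = {}" by auto
  then show ?thesis by (simp only: finite.emptyI)
qed

lemma hits_split:
  assumes i: "i \<in> I" and x: "a \<le> x" "x \<le> b" and q: "q \<noteq> c i x"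
  shows "hits (i, a, b) q = hits (i, a, x) q + hits (i, x, b) q"
proof -
  have A: "{y \<in> {a..b}. c i y = q} = {y \<in> {a..x}. c i y = q} \<union> {y \<in> {x..b}. c i y = q}" using x by auto
  have B: "{y \<in> {a..x}. c i y = q} \<inter> {y \<in> {x..b}. c i y = q} = {}" using q by auto
  show ?thesis unfolding hits_def prod.case A
    by (rule card_Un_disjoint[OF finite_hits[OF i] finite_hits[OF i] B])
qed

lemma hits_full:
  assumes i: "i \<in> I" and q: "q \<noteq> c i y"
  shows "hits (i, y, y + 1) q = (if q \<in> range (c i) then 1 else 0)"
proof (cases "q \<in> range (c i)")
  case True
  then obtain x where x: "x \<in> {y..y + 1}" "q = c i x" unfolding range_c[OF i, of y] by blast
  have "{z \<in> {y..y + 1}. c i z = q} = {x}"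
  proof (intro equalityI subsetI)
    fix z assume "z \<in> {z \<in> {y..y + 1}. c i z = q}"
    then have z: "y \<le> z" "z \<le> y + 1" "c i z = c i x" using x by auto
    from z(3) obtain n :: int where n: "z = x + of_int n" unfolding c_eq_iff[OF i] by blast
    have "c i (y + 1) = c i y" unfolding c_eq_iff[OF i] by (rule exI[of _ 1]) simp
    then have "y < z" "z < y + 1" "y < x" "x < y + 1" using z x q by (auto simp: order_less_le)
    then have "\<bar>of_int n :: real\<bar> < 1" using n by auto
    then have "n = 0" by linarith
    then show "z \<in> {x}" using n by simp
  qed (use x in auto)
  then show ?thesis using True by (simp add: hits_def)
next
  case False
  then have "{z \<in> {y..y + 1}. c i z = q} = {}" by auto
  then show ?thesis using False by (simp only: hits_def prod.case card.empty if_False)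
qed

text \<open>
  The arcs of the list follow one another on a way from \<open>s\<close> to \<open>e\<close>.
\<close>

fun linked :: "real ^ 'n \<Rightarrow> ('i \<times> real \<times> real) list \<Rightarrow> real ^ 'n \<Rightarrow> bool" where
  "linked s [] e \<longleftrightarrow> s = e"
| "linked s ((i, a, b) # A) e \<longleftrightarrow> c i a = s \<and> linked (c i b) A e"

lemma linked_append: "linked s (A @ B) e \<longleftrightarrow> (\<exists>m. linked s A m \<and> linked m B e)"
  by (induction s A e rule: linked.induct) auto

definition arc_integral :: "(real ^ 'n \<Rightarrow> real) \<Rightarrow> 'i \<times> real \<times> real \<Rightarrow> real" where
  "arc_integral f = (\<lambda>(i, a, b). 2 * pi * r i * integral {a..b} (\<lambda>x. f (c i x)))"

definition arc_image :: "'i \<times> real \<times> real \<Rightarrow> (real ^ 'n) set" where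
  "arc_image = (\<lambda>(i, a, b). c i ` {a..b})"

text \<open>
  A closed sequence of arcs that runs exactly once through every circle with index in
  \<open>J\<close>. The last conjunct says that, outside a finite set, a point is visited as
  often as there are circles through it. Arcs of length zero are admitted, so that an arc can be
  divided at any of its points.
\<close>

definition tour :: "'i set \<Rightarrow> ('i \<times> real \<times> real) list \<Rightarrow> bool" where
  "tour J A \<longleftrightarrow> A \<noteq> [] \<and> (\<forall>(i, a, b)\<in>set A. i \<in> J \<and> a \<le> b) \<and> (\<exists>s. linked s A s) \<and>
     (\<Union>x\<in>set A. arc_image x) = (\<Union>j\<in>J. range (c j)) \<and>
     (\<forall>f. continuous_on UNIV f \<longrightarrow> sum_list (map (arc_integral f) A) = (\<Sum>j\<in>J. arc_integral f (j, 0, 1))) \<and>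
     (\<exists>F. finite F \<and> (\<forall>q. q \<notin> F \<longrightarrow> sum_list (map (\<lambda>x. hits x q) A) = card {j \<in> J. q \<in> range (c j)}))"

text \<open>A full turn has the same integral from any starting point.\<close>

lemma arc_integral_full:
  assumes i: "i \<in> I" and f: "continuous_on UNIV f"
  shows "arc_integral f (i, y, y + 1) = arc_integral f (i, 0, 1)"
proof -
  let ?g = "\<lambda>x. f (c i x)"
  have int: "?g integrable_on {a..b}" for a b
    by (intro integrable_continuous_real continuous_on_compose2[OF f continuous_on_c]) auto
  define n where "n = \<lfloor>y\<rfloor>"
  have per: "?g (x + of_int k) = ?g x" for x and k :: int
  proof -
    have "c i (x + of_int k) = c i x" unfolding c_eq_iff[OF i] by blast
    then show ?thesis by simp
  qed
  have n: "of_int n \<le> y" "y < of_int n + 1" unfolding n_def by linarith+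
  have sh: "integral {a + of_int k..b + of_int k} ?g = integral {a..b} ?g" for a b and k :: int
    using integral_shift_real_ivl[of "a + of_int k" "of_int k" "b + of_int k" ?g] per by simp
  have "integral {y..y + 1} ?g = integral {y..of_int n + 1} ?g + integral {of_int n + 1..y + 1} ?g"
    using n by (intro Henstock_Kurzweil_Integration.integral_combine[symmetric] int) auto
  also have "integral {of_int n + 1..y + 1} ?g = integral {of_int n..y} ?g"
    using sh[of "of_int n" 1 y] by simp
  also have "integral {y..of_int n + 1} ?g + integral {of_int n..y} ?g = integral {of_int n..of_int n + 1} ?g"
    using Henstock_Kurzweil_Integration.integral_combine[OF n(1) _ int, of "of_int n + 1"] n by simp
  also have "\<dots> = integral {0..1} ?g" using sh[of 0 n 1] by (simp add: add.commute)
  finally show ?thesis by (simp add: arc_integral_def)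
qed

lemma tour_singleton: "i \<in> I \<Longrightarrow> tour {i} [(i, 0, 1)]"
proof -
  assume i: "i \<in> I"
  have "c i 1 = c i 0" unfolding c_eq_iff[OF i] by (rule exI[of _ 1]) simp
  moreover have "hits (i, 0, 1) q = card {j \<in> {i}. q \<in> range (c j)}" if "q \<notin> {c i 0}" for q
  proof -
    have "{j \<in> {i}. q \<in> range (c j)} = (if q \<in> range (c i) then {i} else {})" by auto
    then show ?thesis using hits_full[OF i, of q 0] that by simp
  qed
  then have "\<exists>F. finite F \<and> (\<forall>q. q \<notin> F \<longrightarrow> hits (i, 0, 1) q = card {j \<in> {i}. q \<in> range (c j)})"
    by (intro exI[of _ "{c i 0}"]) simp
  ultimately show ?thesis using range_c[OF i, of 0] by (simp add: tour_def arc_image_def)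
qed

text \<open>
  Divide an arc at a point that lies on the new circle and insert there a full turn around it.
\<close>

lemma tour_insert:
  assumes t: "tour J A" and J: "J \<subseteq> I" and i: "i \<in> I - J" and meet: "range (c i) \<inter> (\<Union>j\<in>J. range (c j)) \<noteq> {}"
  shows "\<exists>A'. tour (insert i J) A'"
proof -
  from meet obtain y where y: "c i y \<in> (\<Union>j\<in>J. range (c j))" by auto
  then obtain arc where arc: "arc \<in> set A" "c i y \<in> arc_image arc" using t unfolding tour_def by blast
  obtain j a b where jab: "arc = (j, a, b)" by (cases arc)
  obtain x where x: "a \<le> x" "x \<le> b" "c j x = c i y" using arc(2) by (auto simp: jab arc_image_def)
  obtain B D where A: "A = B @ (j, a, b) # D" using arc(1) by (auto simp: jab in_set_conv_decomp)
  define A' where "A' = B @ (j, a, x) # (i, y, y + 1) # (j, x, b) # D"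
  have j: "j \<in> J" using t by (auto simp: tour_def A)
  then have jI: "j \<in> I" and iI: "i \<in> I" and iJ: "i \<notin> J" and finJ: "finite J"
    using J i finite_I finite_subset by auto
  have per: "c i (y + 1) = c i y" unfolding c_eq_iff[OF iI] by (rule exI[of _ 1]) simp
  have all: "k \<in> J \<and> l \<le> m" if "(k, l, m) \<in> set A" for k l m
    using t that unfolding tour_def by blast
  obtain s where "linked s A s" using t unfolding tour_def by blast
  then obtain m where lk: "linked s B m" "c j a = m" "linked (c j b) D s" unfolding A linked_append by auto
  have "tour (insert i J) A'"
    unfolding tour_def
  proof (intro conjI allI impI)
    show "A' \<noteq> []" by (simp add: A'_def)
    show "\<forall>(k, a, b)\<in>set A'. k \<in> insert i J \<and> a \<le> b" using all x(1,2) j unfolding A A'_def by auto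
    show "\<exists>s. linked s A' s"
      unfolding A'_def linked_append using lk x(3) per by (intro exI[of _ s] exI[of _ m]) simp
    have "arc_image (j, a, b) = arc_image (j, a, x) \<union> arc_image (j, x, b)"
    proof -
      have "{a..b} = {a..x} \<union> {x..b}" using x by auto
      then show ?thesis by (simp add: arc_image_def image_Un)
    qed
    then have "(\<Union>x\<in>set A'. arc_image x) = (\<Union>x\<in>set A. arc_image x) \<union> range (c i)"
      using range_c[OF iI, of y] by (auto simp: A A'_def arc_image_def)
    then show "(\<Union>x\<in>set A'. arc_image x) = (\<Union>j\<in>insert i J. range (c j))" using t by (auto simp: tour_def)
  next
    fix f :: "real ^ 'n \<Rightarrow> real" assume f: "continuous_on UNIV f"
    have "(\<lambda>x. f (c j x)) integrable_on {a..b}"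
      by (intro integrable_continuous_real continuous_on_compose2[OF f continuous_on_c]) auto
    from Henstock_Kurzweil_Integration.integral_combine[OF x(1,2) this]
    have "arc_integral f (j, a, b) = arc_integral f (j, a, x) + arc_integral f (j, x, b)"
      by (simp add: arc_integral_def flip: distrib_left)
    then have "sum_list (map (arc_integral f) A') = sum_list (map (arc_integral f) A) + arc_integral f (i, 0, 1)"
      by (simp add: A A'_def arc_integral_full[OF iI f])
    then show "sum_list (map (arc_integral f) A') = (\<Sum>j\<in>insert i J. arc_integral f (j, 0, 1))"
      using t f iJ finJ by (simp add: tour_def)
  next
    obtain F where F: "finite F" "\<And>q. q \<notin> F \<Longrightarrow> sum_list (map (\<lambda>x. hits x q) A) = card {j \<in> J. q \<in> range (c j)}"
      using t by (auto simp: tour_def)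
    have "sum_list (map (\<lambda>x. hits x q) A') = card {j \<in> insert i J. q \<in> range (c j)}" if q: "q \<notin> insert (c i y) F" for q
    proof -
      have "sum_list (map (\<lambda>x. hits x q) A') = sum_list (map (\<lambda>x. hits x q) A) + (if q \<in> range (c i) then 1 else 0)"
        using hits_split[OF jI x(1,2), of q] hits_full[OF iI, of q y] q x(3) by (simp add: A A'_def)
      also have "\<dots> = card {j \<in> J. q \<in> range (c j)} + (if q \<in> range (c i) then 1 else 0)" using F q by simp
      also have "\<dots> = card {j \<in> insert i J. q \<in> range (c j)}"
      proof -
        have "{j \<in> insert i J. q \<in> range (c j)} =
          (if q \<in> range (c i) then insert i {j \<in> J. q \<in> range (c j)} else {j \<in> J. q \<in> range (c j)})" by auto
        then show ?thesis using iJ finJ by simp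
      qed
      finally show ?thesis .
    qed
    then show "\<exists>F. finite F \<and> (\<forall>q. q \<notin> F \<longrightarrow> sum_list (map (\<lambda>x. hits x q) A') = card {j \<in> insert i J. q \<in> range (c j)})"
      using F(1) by (intro exI[of _ "insert (c i y) F"]) simp
  qed
  then show ?thesis ..
qed

text \<open>
  If the circles outside \<open>J\<close> did not meet those in \<open>J\<close>, the union of
  all circles would fall apart into two closed sets. So a tour of \<open>J\<close> can be
  enlarged until it visits all circles.
\<close>

lemma tour_exists:
  assumes conn: "connected (\<Union>i\<in>I. range (c i))"
  shows "\<exists>A. tour I A"
proof -
  have "\<exists>J\<subseteq>I. card J = Suc n \<and> (\<exists>A. tour J A)" if "Suc n \<le> card I" for n
    using that
  proof (induction n)
    case 0
    obtain i where "i \<in> I" using I_ne by blast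
    then show ?case using tour_singleton[of i] by (intro exI[of _ "{i}"]) auto
  next
    case (Suc n)
    then obtain J A where J: "J \<subseteq> I" "card J = Suc n" and t: "tour J A" by auto
    let ?S = "\<lambda>K. \<Union>k\<in>K. range (c k)"
    have cl: "closed (?S K)" if "K \<subseteq> I" for K
      using that finite_subset[OF that finite_I] by (intro closed_UN) (auto intro!: compact_imp_closed compact_range_c)
    have "I - J \<noteq> {}" "J \<noteq> {}" using J Suc.prems by auto
    then obtain k l where kl: "k \<in> J" "l \<in> I - J" by blast
    have "?S J \<inter> ?S (I - J) \<noteq> {}"
    proof
      assume dj: "?S J \<inter> ?S (I - J) = {}"
      have "?S I \<subseteq> ?S J \<union> ?S (I - J)" by blast
      moreover have "?S J \<inter> ?S (I - J) \<inter> ?S I = {}" using dj by simp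
      ultimately have "?S J \<inter> ?S I = {} \<or> ?S (I - J) \<inter> ?S I = {}"
        using conn cl[OF J(1)] cl[of "I - J"] by (intro connected_closedD) auto
      moreover have "c k 0 \<in> ?S J \<inter> ?S I" "c l 0 \<in> ?S (I - J) \<inter> ?S I" using kl J(1) by auto
      ultimately show False by blast
    qed
    then obtain i where i: "i \<in> I - J" "range (c i) \<inter> ?S J \<noteq> {}" by blast
    from tour_insert[OF t J(1) i] have "\<exists>A'. tour (insert i J) A'" .
    moreover have "card (insert i J) = Suc (Suc n)"
      using i(1) J finite_subset[OF J(1) finite_I] by simp
    ultimately show ?case using i(1) J(1) by (intro exI[of _ "insert i J"]) auto
  qed
  moreover have "Suc (card I - 1) = card I" using I_ne finite_I by (simp add: card_gt_0_iff)
  ultimately obtain J where "J \<subseteq> I" "card J = card I" "\<exists>A. tour J A" by (metis order_refl)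
  then show ?thesis using card_subset_eq[OF finite_I] by blast
qed

definition arc_point :: "'i \<times> real \<times> real \<Rightarrow> real \<Rightarrow> real ^ 'n" where
  "arc_point = (\<lambda>(i, a, b) \<tau>. c i (a + (b - a) * \<tau>))"

text \<open>
  Each arc gets one of \<open>length A\<close> parameter intervals of equal length. The minimum
  makes the parameter \<open>1\<close> belong to the last of them.
\<close>

definition traverse :: "('i \<times> real \<times> real) list \<Rightarrow> real \<Rightarrow> real ^ 'n" where
  "traverse A s = (let k = min (length A - 1) (nat \<lfloor>real (length A) * s\<rfloor>)
     in arc_point (A ! k) (real (length A) * s - real k))"

lemma linked_nth:
  "linked s A e \<Longrightarrow> A \<noteq> [] \<Longrightarrow> arc_point (A ! 0) 0 = s \<and> arc_point (last A) 1 = e \<and>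
     (\<forall>k. Suc k < length A \<longrightarrow> arc_point (A ! k) 1 = arc_point (A ! Suc k) 0)"
proof (induction s A e rule: linked.induct)
  case (2 s i a b A e)
  show ?case
  proof (cases "A = []")
    case True
    then show ?thesis using 2 by (simp add: arc_point_def)
  next
    case False
    have IH: "arc_point (A ! 0) 0 = c i b" "arc_point (last A) 1 = e"
      "\<And>k. Suc k < length A \<Longrightarrow> arc_point (A ! k) 1 = arc_point (A ! Suc k) 0"
      using 2 False by auto
    have "arc_point (((i, a, b) # A) ! k) 1 = arc_point (((i, a, b) # A) ! Suc k) 0"
      if "Suc k < length ((i, a, b) # A)" for k
    proof (cases k)
      case 0
      then show ?thesis using IH(1) by (simp add: arc_point_def)
    next
      case (Suc l)
      then show ?thesis using IH(3)[of l] that by simp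
    qed
    then show ?thesis using IH(2) 2(2) False by (simp add: arc_point_def)
  qed
qed simp

text \<open>
  At the right end of the interval the definition already refers to the next arc, which starts
  where this one ends.
\<close>

lemma traverse_on_cell:
  assumes l: "linked q A q" and k: "k < length A"
    and s: "s \<in> {real k / real (length A)..real (Suc k) / real (length A)}"
  shows "traverse A s = arc_point (A ! k) (real (length A) * s - real k)"
proof -
  let ?m = "length A"
  have m: "real ?m > 0" using k by (cases A) auto
  have s': "real k \<le> real ?m * s" "real ?m * s \<le> real k + 1"
    using s m by (auto simp: field_simps)
  have A: "A \<noteq> []" using k by auto
  show ?thesis
  proof (cases "real ?m * s < real k + 1")
    case True
    then have "\<lfloor>real ?m * s\<rfloor> = int k" using s' by linarith
    then show ?thesis using k by (simp add: traverse_def)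
  next
    case False
    then have e: "real ?m * s = real (Suc k)" using s' by simp
    then have fl: "nat \<lfloor>real ?m * s\<rfloor> = Suc k" by simp
    show ?thesis
    proof (cases "Suc k < ?m")
      case True
      then have "min (?m - 1) (nat \<lfloor>real ?m * s\<rfloor>) = Suc k" using fl by simp
      then have "traverse A s = arc_point (A ! Suc k) 0" unfolding traverse_def Let_def e by simp
      also have "\<dots> = arc_point (A ! k) 1" using linked_nth[OF l A] True by simp
      finally show ?thesis unfolding e by simp
    next
      case False
      then have "min (?m - 1) (nat \<lfloor>real ?m * s\<rfloor>) = k" using fl k by simp
      then show ?thesis unfolding traverse_def Let_def by simp
    qed
  qed
qed

text \<open>
  Derivatives of the sine and the cosine are shifts by \<open>pi / 2\<close>, which gives all
  derivatives of the arc in closed form.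
\<close>

lemma smooth_arc:
  assumes eq: "\<And>s. s \<in> {l..h} \<Longrightarrow> g s = c i (\<alpha> + \<beta> * s)"
  shows "smooth_on_interval l h g"
proof -
  let ?\<theta> = "\<lambda>j s. 2 * pi * (\<alpha> + \<beta> * s) + real j * (pi / 2)"
  define E where "E j s = (r i * (2 * pi * \<beta>) ^ j * cos (?\<theta> j s)) *\<^sub>R u i + (r i * (2 * pi * \<beta>) ^ j * sin (?\<theta> j s)) *\<^sub>R v i" for j s
  define D where "D j s = (if j = 0 then g s else E j s)" for j s
  have D0: "D 0 = g" by (simp add: D_def fun_eq_iff)
  have E: "(E j has_vector_derivative E (Suc j) s) (at s within {l..h})" for j s
  proof -
    have 1: "cos (?\<theta> (Suc j) s) = - sin (?\<theta> j s)" "sin (?\<theta> (Suc j) s) = cos (?\<theta> j s)"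
    proof -
      have "?\<theta> (Suc j) s = ?\<theta> j s + pi / 2" by (simp add: algebra_simps)
      then show "cos (?\<theta> (Suc j) s) = - sin (?\<theta> j s)" "sin (?\<theta> (Suc j) s) = cos (?\<theta> j s)"
        by (simp_all only: cos_add sin_add) simp_all
    qed
    show ?thesis unfolding E_def 1
      by (auto intro!: derivative_eq_intros simp: has_real_derivative_iff_has_vector_derivative[symmetric] algebra_simps)
  qed
  have "(D j has_vector_derivative D (Suc j) s) (at s within {l..h})" if s: "s \<in> {l..h}" for j s
  proof (cases "j = 0")
    case True
    have "((\<lambda>s. p i + E 0 s) has_vector_derivative E 1 s) (at s within {l..h})"
      using has_vector_derivative_add[OF has_vector_derivative_const E[of 0 s], of "p i"] by simp
    from has_vector_derivative_transform[OF s _ this, of g]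
    have "(g has_vector_derivative E 1 s) (at s within {l..h})"
      by (simp add: eq E_def circle_param_def add.assoc)
    then show ?thesis using True by (simp add: D0) (simp add: D_def)
  next
    case False
    then have "D j = E j" by (simp add: D_def fun_eq_iff)
    then show ?thesis using E by (simp add: D_def)
  qed
  with D0 show ?thesis unfolding smooth_on_interval_def by blast
qed

lemma c_has_vector_derivative:
  "(c i has_vector_derivative (2 * pi * r i) *\<^sub>R (- sin (2 * pi * x) *\<^sub>R u i + cos (2 * pi * x) *\<^sub>R v i)) (at x)"
  unfolding circle_param_def
  by (auto intro!: derivative_eq_intros simp: has_real_derivative_iff_has_vector_derivative[symmetric] algebra_simps)

lemma norm_c_derivative: "i \<in> I \<Longrightarrow> norm ((2 * pi * r i) *\<^sub>R (- sin (2 * pi * x) *\<^sub>R u i + cos (2 * pi * x) *\<^sub>R v i)) = 2 * pi * r i"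
proof -
  assume i: "i \<in> I"
  have "(norm (- sin (2 * pi * x) *\<^sub>R u i + cos (2 * pi * x) *\<^sub>R v i))\<^sup>2 = (sin (2 * pi * x))\<^sup>2 + (cos (2 * pi * x))\<^sup>2"
    unfolding power2_norm_eq_inner using orthonormal[OF i]
    by (simp add: inner_add_left inner_add_right inner_diff_left inner_diff_right norm_eq_1 inner_commute[of "v i" "u i"])
  then have "norm (- sin (2 * pi * x) *\<^sub>R u i + cos (2 * pi * x) *\<^sub>R v i) = 1 \<or>
      norm (- sin (2 * pi * x) *\<^sub>R u i + cos (2 * pi * x) *\<^sub>R v i) = - 1"
    by (simp only: sin_cos_squared_add power2_eq_1_iff)
  then have "norm (- sin (2 * pi * x) *\<^sub>R u i + cos (2 * pi * x) *\<^sub>R v i) = 1"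
    using norm_ge_zero[of "- sin (2 * pi * x) *\<^sub>R u i + cos (2 * pi * x) *\<^sub>R v i"] by linarith
  then show ?thesis using r_pos[OF i] by simp
qed

text \<open>
  Substitution on one parameter interval; an arc of length zero contributes nothing on either
  side.
\<close>

lemma traverse_cell_integral:
  assumes l: "linked q A q" and k: "k < length A" and arc: "A ! k = (i, a, b)" "i \<in> I" "a \<le> b"
    and f: "continuous_on UNIV f"
  shows "((\<lambda>s. f (traverse A s) * norm (vector_derivative (traverse A) (at s within {0..1})))
     has_integral arc_integral f (A ! k)) {real k / real (length A)..real (Suc k) / real (length A)}"
proof -
  let ?m = "real (length A)"
  define g where "g s = a + (b - a) * (?m * s - real k)" for s
  let ?l = "real k / ?m" and ?h = "real (Suc k) / ?m"
  have m: "?m > 0" using k by (cases A) auto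
  have gend: "g ?l = a" "g ?h = b" using m by (simp_all add: g_def)
  have tr: "traverse A s = c i (g s)" if "s \<in> {?l..?h}" for s
    using traverse_on_cell[OF l k that] by (simp add: arc arc_point_def g_def)
  have gder: "(g has_real_derivative (b - a) * ?m) (at s within S)" for s S
    unfolding g_def by (auto intro!: derivative_eq_intros)
  have "((\<lambda>s. ((b - a) * ?m) *\<^sub>R (2 * pi * r i * f (c i (g s)))) has_integral
     (integral {g ?l..g ?h} (\<lambda>x. 2 * pi * r i * f (c i x)))) {?l..?h}"
  proof (rule has_integral_substitution[where c = a and d = b])
    show "?l \<le> ?h" using m by (simp add: divide_right_mono)
    show "g ?l \<le> g ?h" using arc gend by simp
    show "g ` {?l..?h} \<subseteq> {a..b}"
    proof
      fix y assume "y \<in> g ` {?l..?h}"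
      then obtain s where s: "s \<in> {?l..?h}" "y = g s" by blast
      then have "0 \<le> ?m * s - real k" "?m * s - real k \<le> 1" using m by (auto simp: field_simps)
      then have "0 \<le> (b - a) * (?m * s - real k)" "(b - a) * (?m * s - real k) \<le> (b - a) * 1"
        using arc(3) by (intro mult_nonneg_nonneg mult_left_mono; simp)+
      then show "y \<in> {a..b}" by (simp add: s(2) g_def)
    qed
    show "continuous_on {a..b} (\<lambda>x. 2 * pi * r i * f (c i x))"
      by (intro continuous_intros continuous_on_compose2[OF f continuous_on_c]) auto
    show "(g has_real_derivative (b - a) * ?m) (at s within {?l..?h})" for s by (rule gder)
  qed
  then have int: "((\<lambda>s. ((b - a) * ?m) *\<^sub>R (2 * pi * r i * f (c i (g s)))) has_integral arc_integral f (A ! k)) {?l..?h}"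
    unfolding gend by (simp add: arc(1) arc_integral_def)
  show ?thesis
  proof (rule has_integral_spike_finite[OF _ _ int, of "{?l, ?h}"])
    fix s assume "s \<in> {?l..?h} - {?l, ?h}"
    then have s: "s \<in> {?l<..<?h}" by auto
    have s01: "0 \<le> s" "s \<le> 1"
    proof -
      have "0 \<le> ?l" "?h \<le> 1" using m k by (auto simp: divide_simps)
      then show "0 \<le> s" "s \<le> 1" using s unfolding greaterThanLessThan_iff by linarith+
    qed
    let ?d = "(2 * pi * r i) *\<^sub>R (- sin (2 * pi * g s) *\<^sub>R u i + cos (2 * pi * g s) *\<^sub>R v i)"
    have "(c i \<circ> g has_vector_derivative ((b - a) * ?m) *\<^sub>R ?d) (at s)"
      by (rule vector_diff_chain_at) (use gder c_has_vector_derivative in \<open>auto simp: has_real_derivative_iff_has_vector_derivative\<close>)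
    then have "(traverse A has_vector_derivative ((b - a) * ?m) *\<^sub>R ?d) (at s)"
      by (rule has_vector_derivative_transform_within_open[of _ _ _ "{?l<..<?h}"]) (use s tr in auto)
    then have "vector_derivative (traverse A) (at s within {0..1}) = ((b - a) * ?m) *\<^sub>R ?d"
      using s01 by (intro vector_derivative_at_within_ivl) auto
    then have "norm (vector_derivative (traverse A) (at s within {0..1})) = (b - a) * ?m * (2 * pi * r i)"
      using norm_c_derivative[OF arc(2), of "g s"] arc(3) by (simp only: norm_scaleR) simp
    then show "f (traverse A s) * norm (vector_derivative (traverse A) (at s within {0..1})) =
       ((b - a) * ?m) *\<^sub>R (2 * pi * r i * f (c i (g s)))"
      using tr[of s] s by (simp add: less_imp_le)
  qed simp
qed

lemma traverse_curve_integral: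
  assumes t: "tour I A" and f: "continuous_on UNIV f"
  shows "curve_integral (traverse A) f = (\<Sum>i\<in>I. arc_integral f (i, 0, 1))"
proof -
  let ?m = "real (length A)"
  obtain q where l: "linked q A q" using t by (auto simp: tour_def)
  have A: "A \<noteq> []" using t by (simp add: tour_def)
  let ?h = "\<lambda>s. f (traverse A s) * norm (vector_derivative (traverse A) (at s within {0..1}))"
  have "(?h has_integral arc_integral f (A ! k)) {real k / ?m..real (Suc k) / ?m}" if k: "k < length A" for k
  proof -
    obtain i a b where arc: "A ! k = (i, a, b)" by (cases "A ! k")
    then have "(i, a, b) \<in> set A" using nth_mem[OF k] by simp
    then have "i \<in> I" "a \<le> b" using t unfolding tour_def by blast+
    then show ?thesis by (rule traverse_cell_integral[OF l k arc _ _ f])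
  qed
  then have "(?h has_integral (\<Sum>k<length A. arc_integral f (A ! k))) {real 0 / ?m..real (length A) / ?m}"
    using has_integral_sum_cells[of "length A" "\<lambda>k. real k / ?m" ?h "\<lambda>k. arc_integral f (A ! k)"] A
    by (simp add: divide_right_mono)
  then have "curve_integral (traverse A) f = (\<Sum>k<length A. arc_integral f (A ! k))"
    using A by (simp add: curve_integral_def integral_unique)
  also have "\<dots> = sum_list (map (arc_integral f) A)"
    by (simp add: sum_list_sum_nth atLeast0LessThan)
  finally show ?thesis using t f by (simp add: tour_def)
qed

lemma traverse_cell_of:
  assumes "A \<noteq> []" "s \<in> {0..<1}"
  obtains k where "k < length A" "s \<in> {real k / real (length A)..<real (Suc k) / real (length A)}"
proof -
  let ?m = "real (length A)"
  have m: "?m > 0" using assms(1) by simp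
  define k where "k = nat \<lfloor>?m * s\<rfloor>"
  have s: "0 \<le> ?m * s" "?m * s < ?m" using assms(2) m by auto
  then have k: "real k \<le> ?m * s" "?m * s < real k + 1" unfolding k_def by linarith+
  then have "real k < ?m" using s by linarith
  then have "k < length A" by simp
  moreover have "s \<in> {real k / ?m..<real (Suc k) / ?m}" using k m by (simp add: field_simps)
  ultimately show ?thesis by (rule that)
qed

text \<open>
  Self-intersections: exclude the exceptional points of the tour, the common points of two
  circles and the initial points of arcs. Any other point lies on one circle only and is met by
  exactly one arc, which is not degenerate, at exactly one parameter.
\<close>

lemma traverse_sphere_curve:
  assumes t: "tour I A" and fin: "\<And>i j. i \<in> I \<Longrightarrow> j \<in> I \<Longrightarrow> i \<noteq> j \<Longrightarrow> finite (range (c i) \<inter> range (c j))"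
  shows "sphere_curve (traverse A) \<and> path_image (traverse A) = (\<Union>i\<in>I. range (c i))"
proof -
  let ?m = "real (length A)"
  obtain q where l: "linked q A q" using t by (auto simp: tour_def)
  have A: "A \<noteq> []" using t by (simp add: tour_def)
  have m: "?m > 0" using A by simp
  have arcs: "i \<in> I \<and> a \<le> b" if "k < length A" "A ! k = (i, a, b)" for i a b k
  proof -
    have "(i, a, b) \<in> set A" using that nth_mem by metis
    then show ?thesis using t unfolding tour_def by blast
  qed
  have tr: "traverse A s = c i (a + (b - a) * (?m * s - real k))"
    if "k < length A" "A ! k = (i, a, b)" "s \<in> {real k / ?m..real (Suc k) / ?m}" for k i a b s
    using traverse_on_cell[OF l that(1,3)] that(2) by (simp add: arc_point_def)
  have sm: "smooth_on_interval (real k / ?m) (real (Suc k) / ?m) (traverse A)" if k: "k < length A" for k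
  proof -
    obtain i a b where arc: "A ! k = (i, a, b)" by (cases "A ! k")
    show ?thesis
      by (rule smooth_arc[of _ _ _ i "a - (b - a) * real k" "(b - a) * ?m"])
        (simp add: tr[OF k arc] algebra_simps)
  qed
  have ps: "piecewise_smooth (traverse A)"
    unfolding piecewise_smooth_def
    by (intro exI[of _ "length A"] exI[of _ "\<lambda>k. real k / ?m"]) (use sm m A in \<open>auto simp: divide_strict_right_mono\<close>)
  have cover: "{0..1} = (\<Union>k\<in>{..<length A}. {real k / ?m..real (Suc k) / ?m})"
  proof (intro equalityI subsetI)
    fix s :: real assume s: "s \<in> {0..1}"
    show "s \<in> (\<Union>k\<in>{..<length A}. {real k / ?m..real (Suc k) / ?m})"
    proof (cases "s = 1")
      case True
      then show ?thesis using A m by (intro UN_I[of "length A - 1"]) (auto simp: field_simps of_nat_diff Suc_le_eq)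
    next
      case False
      then have "s \<in> {0..<1}" using s by auto
      then obtain k where "k < length A" "s \<in> {real k / ?m..<real (Suc k) / ?m}" by (rule traverse_cell_of[OF A])
      then show ?thesis by (intro UN_I[of k]) auto
    qed
  next
    fix s assume "s \<in> (\<Union>k\<in>{..<length A}. {real k / ?m..real (Suc k) / ?m})"
    then obtain k where k: "k < length A" "s \<in> {real k / ?m..real (Suc k) / ?m}" by blast
    then have "0 \<le> real k / ?m" "real (Suc k) / ?m \<le> 1" using m by (auto simp: divide_simps)
    then show "s \<in> {0..1}" using k(2) unfolding atLeastAtMost_iff by linarith
  qed
  have pt: "path (traverse A)"
    unfolding path_def cover
  proof (rule continuous_on_closed_Union)
    fix k assume "k \<in> {..<length A}"
    then obtain D where D: "D 0 = traverse A" "\<And>j s. s \<in> {real k / ?m..real (Suc k) / ?m} \<Longrightarrow>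
        (D j has_vector_derivative D (Suc j) s) (at s within {real k / ?m..real (Suc k) / ?m})"
      using sm[of k] unfolding smooth_on_interval_def by blast
    show "continuous_on {real k / ?m..real (Suc k) / ?m} (traverse A)"
      using D(2)[of _ 0] unfolding D(1) by (rule continuous_on_vector_derivative)
  qed auto
  have cell_image: "traverse A ` {real k / ?m..real (Suc k) / ?m} = arc_image (A ! k)" if k: "k < length A" for k
  proof -
    obtain i a b where arc: "A ! k = (i, a, b)" by (cases "A ! k")
    have ab: "a \<le> b" using arcs[OF k arc] by simp
    have "(\<lambda>s. ?m * s + (- real k)) ` {real k / ?m..real (Suc k) / ?m} = {0..1}"
      using m by (subst image_affinity_atLeastAtMost) (auto simp: divide_right_mono)
    moreover have "(\<lambda>\<tau>. (b - a) * \<tau> + a) ` {0..1} = {a..b}"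
      using ab by (subst image_affinity_atLeastAtMost) auto
    ultimately have "(\<lambda>s. (b - a) * (?m * s + (- real k)) + a) ` {real k / ?m..real (Suc k) / ?m} = {a..b}"
      by (metis (no_types, lifting) image_cong image_image)
    then have "c i ` {a..b} = (\<lambda>s. c i ((b - a) * (?m * s + (- real k)) + a)) ` {real k / ?m..real (Suc k) / ?m}"
      by (metis (no_types, lifting) image_cong image_image)
    also have "\<dots> = traverse A ` {real k / ?m..real (Suc k) / ?m}"
      by (intro image_cong refl) (simp add: tr[OF k arc] add.commute)
    finally show ?thesis by (simp add: arc arc_image_def)
  qed
  have img: "path_image (traverse A) = (\<Union>i\<in>I. range (c i))"
  proof -
    have "path_image (traverse A) = (\<Union>k\<in>{..<length A}. arc_image (A ! k))"
      unfolding path_image_def cover image_UN by (intro SUP_cong refl cell_image) simp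
    also have "\<dots> = (\<Union>x\<in>set A. arc_image x)" by (auto simp: set_conv_nth)
    finally show ?thesis using t by (simp add: tour_def)
  qed
  have closed: "pathstart (traverse A) = pathfinish (traverse A)"
  proof -
    have "traverse A 0 = arc_point (A ! 0) 0" using traverse_on_cell[OF l, of 0 0] A by simp
    moreover have "traverse A 1 = arc_point (A ! (length A - 1)) 1"
      using traverse_on_cell[OF l, of "length A - 1" 1] A m by (simp add: of_nat_diff Suc_le_eq field_simps)
    ultimately show ?thesis using linked_nth[OF l A] A by (simp add: pathstart_def pathfinish_def last_conv_nth)
  qed
  have len: "curve_length (traverse A) > 0"
  proof -
    have "curve_length (traverse A) = (\<Sum>i\<in>I. arc_integral (\<lambda>_. 1) (i, 0, 1))"
      using traverse_curve_integral[OF t continuous_on_const, of 1] by (simp add: curve_length_def curve_integral_def)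
    also have "\<dots> > 0" using finite_I I_ne r_pos by (intro sum_pos) (auto simp: arc_integral_def)
    finally show ?thesis .
  qed
  have self: "finite_self_intersections (traverse A)"
  proof -
    \<comment> \<open>\<open>X\<close>: common points of two circles; \<open>Y\<close>: initial points of arcs, which include all degenerate arcs.\<close>
    obtain F where F: "finite F" "\<And>q. q \<notin> F \<Longrightarrow> sum_list (map (\<lambda>x. hits x q) A) = card {j \<in> I. q \<in> range (c j)}"
      using t unfolding tour_def by blast
    define X where "X = (\<Union>(i, j)\<in>{(i, j). i \<in> I \<and> j \<in> I \<and> i \<noteq> j}. range (c i) \<inter> range (c j))"
    define Y where "Y = (\<lambda>k. arc_point (A ! k) 0) ` {..<length A}"
    have "finite {(i, j). i \<in> I \<and> j \<in> I \<and> i \<noteq> j}" by (rule finite_subset[of _ "I \<times> I"]) (auto simp: finite_I)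
    then have "finite X" unfolding X_def using fin by auto
    then have fB: "finite (F \<union> X \<union> Y)" using F(1) by (simp add: Y_def)
    have "\<exists>!s. s \<in> {0..<1} \<and> traverse A s = q" if q: "q \<in> traverse A ` {0..<1}" "q \<notin> F \<union> X \<union> Y" for q
    proof -
      obtain s where s: "s \<in> {0..<1}" "traverse A s = q" using q(1) by blast
      have "s' = s''" if s': "s' \<in> {0..<1}" "traverse A s' = q" and s'': "s'' \<in> {0..<1}" "traverse A s'' = q" for s' s''
      proof -
        have loc: "\<exists>k i a b x. k < length A \<and> A ! k = (i, a, b) \<and> x \<in> {a..b} \<and> c i x = q \<and> a < b \<and>
            x = a + (b - a) * (?m * s - real k)" if s: "s \<in> {0..<1}" "traverse A s = q" for s
        proof -
          obtain k where k: "k < length A" "s \<in> {real k / ?m..<real (Suc k) / ?m}" by (rule traverse_cell_of[OF A s(1)])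
          obtain i a b where arc: "A ! k = (i, a, b)" by (cases "A ! k")
          let ?x = "a + (b - a) * (?m * s - real k)"
          have x: "c i ?x = q" using tr[OF k(1) arc, of s] k(2) s(2) by simp
          have ab: "a \<le> b" using arcs[OF k(1) arc] by simp
          have "a \<noteq> b"
          proof
            assume "a = b"
            then have "q = arc_point (A ! k) 0" using x by (simp add: arc arc_point_def)
            then show False using q(2) k(1) by (auto simp: Y_def)
          qed
          then have "a < b" using ab by simp
          moreover have "0 \<le> ?m * s - real k" "?m * s - real k \<le> 1" using k(2) m by (auto simp: field_simps)
          then have "0 \<le> (b - a) * (?m * s - real k)" "(b - a) * (?m * s - real k) \<le> (b - a) * 1"
            using ab by (intro mult_nonneg_nonneg mult_left_mono; simp)+
          then have "?x \<in> {a..b}" by simp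
          ultimately show ?thesis using k(1) arc x by blast
        qed
        obtain k i a b x where 1: "k < length A" "A ! k = (i, a, b)" "x \<in> {a..b}" "c i x = q" "a < b"
          "x = a + (b - a) * (?m * s' - real k)" using loc[OF s'] by blast
        obtain k' i' a' b' x' where 2: "k' < length A" "A ! k' = (i', a', b')" "x' \<in> {a'..b'}" "c i' x' = q" "a' < b'"
          "x' = a' + (b' - a') * (?m * s'' - real k')" using loc[OF s''] by blast
        have iI: "i \<in> I" "i' \<in> I" using arcs 1(1,2) 2(1,2) by blast+
        have "j = i" if "j \<in> I" "q \<in> range (c j)" for j
        proof (rule ccontr)
          assume "j \<noteq> i"
          moreover have "q \<in> range (c i)" using 1(4) by blast
          ultimately have "q \<in> X" using that iI(1) unfolding X_def by blast
          then show False using q(2) by blast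
        qed
        then have "{j \<in> I. q \<in> range (c j)} = {i}" using iI(1) 1(4) by blast
        then have tot: "(\<Sum>k<length A. hits (A ! k) q) = 1"
          using F(2)[of q] q(2) by (simp add: sum_list_sum_nth atLeast0LessThan)
        have pos: "0 < hits (A ! k) q" "0 < hits (A ! k') q"
          using 1 2 finite_hits[OF iI(1), of a b q] finite_hits[OF iI(2), of a' b' q]
          by (auto simp: hits_def card_gt_0_iff)
        have "k = k'"
        proof (rule ccontr)
          assume "k \<noteq> k'"
          then have "(\<Sum>l\<in>{k, k'}. hits (A ! l) q) \<le> (\<Sum>l<length A. hits (A ! l) q)"
            using 1(1) 2(1) by (intro sum_mono2) auto
          then show False using tot pos \<open>k \<noteq> k'\<close> by simp
        qed
        then have same: "i' = i" "a' = a" "b' = b" using 1(2) 2(2) by auto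
        have "hits (A ! k) q \<le> 1" using member_le_sum[of k "{..<length A}" "\<lambda>l. hits (A ! l) q"] tot 1(1) by simp
        then have le: "card {y \<in> {a..b}. c i y = q} \<le> 1" by (simp add: 1(2) hits_def)
        have "x = x'"
        proof (rule ccontr)
          assume "x \<noteq> x'"
          then have "card {x, x'} = 2" by simp
          moreover have "card {x, x'} \<le> card {y \<in> {a..b}. c i y = q}"
            using 1(3,4) 2(3,4) same finite_hits[OF iI(1)] by (intro card_mono) auto
          ultimately show False using le by simp
        qed
        then show "s' = s''" using 1(5,6) 2(6) same \<open>k = k'\<close> m by simp
      qed
      then show ?thesis using s by blast
    qed
    then have "{q \<in> traverse A ` {0..<1}. \<not> (\<exists>!s. s \<in> {0..<1} \<and> traverse A s = q)} \<subseteq> F \<union> X \<union> Y" by blast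
    then show ?thesis unfolding finite_self_intersections_def using fB finite_subset by blast
  qed
  have "path_image (traverse A) \<subseteq> sphere 0 1" unfolding img using norm_c by auto
  then show ?thesis unfolding sphere_curve_def using ps pt closed len self img by blast
qed

lemma closed_curve_exists:
  assumes conn: "connected (\<Union>i\<in>I. range (c i))"
    and fin: "\<And>i j. i \<in> I \<Longrightarrow> j \<in> I \<Longrightarrow> i \<noteq> j \<Longrightarrow> finite (range (c i) \<inter> range (c j))"
  shows "\<exists>\<gamma>. sphere_curve \<gamma> \<and> path_image \<gamma> = (\<Union>i\<in>I. range (c i)) \<and>
     curve_length \<gamma> = (\<Sum>i\<in>I. 2 * pi * r i) \<and>
     (\<forall>f. continuous_on UNIV f \<longrightarrow>
        curve_integral \<gamma> f = (\<Sum>i\<in>I. 2 * pi * r i * integral {0..1} (\<lambda>x. f (c i x))))"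
proof -
  obtain A where t: "tour I A" using tour_exists[OF conn] ..
  have "curve_length (traverse A) = (\<Sum>i\<in>I. 2 * pi * r i)"
    using traverse_curve_integral[OF t continuous_on_const, of 1]
    by (simp add: curve_length_def curve_integral_def arc_integral_def)
  then show ?thesis
    using traverse_sphere_curve[OF t fin] traverse_curve_integral[OF t]
    by (intro exI[of _ "traverse A"]) (simp add: arc_integral_def)
qed

end

section \<open>A connected family of turned latitude circles\<close>

text \<open>
  The coordinates are numbered by \<open>e\<close>. The set \<open>Z k\<close> contains the
  heights used on \<open>S\<^sup>k\<close>, and \<open>ca\<close> and \<open>sa\<close> are
  cosine and sine of the turning angle. That \<open>sa\<close> bounds all heights makes the
  turned equator reach every parallel; that \<open>ca\<close> is positive keeps the directions
  of all copies apart.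
\<close>

locale latitude_family =
  fixes d :: nat and e :: "nat \<Rightarrow> 'n::finite" and Z :: "nat \<Rightarrow> real set" and ca sa :: real
  assumes d2: "2 \<le> d" and e: "bij_betw e {..d} UNIV"
    and finite_Z: "k \<in> {2..d} \<Longrightarrow> finite (Z k)"
    and zero_Z: "k \<in> {2..d} \<Longrightarrow> 0 \<in> Z k"
    and Z_bound: "k \<in> {2..d} \<Longrightarrow> z \<in> Z k \<Longrightarrow> \<bar>z\<bar> \<le> sa"
    and angle: "0 < ca" "0 < sa" "ca\<^sup>2 + sa\<^sup>2 = 1"
begin

abbreviation ax :: "nat \<Rightarrow> real ^ 'n" where
  "ax k \<equiv> axis (e k) 1"

abbreviation co :: "real \<Rightarrow> real" where
  "co z \<equiv> sqrt (1 - z\<^sup>2)"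

definition rot :: "nat \<Rightarrow> real ^ 'n \<Rightarrow> real ^ 'n" where
  "rot k = coord_rot (e 1) (e k) ca sa"

text \<open>
  The copy with index \<open>\<epsilon>\<close> is turned successively in the planes of the
  coordinates \<open>1\<close> and \<open>k\<close>, \<open>k \<in> \<epsilon>\<close>.
\<close>

primrec turn :: "nat set \<Rightarrow> nat \<Rightarrow> real ^ 'n \<Rightarrow> real ^ 'n" where
  "turn \<epsilon> 0 x = x"
| "turn \<epsilon> (Suc k) x = (if Suc k \<in> \<epsilon> then rot (Suc k) (turn \<epsilon> k x) else turn \<epsilon> k x)"

text \<open>
  Centre and radius of the circle on \<open>S\<^sup>k\<close> at the heights \<open>z 2,
  \<dots>, z k\<close>. A step from \<open>k\<close> to \<open>k + 1\<close> scales the circle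
  by \<open>co (z (k + 1))\<close> and lifts it to the height \<open>z (k + 1)\<close>; the
  recursion really starts at \<open>k = 1\<close>, with the unit circle.
\<close>

primrec cen :: "(nat \<Rightarrow> real) \<Rightarrow> nat \<Rightarrow> real ^ 'n" where
  "cen z 0 = 0"
| "cen z (Suc k) = (if k = 0 then 0 else co (z (Suc k)) *\<^sub>R cen z k + z (Suc k) *\<^sub>R ax (Suc k))"

definition rad :: "(nat \<Rightarrow> real) \<Rightarrow> nat \<Rightarrow> real" where
  "rad z k = (\<Prod>j=2..k. co (z j))"

definition pt :: "(nat \<Rightarrow> real) \<Rightarrow> nat \<Rightarrow> real \<Rightarrow> real ^ 'n" where
  "pt z k = circle_param (cen z k) (rad z k) (ax 1) (ax 0)"

lemma sa_less_1: "sa < 1"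
  using angle by (smt (verit) power2_less_imp_less one_power2 zero_less_power)

lemma Z_less: "k \<in> {2..d} \<Longrightarrow> z \<in> Z k \<Longrightarrow> z\<^sup>2 < 1"
  using Z_bound[of k z] sa_less_1 by (simp add: abs_square_less_1)

lemma co_pos: "k \<in> {2..d} \<Longrightarrow> z \<in> Z k \<Longrightarrow> 0 < co z"
  using Z_less[of k z] by simp

lemma e_eq_iff: "i \<le> d \<Longrightarrow> j \<le> d \<Longrightarrow> e i = e j \<longleftrightarrow> i = j"
  using e unfolding bij_betw_def by (metis atMost_iff inj_onD)

lemma ax_nth: "i \<le> d \<Longrightarrow> j \<le> d \<Longrightarrow> ax i $ e j = (if i = j then 1 else 0)"
  by (auto simp: axis_def e_eq_iff)

lemma inner_ax: "x \<bullet> ax i = x $ e i"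
  by (simp add: inner_axis)

lemma orthogonal_rot: "k \<in> {2..d} \<Longrightarrow> orthogonal_transformation (rot k)"
  unfolding rot_def by (rule orthogonal_coord_rot) (use e_eq_iff[of 1 k] angle in auto)

lemma rot_nth:
  "k \<in> {2..d} \<Longrightarrow> j \<le> d \<Longrightarrow> rot k x $ e j =
    (if j = 1 then ca * x $ e 1 - sa * x $ e k else if j = k then sa * x $ e 1 + ca * x $ e k else x $ e j)"
  using e_eq_iff[of j 1] e_eq_iff[of j k] by (auto simp: rot_def coord_rot_def)

lemma vec_eq_e_iff: "x = y \<longleftrightarrow> (\<forall>j\<le>d. x $ e j = y $ e j)" for x y :: "real ^ 'n"
proof
  assume *: "\<forall>j\<le>d. x $ e j = y $ e j"
  have "x $ i = y $ i" for i
  proof -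
    obtain j where "j \<le> d" "i = e j" using e unfolding bij_betw_def by (metis UNIV_I atMost_iff imageE)
    then show ?thesis using * by simp
  qed
  then show "x = y" by (simp add: vec_eq_iff)
qed simp

lemma orthogonal_turn:
  assumes "\<epsilon> \<subseteq> {2..d}"
  shows "orthogonal_transformation (turn \<epsilon> k)"
proof (induction k)
  case 0
  show ?case by (simp add: orthogonal_transformation_id[unfolded id_def])
next
  case (Suc k)
  show ?case
  proof (cases "Suc k \<in> \<epsilon>")
    case True
    then have "orthogonal_transformation (rot (Suc k) \<circ> turn \<epsilon> k)"
      using assms by (intro orthogonal_transformation_compose Suc orthogonal_rot) auto
    moreover have "turn \<epsilon> (Suc k) = rot (Suc k) \<circ> turn \<epsilon> k" using True by (auto simp: fun_eq_iff)
    ultimately show ?thesis by (simp only:)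
  next
    case False
    then have "turn \<epsilon> (Suc k) = turn \<epsilon> k" by (auto simp: fun_eq_iff)
    then show ?thesis using Suc by simp
  qed
qed

lemma turn_fixes:
  assumes "\<epsilon> \<subseteq> {2..d}" "j \<le> d" "j = 0 \<or> k < j \<and> 2 \<le> j"
  shows "turn \<epsilon> k (ax j) = ax j"
  using assms(3)
proof (induction k)
  case (Suc k)
  then have IH: "turn \<epsilon> k (ax j) = ax j" by auto
  show ?case
  proof (cases "Suc k \<in> \<epsilon>")
    case True
    then have k: "Suc k \<in> {2..d}" using assms by auto
    have "rot (Suc k) (ax j) = ax j"
      unfolding vec_eq_e_iff using k assms(2) Suc.prems by (auto simp: rot_nth ax_nth)
    then show ?thesis using True IH by simp
  qed (use IH in simp)
qed simp

text \<open>
  All turned planes contain \<open>ax 0\<close>, and their second direction \<open>turn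
  \<epsilon> k (ax 1)\<close> reveals \<open>\<epsilon>\<close> by its support.
\<close>

lemma turn_ax1:
  assumes "\<epsilon> \<subseteq> {2..d}" "k \<le> d"
  shows "0 < turn \<epsilon> k (ax 1) $ e 1 \<and>
    (\<forall>j\<in>{2..d}. turn \<epsilon> k (ax 1) $ e j \<noteq> 0 \<longleftrightarrow> j \<in> \<epsilon> \<and> j \<le> k)"
  using assms(2)
proof (induction k)
  case 0
  then show ?case using d2 by (auto simp: ax_nth)
next
  case (Suc k)
  let ?y = "turn \<epsilon> k (ax 1)"
  have IH: "0 < ?y $ e 1" "\<And>j. j \<in> {2..d} \<Longrightarrow> ?y $ e j \<noteq> 0 \<longleftrightarrow> j \<in> \<epsilon> \<and> j \<le> k" using Suc by auto
  show ?case
  proof (cases "Suc k \<in> \<epsilon>")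
    case True
    then have k: "Suc k \<in> {2..d}" using assms by auto
    have 0: "?y $ e (Suc k) = 0" using IH(2)[OF k] by simp
    have "rot (Suc k) ?y $ e 1 = ca * ?y $ e 1" using rot_nth[OF k, of 1] d2 0 by simp
    moreover have "rot (Suc k) ?y $ e j \<noteq> 0 \<longleftrightarrow> j \<in> \<epsilon> \<and> j \<le> Suc k" if j: "j \<in> {2..d}" for j
      using rot_nth[OF k, of j ?y] IH(1) IH(2)[OF j] j angle 0 True by auto
    ultimately show ?thesis using True IH(1) angle by simp
  next
    case False
    then show ?thesis using IH by (auto simp: le_Suc_eq)
  qed
qed

lemma pt_1: "pt z (Suc 0) x = cos (2 * pi * x) *\<^sub>R ax 1 + sin (2 * pi * x) *\<^sub>R ax 0"
  by (simp add: pt_def circle_param_def rad_def)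

lemma pt_Suc: "1 \<le> k \<Longrightarrow> pt z (Suc k) x = co (z (Suc k)) *\<^sub>R pt z k x + z (Suc k) *\<^sub>R ax (Suc k)"
proof -
  assume k: "1 \<le> k"
  then have "{2..Suc k} = insert (Suc k) {2..k}" by auto
  then have "rad z (Suc k) = co (z (Suc k)) * rad z k" by (simp add: rad_def)
  then show ?thesis using k by (simp add: pt_def circle_param_def algebra_simps)
qed

lemma cen_nth: "k \<le> d \<Longrightarrow> j \<le> d \<Longrightarrow> j < 2 \<or> k < j \<Longrightarrow> cen z k $ e j = 0"
  by (induction k) (auto simp: ax_nth)

lemma pt_nth: "k \<le> d \<Longrightarrow> j \<le> d \<Longrightarrow> 2 \<le> j \<Longrightarrow> k < j \<Longrightarrow> pt z k x $ e j = 0"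
  using cen_nth[of k j z] by (simp add: pt_def circle_param_def ax_nth)

lemma pt_inj:
  assumes "1 \<le> k" "k \<le> d" "\<forall>j\<in>{2..k}. z j \<in> Z j" "\<forall>j\<in>{2..k}. z' j \<in> Z j" "pt z k x = pt z' k y"
  shows "\<forall>j\<in>{2..k}. z j = z' j"
  using assms
proof (induction k rule: nat_induct_at_least)
  case base
  then show ?case by simp
next
  case (Suc k)
  have eq: "co (z (Suc k)) *\<^sub>R pt z k x + z (Suc k) *\<^sub>R ax (Suc k) = co (z' (Suc k)) *\<^sub>R pt z' k y + z' (Suc k) *\<^sub>R ax (Suc k)"
    using Suc.prems(4) unfolding pt_Suc[OF Suc.hyps] .
  from arg_cong[OF this, of "\<lambda>x. x $ e (Suc k)"] have zz: "z (Suc k) = z' (Suc k)"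
  proof -
    have k: "Suc k \<le> d" "2 \<le> Suc k" "k \<le> d" "k < Suc k" using Suc.hyps Suc.prems(1) by auto
    assume "(co (z (Suc k)) *\<^sub>R pt z k x + z (Suc k) *\<^sub>R ax (Suc k)) $ e (Suc k) =
       (co (z' (Suc k)) *\<^sub>R pt z' k y + z' (Suc k) *\<^sub>R ax (Suc k)) $ e (Suc k)"
    then show ?thesis
      using pt_nth[OF k(3,1,2,4), of z x] pt_nth[OF k(3,1,2,4), of z' y] ax_nth[OF k(1,1)] by simp
  qed
  have "0 < co (z (Suc k))" using Suc.hyps Suc.prems(1,2) by (intro co_pos[of "Suc k"]) auto
  then have "pt z k x = pt z' k y" using eq zz by simp
  then have "\<forall>j\<in>{2..k}. z j = z' j" using Suc.prems(1-3) by (intro Suc.IH) auto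
  then show ?case using zz by (auto simp: le_Suc_eq)
qed

lemma cen_rad:
  assumes "1 \<le> k" "k \<le> d" "\<forall>j\<in>{2..k}. z j \<in> Z j"
  shows "(norm (cen z k))\<^sup>2 + (rad z k)\<^sup>2 = 1 \<and> 0 < rad z k"
  using assms
proof (induction k rule: nat_induct_at_least)
  case base
  then show ?case by (simp add: rad_def)
next
  case (Suc k)
  let ?z = "z (Suc k)"
  have IH: "(norm (cen z k))\<^sup>2 + (rad z k)\<^sup>2 = 1" "0 < rad z k" using Suc by auto
  have zZ: "?z \<in> Z (Suc k)" "Suc k \<in> {2..d}" using Suc by auto
  then have c: "0 < co ?z" "(co ?z)\<^sup>2 = 1 - ?z\<^sup>2" using co_pos[of "Suc k" ?z] Z_less[of "Suc k" ?z] by auto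
  have "{2..Suc k} = insert (Suc k) {2..k}" using Suc.hyps by auto
  then have rad: "rad z (Suc k) = co ?z * rad z k" by (simp add: rad_def)
  have "cen z k \<bullet> ax (Suc k) = 0" unfolding inner_ax using Suc by (intro cen_nth) auto
  then have "(norm (cen z (Suc k)))\<^sup>2 = (co ?z)\<^sup>2 * (norm (cen z k))\<^sup>2 + ?z\<^sup>2"
    using Suc.hyps unfolding power2_norm_eq_inner
    by (simp add: inner_add_left inner_add_right inner_commute[of "ax (Suc k)" "cen z k"] inner_ax) (simp add: power2_eq_square axis_def)
  then have "(norm (cen z (Suc k)))\<^sup>2 + (rad z (Suc k))\<^sup>2 = (co ?z)\<^sup>2 * ((norm (cen z k))\<^sup>2 + (rad z k)\<^sup>2) + ?z\<^sup>2"
    by (simp only: rad power_mult_distrib distrib_left)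
  then have "(norm (cen z (Suc k)))\<^sup>2 + (rad z (Suc k))\<^sup>2 = 1" by (simp only: IH c) simp
  then show ?case using rad c(1) IH(2) by simp
qed

definition index_set :: "(nat set \<times> (nat \<Rightarrow> real)) set" where
  "index_set = Pow {2..d} \<times> PiE {2..d} Z"

definition ucirc where "ucirc i = turn (fst i) d (ax 1)" for i :: "nat set \<times> (nat \<Rightarrow> real)"
definition pcirc where "pcirc i = turn (fst i) d (cen (snd i) d)" for i :: "nat set \<times> (nat \<Rightarrow> real)"

lemma circle_param_turn:
  assumes "\<epsilon> \<subseteq> {2..d}"
  shows "circle_param (pcirc (\<epsilon>, z)) (rad z d) (ucirc (\<epsilon>, z)) (ax 0) x = turn \<epsilon> d (pt z d x)"
proof -
  have lin: "linear (turn \<epsilon> d)" using orthogonal_turn[OF assms] by (rule orthogonal_transformation_linear)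
  have "turn \<epsilon> d (ax 0) = ax 0" using turn_fixes[OF assms, of 0] by simp
  then show ?thesis
    by (simp add: circle_param_def pt_def pcirc_def ucirc_def linear_add[OF lin] linear_scale[OF lin])
qed

lemma circle_family: "circle_family index_set pcirc ucirc (\<lambda>_. ax 0) (\<lambda>i. rad (snd i) d)"
proof
  show "finite index_set" unfolding index_set_def using finite_Z by (intro finite_cartesian_product finite_PiE) auto
  have "restrict (\<lambda>_. 0) {2..d} \<in> PiE {2..d} Z" using zero_Z by auto
  then show "index_set \<noteq> {}" unfolding index_set_def by blast
  fix i assume i: "i \<in> index_set"
  obtain \<epsilon> z where i': "i = (\<epsilon>, z)" by (cases i)
  then have \<epsilon>: "\<epsilon> \<subseteq> {2..d}" and z: "\<forall>j\<in>{2..d}. z j \<in> Z j" using i by (auto simp: index_set_def)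
  have o: "orthogonal_transformation (turn \<epsilon> d)" by (rule orthogonal_turn[OF \<epsilon>])
  have f0: "ax 0 = turn \<epsilon> d (ax 0)" using turn_fixes[OF \<epsilon>, of 0] by simp
  have inn: "turn \<epsilon> d x \<bullet> turn \<epsilon> d y = x \<bullet> y" for x y using o by (simp add: orthogonal_transformation_def)
  note cr = cen_rad[of d z] z d2
  show "0 < rad (snd i) d" using cr by (simp add: i')
  show "norm (ucirc i) = 1" using orthogonal_transformation_norm[OF o] by (simp add: i' ucirc_def)
  show "norm (ax 0) = 1" by simp
  show "ucirc i \<bullet> ax 0 = 0"
    unfolding i' ucirc_def fst_conv by (subst f0) (simp only: inn inner_ax, use d2 in \<open>simp add: ax_nth\<close>)
  show "pcirc i \<bullet> ucirc i = 0"
    unfolding i' ucirc_def pcirc_def fst_conv snd_conv using d2 by (simp only: inn inner_ax) (simp add: cen_nth)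
  show "pcirc i \<bullet> ax 0 = 0"
    unfolding i' pcirc_def fst_conv snd_conv by (subst f0) (simp only: inn inner_ax, use d2 in \<open>simp add: cen_nth\<close>)
  show "(norm (pcirc i))\<^sup>2 + (rad (snd i) d)\<^sup>2 = 1"
    using cr orthogonal_transformation_norm[OF o] by (simp add: i' pcirc_def)
qed

sublocale circle_family index_set pcirc ucirc "\<lambda>_. ax 0" "\<lambda>i. rad (snd i) d"
  by (rule circle_family)

text \<open>
  On the circle \<open>j\<close> the coordinate \<open>k\<close> is constant, and on the circle
  \<open>i\<close> it takes each value at most twice.
\<close>

lemma finite_intersection_turned:
  assumes i: "i \<in> index_set" and j: "j \<in> index_set" and k: "k \<in> fst i" "k \<notin> fst j"
  shows "finite (range (c i) \<inter> range (c j))"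
proof -
  have \<epsilon>: "fst i \<subseteq> {2..d}" "fst j \<subseteq> {2..d}" using i j by (auto simp: index_set_def)
  then have kd: "k \<in> {2..d}" using k by auto
  have ui: "ucirc i $ e k \<noteq> 0" "ucirc j $ e k = 0"
    using turn_ax1[OF \<epsilon>(1), of d] turn_ax1[OF \<epsilon>(2), of d] kd k by (auto simp: ucirc_def)
  have ax0: "ax 0 $ e k = 0" using kd by (simp add: ax_nth)
  let ?r = "rad (snd i) d"
  have r: "0 < ?r" using r_pos[OF i] .
  define \<kappa> where "\<kappa> = (pcirc j $ e k - pcirc i $ e k) / (?r * ucirc i $ e k)"
  let ?f = "\<lambda>s. pcirc i + (?r * \<kappa>) *\<^sub>R ucirc i + (?r * s) *\<^sub>R ax 0"
  have "range (c i) \<inter> range (c j) \<subseteq> ?f ` {sqrt (1 - \<kappa>\<^sup>2), - sqrt (1 - \<kappa>\<^sup>2)}"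
  proof
    fix q assume "q \<in> range (c i) \<inter> range (c j)"
    then obtain x y where q: "q = c i x" "q = c j y" by blast
    have "q $ e k = pcirc j $ e k" unfolding q(2) by (simp add: circle_param_def ui ax0)
    moreover have "q $ e k = pcirc i $ e k + ?r * cos (2 * pi * x) * ucirc i $ e k"
      unfolding q(1) by (simp add: circle_param_def ax0)
    ultimately have cx: "cos (2 * pi * x) = \<kappa>" using r ui(1) by (simp add: \<kappa>_def field_simps)
    then have "(sin (2 * pi * x))\<^sup>2 = 1 - \<kappa>\<^sup>2" by (simp add: sin_squared_eq)
    then have "sin (2 * pi * x) \<in> {sqrt (1 - \<kappa>\<^sup>2), - sqrt (1 - \<kappa>\<^sup>2)}"
      by (metis insertI1 insertI2 power2_eq_iff real_sqrt_abs abs_if real_sqrt_pow2_iff zero_le_power2)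
    moreover have "q = ?f (sin (2 * pi * x))" unfolding q(1) by (simp add: circle_param_def cx)
    ultimately show "q \<in> ?f ` {sqrt (1 - \<kappa>\<^sup>2), - sqrt (1 - \<kappa>\<^sup>2)}" by blast
  qed
  then show ?thesis by (rule finite_subset) simp
qed

lemma finite_intersection:
  assumes i: "i \<in> index_set" and j: "j \<in> index_set" and ij: "i \<noteq> j"
  shows "finite (range (c i) \<inter> range (c j))"
proof (cases "fst i = fst j")
  case False
  then obtain k where "k \<in> fst i \<and> k \<notin> fst j \<or> k \<in> fst j \<and> k \<notin> fst i" by blast
  then show ?thesis
    using finite_intersection_turned[OF i j] finite_intersection_turned[OF j i] by (metis inf_commute)
next
  case True
  obtain \<epsilon> z z' where ij': "i = (\<epsilon>, z)" "j = (\<epsilon>, z')" using True by (metis prod.collapse)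
  have \<epsilon>: "\<epsilon> \<subseteq> {2..d}" and z: "z \<in> PiE {2..d} Z" "z' \<in> PiE {2..d} Z"
    using i j by (auto simp: index_set_def ij')
  have "range (c i) \<inter> range (c j) = {}"
  proof (rule ccontr)
    assume "range (c i) \<inter> range (c j) \<noteq> {}"
    then obtain x y where "c i x = c j y" by blast
    then have "turn \<epsilon> d (pt z d x) = turn \<epsilon> d (pt z' d y)"
      using circle_param_turn[OF \<epsilon>, of z x] circle_param_turn[OF \<epsilon>, of z' y] by (simp add: ij')
    then have "pt z d x = pt z' d y" using orthogonal_transformation_inj[OF orthogonal_turn[OF \<epsilon>]] by (metis injD)
    then have "\<forall>j\<in>{2..d}. z j = z' j" using z d2 by (intro pt_inj) auto
    then have "z = z'" using z by (intro PiE_ext) auto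
    then show False using ij ij' by simp
  qed
  then show ?thesis by simp
qed

definition great_circle :: "(real ^ 'n) set" where
  "great_circle = {x *\<^sub>R ax 1 + y *\<^sub>R ax 0 | x y. x\<^sup>2 + y\<^sup>2 = 1}"

text \<open>
  The union of all circles on \<open>S\<^sup>k\<close>, including the copies turned so far.
\<close>

definition layer :: "nat \<Rightarrow> (real ^ 'n) set" where
  "layer k = {turn \<epsilon> k (pt z k x) | \<epsilon> z x. \<epsilon> \<subseteq> {2..d} \<and> (\<forall>j\<in>{2..k}. z j \<in> Z j)}"

definition parallel :: "nat \<Rightarrow> real \<Rightarrow> (real ^ 'n) set" where
  "parallel k z = (\<lambda>y. co z *\<^sub>R y + z *\<^sub>R ax (Suc k)) ` layer k"

lemma great_circleI: "x\<^sup>2 + y\<^sup>2 = 1 \<Longrightarrow> x *\<^sub>R ax 1 + y *\<^sub>R ax 0 \<in> great_circle"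
  unfolding great_circle_def by blast

lemma great_circle_eq_range: "great_circle = range (pt (\<lambda>_. 0) 1)"
  unfolding great_circle_def
proof (intro equalityI subsetI)
    fix q assume "q \<in> {x *\<^sub>R ax 1 + y *\<^sub>R ax 0 | x y. x\<^sup>2 + y\<^sup>2 = (1::real)}"
    then obtain x y where q: "q = x *\<^sub>R ax 1 + y *\<^sub>R ax 0" and xy: "x\<^sup>2 + y\<^sup>2 = 1" by blast
    from sincos_total_2pi[OF xy] obtain t where "x = cos t" "y = sin t" by blast
    then have "q = pt (\<lambda>_. 0) 1 (t / (2 * pi))" by (simp add: q pt_1)
    then show "q \<in> range (pt (\<lambda>_. 0) 1)" by blast
  next
    fix q assume "q \<in> range (pt (\<lambda>_. 0) 1)"
    then obtain x where "q = cos (2 * pi * x) *\<^sub>R ax 1 + sin (2 * pi * x) *\<^sub>R ax 0" by (auto simp: pt_1)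
    moreover have "(cos (2 * pi * x))\<^sup>2 + (sin (2 * pi * x))\<^sup>2 = 1" by simp
    ultimately show "q \<in> {x *\<^sub>R ax 1 + y *\<^sub>R ax 0 | x y. x\<^sup>2 + y\<^sup>2 = (1::real)}" by blast
  qed

lemma layer_1: "layer 1 = great_circle"
proof -
  have t: "turn \<epsilon> 1 y = y" if "\<epsilon> \<subseteq> {2..d}" for \<epsilon> y
    using that by auto
  have p: "pt z 1 = pt (\<lambda>_. 0) 1" for z
    by (simp add: pt_1 fun_eq_iff)
  have "{turn \<epsilon> 1 (pt z 1 x) | \<epsilon> z x. \<epsilon> \<subseteq> {2..d} \<and> (\<forall>j\<in>{2..1}. z j \<in> Z j)} = range (pt (\<lambda>_. 0) 1)"
  proof (intro equalityI subsetI)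
    fix q assume "q \<in> {turn \<epsilon> 1 (pt z 1 x) | \<epsilon> z x. \<epsilon> \<subseteq> {2..d} \<and> (\<forall>j\<in>{2..1}. z j \<in> Z j)}"
    then obtain \<epsilon> z x where "q = turn \<epsilon> 1 (pt z 1 x)" "\<epsilon> \<subseteq> {2..d}" by blast
    then show "q \<in> range (pt (\<lambda>_. 0) 1)" using t p[of z] by simp
  next
    fix q assume "q \<in> range (pt (\<lambda>_. 0) 1)"
    then obtain x where "q = pt (\<lambda>_. 0) 1 x" by blast
    then have "q = turn {} 1 (pt (\<lambda>_. 0) 1 x)" using t by simp
    moreover have "{} \<subseteq> {2..d}" "\<forall>j\<in>{2..1::nat}. (0::real) \<in> Z j" by auto
    ultimately show "q \<in> {turn \<epsilon> 1 (pt z 1 x) | \<epsilon> z x. \<epsilon> \<subseteq> {2..d} \<and> (\<forall>j\<in>{2..1}. z j \<in> Z j)}" by blast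
  qed
  also have "\<dots> = great_circle" by (rule great_circle_eq_range[symmetric])
  finally show ?thesis unfolding layer_def .
qed

text \<open>
  Turning in the first \<open>k\<close> coordinates commutes with the passage to a parallel, so
  the union of circles has a recursive description even though all turns are applied last.
\<close>

lemma layer_Suc:
  assumes k: "1 \<le> k" "k < d"
  shows "layer (Suc k) = (\<Union>z\<in>Z (Suc k). parallel k z \<union> rot (Suc k) ` parallel k z)"
proof -
  have step: "turn \<epsilon> k (pt z (Suc k) x) = co (z (Suc k)) *\<^sub>R turn \<epsilon> k (pt z k x) + z (Suc k) *\<^sub>R ax (Suc k)"
    if \<epsilon>: "\<epsilon> \<subseteq> {2..d}" for \<epsilon> z x
  proof -
    have lin: "linear (turn \<epsilon> k)" using orthogonal_turn[OF \<epsilon>] by (rule orthogonal_transformation_linear)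
    have "turn \<epsilon> k (ax (Suc k)) = ax (Suc k)" using k by (intro turn_fixes[OF \<epsilon>]) auto
    then show ?thesis by (simp only: pt_Suc[OF k(1)] linear_add[OF lin] linear_scale[OF lin])
  qed
  show ?thesis
  proof (intro equalityI subsetI)
    fix q assume "q \<in> layer (Suc k)"
    then obtain \<epsilon> z x where q: "q = turn \<epsilon> (Suc k) (pt z (Suc k) x)" "\<epsilon> \<subseteq> {2..d}" "\<forall>j\<in>{2..Suc k}. z j \<in> Z j"
      unfolding layer_def by blast
    have "turn \<epsilon> k (pt z k x) \<in> layer k" unfolding layer_def using q by fastforce
    then have "turn \<epsilon> k (pt z (Suc k) x) \<in> parallel k (z (Suc k))"
      unfolding parallel_def step[OF q(2)] by blast
    moreover have "z (Suc k) \<in> Z (Suc k)" using q(3) k by auto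
    ultimately show "q \<in> (\<Union>z\<in>Z (Suc k). parallel k z \<union> rot (Suc k) ` parallel k z)"
      unfolding q(1) turn.simps(2) by (auto split: if_splits)
  next
    fix q assume "q \<in> (\<Union>z\<in>Z (Suc k). parallel k z \<union> rot (Suc k) ` parallel k z)"
    then obtain \<zeta> w where \<zeta>: "\<zeta> \<in> Z (Suc k)" and w: "w \<in> parallel k \<zeta>" and q: "q = w \<or> q = rot (Suc k) w" by blast
    then obtain \<epsilon> z x where \<epsilon>: "\<epsilon> \<subseteq> {2..d}" and z: "\<forall>j\<in>{2..k}. z j \<in> Z j"
      and w': "w = co \<zeta> *\<^sub>R turn \<epsilon> k (pt z k x) + \<zeta> *\<^sub>R ax (Suc k)"
      unfolding parallel_def layer_def by blast
    define z' where "z' = z(Suc k := \<zeta>)"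
    have pt_cong: "pt z' l x = pt z l x" if "l \<le> k" for l
    proof -
      have "cen z' l = cen z l" using that by (induction l) (auto simp: z'_def)
      moreover have "rad z' l = rad z l" unfolding rad_def using that by (intro prod.cong) (auto simp: z'_def)
      ultimately show ?thesis by (simp add: pt_def)
    qed
    have tc: "turn \<epsilon>' l y = turn \<epsilon> l y" if "\<And>j. j \<le> k \<Longrightarrow> j \<in> \<epsilon>' \<longleftrightarrow> j \<in> \<epsilon>" "l \<le> k" for \<epsilon>' l y
      using that(2) by (induction l) (auto simp: that(1))
    have z'Z: "\<forall>j\<in>{2..Suc k}. z' j \<in> Z j" using z \<zeta> by (auto simp: z'_def le_Suc_eq)
    have mem: "turn \<epsilon>' (Suc k) (pt z' (Suc k) x) \<in> layer (Suc k)" if "\<epsilon>' \<subseteq> {2..d}" for \<epsilon>'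
      unfolding layer_def using that z'Z by blast
    have w'': "w = turn \<epsilon>' k (pt z' (Suc k) x)" if "\<epsilon>' \<subseteq> {2..d}" "\<And>j. j \<le> k \<Longrightarrow> j \<in> \<epsilon>' \<longleftrightarrow> j \<in> \<epsilon>" for \<epsilon>'
      unfolding step[OF that(1)] w' using tc[OF that(2), of k] pt_cong[of k] by (simp add: z'_def)
    show "q \<in> layer (Suc k)"
    proof (cases "q = w")
      case True
      let ?\<epsilon> = "\<epsilon> - {Suc k}"
      have "?\<epsilon> \<subseteq> {2..d}" using \<epsilon> by blast
      then have "q = turn ?\<epsilon> (Suc k) (pt z' (Suc k) x)" using w''[of ?\<epsilon>] True by auto
      then show ?thesis using mem[OF \<open>?\<epsilon> \<subseteq> {2..d}\<close>] by simp
    next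
      case False
      let ?\<epsilon> = "insert (Suc k) \<epsilon>"
      have "?\<epsilon> \<subseteq> {2..d}" using \<epsilon> k by auto
      then have "q = turn ?\<epsilon> (Suc k) (pt z' (Suc k) x)" using w''[of ?\<epsilon>] False q by auto
      then show ?thesis using mem[OF \<open>?\<epsilon> \<subseteq> {2..d}\<close>] by simp
    qed
  qed
qed

lemma parallel_0: "parallel k 0 = layer k"
  by (simp add: parallel_def)

text \<open>
  Everything happens on the sphere of the coordinates \<open>0\<close>, \<open>1\<close> and
  \<open>k + 1\<close>. The turned great circle reaches the height \<open>sa \<ge>
  \<bar>z\<bar>\<close> there and hence meets the parallel at height \<open>z\<close>. By
  symmetry the turned parallel meets the great circle.
\<close>

lemma parallel_meets_turned_equator:
  assumes k: "Suc k \<in> {2..d}" and gc: "great_circle \<subseteq> layer k" and z: "z \<in> Z (Suc k)"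
  shows "parallel k z \<inter> rot (Suc k) ` layer k \<noteq> {}"
    and "rot (Suc k) ` parallel k z \<inter> layer k \<noteq> {}"
proof -
  have zs: "z\<^sup>2 \<le> sa\<^sup>2" using Z_bound[OF k z] by (simp add: abs_le_square_iff[symmetric] angle less_imp_le abs_of_pos)
  define s where "s = co z"
  have s: "0 < s" "s\<^sup>2 = 1 - z\<^sup>2" using co_pos[OF k z] Z_less[OF k z] by (auto simp: s_def)
  \<comment> \<open>The point \<open>(z / sa) *\<^sub>R ax 1 + y *\<^sub>R ax 0\<close> of the great circle is turned to a point of height \<open>z\<close>.\<close>
  define y where "y = sqrt (1 - (z / sa)\<^sup>2)"
  have y: "(z / sa)\<^sup>2 + y\<^sup>2 = 1" using zs angle by (simp add: y_def power_divide)
  have ca2: "ca\<^sup>2 = 1 - sa\<^sup>2" using angle by simp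
  have rot1: "rot (Suc k) (a *\<^sub>R ax 1 + b *\<^sub>R ax 0 + f *\<^sub>R ax (Suc k)) =
      (ca * a - sa * f) *\<^sub>R ax 1 + b *\<^sub>R ax 0 + (sa * a + ca * f) *\<^sub>R ax (Suc k)" for a b f
    unfolding vec_eq_e_iff using k d2 by (auto simp: rot_nth ax_nth)
  have key: "(ca * z / sa)\<^sup>2 + y\<^sup>2 = s\<^sup>2"
  proof -
    have "y\<^sup>2 = 1 - (z / sa)\<^sup>2" using y by simp
    then have "(ca * z / sa)\<^sup>2 + y\<^sup>2 = ca\<^sup>2 * (z / sa)\<^sup>2 + (1 - (z / sa)\<^sup>2)"
      by (simp add: power_mult_distrib power_divide)
    also have "\<dots> = 1 - sa\<^sup>2 * (z / sa)\<^sup>2" unfolding ca2 by (simp add: algebra_simps)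
    also have "\<dots> = s\<^sup>2" using angle s by (simp add: power_divide)
    finally show ?thesis .
  qed
  have unit: "(a * z / (sa * s))\<^sup>2 + (y / s)\<^sup>2 = 1" if "a\<^sup>2 = ca\<^sup>2" for a
  proof -
    have "(a * z / (sa * s))\<^sup>2 + (y / s)\<^sup>2 = ((ca * z / sa)\<^sup>2 + y\<^sup>2) / s\<^sup>2"
      using that by (simp add: power_mult_distrib power_divide add_divide_distrib)
    then show ?thesis unfolding key using s(1) by simp
  qed
  have "(z / sa) *\<^sub>R ax 1 + y *\<^sub>R ax 0 \<in> layer k" using gc great_circleI[OF y] by blast
  moreover have "rot (Suc k) ((z / sa) *\<^sub>R ax 1 + y *\<^sub>R ax 0) = (ca * z / sa) *\<^sub>R ax 1 + y *\<^sub>R ax 0 + z *\<^sub>R ax (Suc k)"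
    using rot1[of "z / sa" y 0] angle by simp
  ultimately have 1: "(ca * z / sa) *\<^sub>R ax 1 + y *\<^sub>R ax 0 + z *\<^sub>R ax (Suc k) \<in> rot (Suc k) ` layer k"
    by (metis imageI)
  have "(ca * z / (sa * s)) *\<^sub>R ax 1 + (y / s) *\<^sub>R ax 0 \<in> layer k"
    using gc great_circleI[OF unit[of ca]] by auto
  then have "s *\<^sub>R ((ca * z / (sa * s)) *\<^sub>R ax 1 + (y / s) *\<^sub>R ax 0) + z *\<^sub>R ax (Suc k) \<in> parallel k z"
    unfolding parallel_def s_def by blast
  then have "(ca * z / sa) *\<^sub>R ax 1 + y *\<^sub>R ax 0 + z *\<^sub>R ax (Suc k) \<in> parallel k z"
    using s by (simp add: scaleR_add_right)
  with 1 show "parallel k z \<inter> rot (Suc k) ` layer k \<noteq> {}" by blast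
  have "(- ca * z / (sa * s)) *\<^sub>R ax 1 + (y / s) *\<^sub>R ax 0 \<in> layer k"
    using gc great_circleI[OF unit[of "- ca"]] by auto
  then have "s *\<^sub>R ((- ca * z / (sa * s)) *\<^sub>R ax 1 + (y / s) *\<^sub>R ax 0) + z *\<^sub>R ax (Suc k) \<in> parallel k z"
    unfolding parallel_def s_def by blast
  then have "(- ca * z / sa) *\<^sub>R ax 1 + y *\<^sub>R ax 0 + z *\<^sub>R ax (Suc k) \<in> parallel k z"
    using s by (simp add: scaleR_add_right scaleR_diff_right)
  moreover have "rot (Suc k) ((- ca * z / sa) *\<^sub>R ax 1 + y *\<^sub>R ax 0 + z *\<^sub>R ax (Suc k)) = (- z / sa) *\<^sub>R ax 1 + y *\<^sub>R ax 0"
  proof -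
    have "ca * (- ca * z / sa) - sa * z = - (ca\<^sup>2 + sa\<^sup>2) * z / sa"
      using angle(2) by (simp add: power2_eq_square field_simps)
    then show ?thesis using angle unfolding rot1 by simp
  qed
  ultimately have "(- z / sa) *\<^sub>R ax 1 + y *\<^sub>R ax 0 \<in> rot (Suc k) ` parallel k z" by (metis imageI)
  moreover have "(- z / sa) *\<^sub>R ax 1 + y *\<^sub>R ax 0 \<in> layer k"
    using gc great_circleI[of "- z / sa" y] y by auto
  ultimately show "rot (Suc k) ` parallel k z \<inter> layer k \<noteq> {}" by blast
qed

text \<open>
  Every parallel meets the turned equator and every turned parallel meets the equator, which in
  turn meet each other.
\<close>

lemma layer_connected:
  assumes "1 \<le> k" "k \<le> d"
  shows "connected (layer k) \<and> great_circle \<subseteq> layer k"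
  using assms
proof (induction k rule: nat_induct_at_least)
  case base
  have "connected (range (pt (\<lambda>_. 0) 1))"
    unfolding pt_def circle_param_def by (intro connected_continuous_image continuous_intros) simp
  then show ?case using layer_1 great_circle_eq_range by simp
next
  case (Suc k)
  then have k: "Suc k \<in> {2..d}" "1 \<le> k" "k < d" by auto
  have IH: "connected (layer k)" "great_circle \<subseteq> layer k" using Suc by auto
  have lin: "linear (rot (Suc k))" using orthogonal_rot[OF k(1)] by (rule orthogonal_transformation_linear)
  then have cr: "continuous_on A (rot (Suc k))" for A by (simp add: linear_continuous_on linear_conv_bounded_linear)
  have cA: "connected (parallel k z)" for z
    unfolding parallel_def by (intro connected_continuous_image continuous_intros IH)
  have cB: "connected (rot (Suc k) ` parallel k z)" for z
    by (intro connected_continuous_image cr cA)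
  let ?A = "parallel k" and ?B = "\<lambda>z. rot (Suc k) ` parallel k z"
  have 0: "0 \<in> Z (Suc k)" by (rule zero_Z[OF k(1)])
  have meet: "?A z \<inter> ?B 0 \<noteq> {}" "?B z \<inter> ?A 0 \<noteq> {}" if "z \<in> Z (Suc k)" for z
    using parallel_meets_turned_equator[OF k(1) IH(2) that] by (simp_all add: parallel_0)
  let ?T = "\<lambda>z. ?B z \<union> (?A z \<union> (?B 0 \<union> ?A 0))"
  have "connected (?T z)" if z: "z \<in> Z (Suc k)" for z
  proof -
    have 1: "connected (?B 0 \<union> ?A 0)" using meet(2)[OF 0] by (rule connected_Un[OF cB cA])
    have "?A z \<inter> (?B 0 \<union> ?A 0) \<noteq> {}" using meet(1)[OF z] by blast
    then have 2: "connected (?A z \<union> (?B 0 \<union> ?A 0))" by (rule connected_Un[OF cA 1])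
    have "?B z \<inter> (?A z \<union> (?B 0 \<union> ?A 0)) \<noteq> {}" using meet(2)[OF z] by blast
    then show ?thesis by (rule connected_Un[OF cB 2])
  qed
  moreover have "?A 0 \<noteq> {}" using meet(2)[OF 0] by blast
  then have "(\<Inter>z\<in>Z (Suc k). ?T z) \<noteq> {}" by blast
  ultimately have "connected (\<Union>z\<in>Z (Suc k). ?T z)" by (intro connected_Union) auto
  moreover have "(\<Union>z\<in>Z (Suc k). ?T z) = layer (Suc k)" unfolding layer_Suc[OF k(2,3)] using 0 by blast
  moreover have "great_circle \<subseteq> layer (Suc k)"
  proof -
    have "parallel k 0 \<subseteq> layer (Suc k)" unfolding layer_Suc[OF k(2,3)] using 0 by blast
    then show ?thesis using IH(2) unfolding parallel_0 by blast
  qed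
  ultimately show ?case by simp
qed

lemma union_of_circles: "(\<Union>i\<in>index_set. range (c i)) = layer d"
proof (intro equalityI subsetI)
  fix q assume "q \<in> (\<Union>i\<in>index_set. range (c i))"
  then obtain \<epsilon> z x where i: "(\<epsilon>, z) \<in> index_set" "q = c (\<epsilon>, z) x" by auto
  then have "\<epsilon> \<subseteq> {2..d}" "\<forall>j\<in>{2..d}. z j \<in> Z j" by (auto simp: index_set_def)
  then show "q \<in> layer d" using i(2) circle_param_turn[of \<epsilon> z x] unfolding layer_def by auto
next
  fix q assume "q \<in> layer d"
  then obtain \<epsilon> z x where q: "q = turn \<epsilon> d (pt z d x)" "\<epsilon> \<subseteq> {2..d}" "\<forall>j\<in>{2..d}. z j \<in> Z j"
    unfolding layer_def by blast
  let ?z = "restrict z {2..d}"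
  have "cen ?z l = cen z l" if "l \<le> d" for l using that by (induction l) auto
  moreover have "rad ?z d = rad z d" unfolding rad_def by (intro prod.cong) auto
  ultimately have "pt ?z d x = pt z d x" by (simp add: pt_def)
  then have "q = c (\<epsilon>, ?z) x" using q circle_param_turn[of \<epsilon> ?z x] by simp
  moreover have "(\<epsilon>, ?z) \<in> index_set" using q by (auto simp: index_set_def)
  ultimately show "q \<in> (\<Union>i\<in>index_set. range (c i))" by blast
qed

lemma connected_circles: "connected (\<Union>i\<in>index_set. range (c i))"
  unfolding union_of_circles using layer_connected[of d] d2 by simp

end

section \<open>Exactness of the family and the main estimate\<close>

lemma polys_uptoI: "f = (\<lambda>x. \<Sum>a | sum a UNIV \<le> t. c a * monomial_fun a x) \<Longrightarrow> f \<in> polys_upto t"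
  unfolding polys_upto_def monomial_fun_def by blast

lemma polys_upto_iff: "f \<in> polys_upto t \<longleftrightarrow> (\<exists>c. f = (\<lambda>x. \<Sum>a | sum a UNIV \<le> t. c a * monomial_fun a x))"
  unfolding polys_upto_def monomial_fun_def by blast

lemma polys_uptoE:
  assumes "f \<in> polys_upto t"
  obtains c where "f = (\<lambda>x. \<Sum>a | sum a UNIV \<le> t. c a * monomial_fun a x)"
  using assms unfolding polys_upto_def monomial_fun_def by blast

lemma polys_upto_scaled_monomial: "sum a UNIV \<le> t \<Longrightarrow> (\<lambda>x. c * monomial_fun a x) \<in> polys_upto t"
  by (rule polys_uptoI[where c = "\<lambda>b. if b = a then c else 0"])
    (simp add: if_distrib[of "\<lambda>c. c * _"] sum.delta finite_multi_indices cong: if_cong)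

lemma polys_upto_add: "f \<in> polys_upto t \<Longrightarrow> g \<in> polys_upto t \<Longrightarrow> (\<lambda>x. f x + g x) \<in> polys_upto t"
proof -
  assume "f \<in> polys_upto t" "g \<in> polys_upto t"
  then obtain b c where "f = (\<lambda>x. \<Sum>a | sum a UNIV \<le> t. b a * monomial_fun a x)"
    "g = (\<lambda>x. \<Sum>a | sum a UNIV \<le> t. c a * monomial_fun a x)" unfolding polys_upto_iff by blast
  then show ?thesis by (intro polys_uptoI[where c = "\<lambda>a. b a + c a"]) (simp add: distrib_right sum.distrib)
qed

lemma polys_upto_sum: "(\<And>i. i \<in> A \<Longrightarrow> f i \<in> polys_upto t) \<Longrightarrow> (\<lambda>x. \<Sum>i\<in>A. f i x) \<in> polys_upto t"
proof (induction A rule: infinite_finite_induct)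
  case (insert i A)
  then show ?case by (simp add: polys_upto_add)
qed (auto intro: polys_uptoI[where c = "\<lambda>_. 0"])

lemma monomial_fun_mult: "monomial_fun a x * monomial_fun b x = monomial_fun (\<lambda>i. a i + b i) x"
  by (simp add: monomial_fun_def power_add prod.distrib)

lemma polys_upto_mult:
  assumes "f \<in> polys_upto s" "g \<in> polys_upto t"
  shows "(\<lambda>x. f x * g x) \<in> polys_upto (s + t)"
proof -
  obtain b c where b: "f = (\<lambda>x. \<Sum>a | sum a UNIV \<le> s. b a * monomial_fun a x)"
    and c: "g = (\<lambda>x. \<Sum>a | sum a UNIV \<le> t. c a * monomial_fun a x)" using assms unfolding polys_upto_iff by blast
  have "(\<lambda>x. f x * g x) = (\<lambda>x. \<Sum>i | sum i UNIV \<le> s. \<Sum>j | sum j UNIV \<le> t. (b i * c j) * monomial_fun (\<lambda>k. i k + j k) x)"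
    unfolding b c sum_product monomial_fun_mult[symmetric] by (simp add: mult_ac)
  also have "\<dots> \<in> polys_upto (s + t)"
    by (intro polys_upto_sum polys_upto_scaled_monomial) (auto simp: sum.distrib)
  finally show ?thesis .
qed

lemma polys_upto_1: "(\<lambda>x. 1) \<in> polys_upto t"
  using polys_upto_scaled_monomial[of "\<lambda>_. 0" t 1] by (simp add: monomial_fun_def)

lemma polys_upto_power: "f \<in> polys_upto t \<Longrightarrow> (\<lambda>x. f x ^ m) \<in> polys_upto (m * t)"
  by (induction m) (auto simp: polys_upto_1 dest: polys_upto_mult)

lemma polys_upto_prod:
  "finite A \<Longrightarrow> (\<And>i. i \<in> A \<Longrightarrow> f i \<in> polys_upto (n i)) \<Longrightarrow> (\<lambda>x. \<Prod>i\<in>A. f i x) \<in> polys_upto (sum n A)"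
  by (induction A rule: finite_induct) (auto simp: polys_upto_1 intro: polys_upto_mult)

lemma polys_upto_mono: "f \<in> polys_upto s \<Longrightarrow> s \<le> t \<Longrightarrow> f \<in> polys_upto t"
  using polys_upto_mult[OF _ polys_upto_1, of f s "t - s"] by simp

text \<open>
  Needed because the family of circles is the union of turned copies of one exact family.
\<close>

lemma polys_upto_compose_linear:
  fixes L :: "real ^ 'n \<Rightarrow> real ^ 'n"
  assumes f: "f \<in> polys_upto t" and L: "linear L"
  shows "(\<lambda>x. f (L x)) \<in> polys_upto t"
proof -
  obtain c where c: "f = (\<lambda>x. \<Sum>a | sum a UNIV \<le> t. c a * monomial_fun a x)" using f by (rule polys_uptoE)
  have coord: "(\<lambda>x. L x $ i) \<in> polys_upto 1" for i
  proof -
    have "L x $ i = (\<Sum>k\<in>UNIV. L (axis k 1) $ i * monomial_fun (\<lambda>j. if j = k then 1 else 0) x)" for x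
    proof -
      have "monomial_fun (\<lambda>j. if j = k then 1 else 0) x = x $ k" for k
      proof -
        have "monomial_fun (\<lambda>j. if j = k then 1 else 0) x = (\<Prod>j\<in>UNIV. if j = k then x $ j else 1)"
          unfolding monomial_fun_def by (intro prod.cong) auto
        then show ?thesis by simp
      qed
      moreover have "L x = (\<Sum>k\<in>UNIV. x $ k *\<^sub>R L (axis k 1))"
        using basis_expansion[of x] linear_sum[OF L] linear_scale[OF L]
        by (metis (no_types, lifting) scalar_mult_eq_scaleR sum.cong)
      ultimately show ?thesis by (simp add: mult.commute)
    qed
    then have "(\<lambda>x. L x $ i) = (\<lambda>x. \<Sum>k\<in>UNIV. L (axis k 1) $ i * monomial_fun (\<lambda>j. if j = k then 1 else 0) x)" by blast
    then show ?thesis by (simp only:) (intro polys_upto_sum polys_upto_scaled_monomial, simp)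
  qed
  have mono: "(\<lambda>x. monomial_fun a (L x)) \<in> polys_upto t" if "sum a UNIV \<le> t" for a
  proof -
    have "(\<lambda>x. L x $ i ^ a i) \<in> polys_upto (a i)" for i using polys_upto_power[OF coord[of i], of "a i"] by simp
    then have "(\<lambda>x. monomial_fun a (L x)) \<in> polys_upto (sum a UNIV)"
      unfolding monomial_fun_def by (intro polys_upto_prod) auto
    then show ?thesis using that by (rule polys_upto_mono)
  qed
  have const: "(\<lambda>x. k) \<in> polys_upto 0" for k :: real
    using polys_upto_scaled_monomial[of "\<lambda>_. 0" 0 k] by (simp add: monomial_fun_def)
  show ?thesis unfolding c
    by (intro polys_upto_sum) (use polys_upto_mult[OF const mono] in auto)
qed

lemma continuous_on_polys_upto: "f \<in> polys_upto t \<Longrightarrow> continuous_on A f"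
  by (elim polys_uptoE) (auto intro!: continuous_intros continuous_on_monomial_fun)

lemma sphere_average_sum:
  fixes f :: "'i \<Rightarrow> real ^ 'n \<Rightarrow> real"
  assumes "\<And>i. i \<in> A \<Longrightarrow> continuous_on UNIV (f i)"
  shows "sphere_average (\<lambda>x. \<Sum>i\<in>A. k i * f i x) = (\<Sum>i\<in>A. k i * sphere_average (f i))"
proof -
  have "continuous_on UNIV (\<lambda>x. \<Sum>i\<in>A. k i * f i x)" using assms by (intro continuous_intros) auto
  then show ?thesis
    using assms by (simp add: sphere_average_cone_integral cone_integral_sum sum_divide_distrib)
qed

text \<open>
  The family of latitude circles with heights that are exact up to degree \<open>t\<close>.
\<close>

locale latitude_design = latitude_family d e Z ca sa
  for d :: nat and e :: "nat \<Rightarrow> 'n::finite" and Z ca sa +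
  fixes t :: nat
  assumes nodes: "k \<in> {2..d} \<Longrightarrow> quadrature_nodes (k - 1) t (Z k)"
begin

lemma sym_Z: "k \<in> {2..d} \<Longrightarrow> z \<in> Z k \<Longrightarrow> - z \<in> Z k"
  using nodes[of k] unfolding quadrature_nodes_def by blast

text \<open>
  Every coordinate before \<open>j\<close> carries the factor \<open>co (z j)\<close>.
\<close>

lemma monomial_pt:
  assumes "1 \<le> k" "k \<le> d"
  shows "(\<Prod>j\<le>k. pt z k x $ e j ^ b j) = cos (2 * pi * x) ^ b 1 * sin (2 * pi * x) ^ b 0 *
     (\<Prod>j=2..k. co (z j) ^ sum b {..<j} * z j ^ b j)"
  using assms
proof (induction k rule: nat_induct_at_least)
  case base
  have "{..1::nat} = {0, 1}" by auto
  then show ?case using d2 by (simp add: pt_1 ax_nth)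
next
  case (Suc k)
  let ?z = "z (Suc k)"
  have "pt z (Suc k) x $ e j = co ?z * pt z k x $ e j" if "j \<le> k" for j
    using that Suc.hyps Suc.prems by (simp add: pt_Suc ax_nth)
  then have "(\<Prod>j\<le>k. pt z (Suc k) x $ e j ^ b j) = (\<Prod>j\<le>k. co ?z ^ b j * pt z k x $ e j ^ b j)"
    by (intro prod.cong) (auto simp: power_mult_distrib)
  also have "\<dots> = co ?z ^ sum b {..k} * (\<Prod>j\<le>k. pt z k x $ e j ^ b j)"
    by (simp add: prod.distrib power_sum)
  finally have 1: "(\<Prod>j\<le>k. pt z (Suc k) x $ e j ^ b j) = co ?z ^ sum b {..k} * (\<Prod>j\<le>k. pt z k x $ e j ^ b j)" .
  have 2: "pt z (Suc k) x $ e (Suc k) = ?z"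
    using Suc.hyps Suc.prems pt_nth[of k "Suc k" z x] by (simp add: pt_Suc ax_nth)
  have 3: "{2..Suc k} = insert (Suc k) {2..k}" using Suc.hyps by auto
  have "(\<Prod>j\<le>Suc k. pt z (Suc k) x $ e j ^ b j) = (\<Prod>j\<le>k. pt z (Suc k) x $ e j ^ b j) * ?z ^ b (Suc k)"
    by (simp add: 2)
  also have "\<dots> = (co ?z ^ sum b {..k} * ?z ^ b (Suc k)) * (\<Prod>j\<le>k. pt z k x $ e j ^ b j)" by (simp add: 1)
  finally show ?case using Suc unfolding 3 by (simp add: lessThan_Suc_atMost)
qed

definition base_length :: real where
  "base_length = (\<Sum>z\<in>PiE {2..d} Z. 2 * pi * rad z d)"

lemma base_length_prod: "base_length = 2 * pi * (\<Prod>j=2..d. \<Sum>z\<in>Z j. co z)"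
  unfolding base_length_def rad_def sum_distrib_left[symmetric]
  by (subst prod_sum_PiE) (auto simp: finite_Z)

text \<open>
  Weighted by its length, the integral over a circle is a product of factors that depend on one
  height each; summation over all heights gives the product of the sums. For even exponents
  these sums are moments by \<open>node_sum_moments\<close>, and the first odd exponent makes
  its factor vanish by symmetry.
\<close>

lemma base_exact_monomial:
  assumes a: "sum a UNIV \<le> t"
  shows "(\<Sum>z\<in>PiE {2..d} Z. 2 * pi * rad z d * integral {0..1} (\<lambda>x. monomial_fun a (pt z d x))) =
     base_length * sphere_average (monomial_fun a)"
proof -
  define b where "b j = a (e j)" for j
  have mon: "monomial_fun a y = (\<Prod>j\<le>d. y $ e j ^ b j)" for y
    unfolding monomial_fun_def b_def by (rule prod.reindex_bij_betw[OF e, symmetric])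
  have sb: "sum b {..d} = sum a UNIV" unfolding b_def by (rule sum.reindex_bij_betw[OF e])
  define A where "A j = sum b {..<j}" for j
  define N where "N j = (\<Sum>z\<in>Z j. co z * (co z ^ A j * z ^ b j))" for j
  define E where "E = integral {0..2 * pi} (\<lambda>x. cos x ^ b 1 * sin x ^ b 0)"
  have E: "2 * pi * integral {0..1} (\<lambda>x. cos (2 * pi * x) ^ b 1 * sin (2 * pi * x) ^ b 0) = E"
  proof -
    have "((\<lambda>x. cos x ^ b 1 * sin x ^ b 0) has_integral E) (cbox 0 (2 * pi))"
      unfolding E_def box_real by (intro integrable_integral integrable_continuous_real continuous_intros)
    from has_integral_affinity[OF this, of "2 * pi" 0]
    have "((\<lambda>x. cos (2 * pi * x) ^ b 1 * sin (2 * pi * x) ^ b 0) has_integral E / (2 * pi)) {0..1}"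
      by (simp add: image_mult_atLeastAtMost_if divide_simps mult_ac)
    then show ?thesis by (simp add: integral_unique)
  qed
  have "(\<Sum>z\<in>PiE {2..d} Z. 2 * pi * rad z d * integral {0..1} (\<lambda>x. monomial_fun a (pt z d x)))
    = (\<Sum>z\<in>PiE {2..d} Z. E * (\<Prod>j=2..d. co (z j) * (co (z j) ^ A j * z j ^ b j)))"
  proof (intro sum.cong refl)
    fix z
    have "integral {0..1} (\<lambda>x. monomial_fun a (pt z d x)) =
      integral {0..1} (\<lambda>x. cos (2 * pi * x) ^ b 1 * sin (2 * pi * x) ^ b 0) * (\<Prod>j=2..d. co (z j) ^ A j * z j ^ b j)"
      using monomial_pt[of d z _ b] d2 by (simp add: mon A_def)
    then show "2 * pi * rad z d * integral {0..1} (\<lambda>x. monomial_fun a (pt z d x)) =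
       E * (\<Prod>j=2..d. co (z j) * (co (z j) ^ A j * z j ^ b j))"
      unfolding E[symmetric] rad_def by (simp add: prod.distrib mult_ac)
  qed
  also have "\<dots> = E * (\<Prod>j=2..d. N j)"
    unfolding N_def sum_distrib_left[symmetric] by (subst prod_sum_PiE) (auto simp: finite_Z)
  also have "\<dots> = base_length * sphere_average (monomial_fun a)"
  proof (cases "\<forall>i. even (a i)")
    case True
    then have ev: "even (b j)" for j by (simp add: b_def)
    have Nj: "N j = (\<Sum>z\<in>Z j. co z) * (trig_moment (b j) (A j + (j - 1)) / trig_moment 0 (j - 1))" if j: "j \<in> {2..d}" for j
    proof -
      obtain i where i: "b j = 2 * i" using ev[of j] by (auto elim: evenE)
      have "even (A j)" unfolding A_def by (intro dvd_sum ev)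
      then obtain r where r: "A j = 2 * r" by (auto elim: evenE)
      have "A j + b j = sum b {..j}" by (simp add: A_def lessThan_Suc_atMost[symmetric])
      also have "\<dots> \<le> sum b {..d}" using j by (intro sum_mono2) auto
      finally have "i + r \<le> t" using a sb i r by simp
      moreover have "- 1 < z \<and> z < 1" if "z \<in> Z j" for z
        using Z_bound[OF j that] sa_less_1 by (simp add: abs_le_iff)
      ultimately show ?thesis
        using node_sum_moments[where Z = "Z j" and t = t and W = "\<Sum>z\<in>Z j. co z" and m = "j - 1" and i = i and r = r] nodes[OF j]
        unfolding quadrature_nodes_def by (simp add: N_def i r)
    qed
    have "(\<Prod>j=2..d. N j) = (\<Prod>j=2..d. \<Sum>z\<in>Z j. co z) * (\<Prod>j=2..d. trig_moment (b j) (A j + (j - 1)) / trig_moment 0 (j - 1))"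
      unfolding prod.distrib[symmetric] by (intro prod.cong refl Nj)
    moreover have "E = 2 * pi * (trig_moment (b 1) (A 1 + (1 - 1)) / trig_moment 0 (1 - 1))"
      unfolding E_def full_circle_moment using ev by (simp add: A_def)
    moreover have "sphere_moment d b = (trig_moment (b 1) (A 1 + (1 - 1)) / trig_moment 0 (1 - 1)) *
        (\<Prod>j=2..d. trig_moment (b j) (A j + (j - 1)) / trig_moment 0 (j - 1))"
    proof -
      have "{1..d} = insert 1 {2..d}" using d2 by auto
      then show ?thesis unfolding sphere_moment_def A_def by (simp only:) simp
    qed
    moreover have "sphere_average (monomial_fun a) = sphere_moment d b"
    proof -
      have "CARD('n) = d + 1" using bij_betw_same_card[OF e] by simp
      then show ?thesis using sphere_average_monomial[OF _ _ e, of a] d2 True by (simp add: b_def[abs_def])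
    qed
    ultimately show ?thesis unfolding base_length_prod by simp
  next
    case False
    then obtain i where "odd (a i)" by blast
    moreover obtain l where "l \<le> d" "e l = i" using e unfolding bij_betw_def by (metis UNIV_I atMost_iff imageE)
    ultimately have l: "l \<le> d" "odd (b l)" by (simp_all add: b_def)
    have "E * (\<Prod>j=2..d. N j) = 0"
    proof (cases "l < 2")
      case True
      then have "l = 0 \<or> l = 1" by auto
      then have "E = 0" unfolding E_def full_circle_moment using l by auto
      then show ?thesis by simp
    next
      case False
      then have j: "l \<in> {2..d}" using l by auto
      have "N l = (\<Sum>z\<in>Z l. co (- z) * (co (- z) ^ A l * (- z) ^ b l))"
        unfolding N_def by (rule sum.reindex_bij_witness[of _ uminus uminus]) (auto simp: sym_Z[OF j])
      also have "\<dots> = - N l" unfolding N_def sum_negf[symmetric] using l(2) by (intro sum.cong) auto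
      finally have "N l = 0" by simp
      then have "(\<Prod>j=2..d. N j) = 0" using j by (intro prod_zero) auto
      then show ?thesis by simp
    qed
    moreover have "sphere_average (monomial_fun a) = 0"
    proof -
      have "CARD('n) = d + 1" using bij_betw_same_card[OF e] by simp
      then show ?thesis using sphere_average_monomial[OF _ _ e, of a] d2 False by simp
    qed
    ultimately show ?thesis by simp
  qed
  finally show ?thesis .
qed

lemma base_exact:
  assumes f: "f \<in> polys_upto t"
  shows "(\<Sum>z\<in>PiE {2..d} Z. 2 * pi * rad z d * integral {0..1} (\<lambda>x. f (pt z d x))) = base_length * sphere_average f"
proof -
  let ?M = "{a :: 'n \<Rightarrow> nat. sum a UNIV \<le> t}"
  obtain k where k: "f = (\<lambda>x. \<Sum>a\<in>?M. k a * monomial_fun a x)" using f by (rule polys_uptoE)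
  have cpt: "continuous_on A (pt z d)" for A z
    unfolding pt_def circle_param_def by (intro continuous_intros)
  have "integral {0..1} (\<lambda>x. f (pt z d x)) = (\<Sum>a\<in>?M. k a * integral {0..1} (\<lambda>x. monomial_fun a (pt z d x)))" for z
  proof -
    have "integral {0..1} (\<lambda>x. f (pt z d x)) = (\<Sum>a\<in>?M. integral {0..1} (\<lambda>x. k a * monomial_fun a (pt z d x)))"
      unfolding k
      by (intro integral_sum finite_multi_indices integrable_continuous_real continuous_intros
          continuous_on_compose2[OF continuous_on_monomial_fun[of UNIV] cpt]) auto
    then show ?thesis by simp
  qed
  then have "(\<Sum>z\<in>PiE {2..d} Z. 2 * pi * rad z d * integral {0..1} (\<lambda>x. f (pt z d x))) =
     (\<Sum>z\<in>PiE {2..d} Z. \<Sum>a\<in>?M. k a * (2 * pi * rad z d * integral {0..1} (\<lambda>x. monomial_fun a (pt z d x))))"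
    by (simp add: sum_distrib_left mult_ac)
  also have "\<dots> = (\<Sum>a\<in>?M. k a * (base_length * sphere_average (monomial_fun a)))"
    by (subst sum.swap) (auto simp: base_exact_monomial simp flip: sum_distrib_left intro!: sum.cong)
  also have "\<dots> = base_length * sphere_average f"
    unfolding k by (subst sphere_average_sum) (auto simp: continuous_on_monomial_fun sum_distrib_left mult_ac)
  finally show ?thesis .
qed

lemma sum_index_set:
  "(\<Sum>i\<in>index_set. h i) = (\<Sum>\<epsilon>\<in>Pow {2..d}. \<Sum>z\<in>PiE {2..d} Z. h (\<epsilon>, z))" for h :: "_ \<Rightarrow> real"
  unfolding index_set_def by (simp add: sum.cartesian_product)

text \<open>
  A turned copy integrates \<open>f\<close> as the original family integrates the polynomial
  \<open>f\<close> composed with the rotation, and the spherical average does not change under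
  rotation.
\<close>

lemma design_curve_exists:
  "\<exists>\<gamma> :: real \<Rightarrow> real ^ 'n. design_curve t \<gamma> \<and> curve_length \<gamma> = 2 ^ (d - 1) * base_length \<and>
     (\<exists>\<C>. (\<forall>C\<in>\<C>. euclidean_circle C) \<and> path_image \<gamma> = \<Union>\<C>)"
proof -
  obtain \<gamma> where sc: "sphere_curve \<gamma>" and img: "path_image \<gamma> = (\<Union>i\<in>index_set. range (c i))"
    and len: "curve_length \<gamma> = (\<Sum>i\<in>index_set. 2 * pi * rad (snd i) d)"
    and int: "\<And>f. continuous_on UNIV f \<Longrightarrow>
        curve_integral \<gamma> f = (\<Sum>i\<in>index_set. 2 * pi * rad (snd i) d * integral {0..1} (\<lambda>x. f (c i x)))"
    using closed_curve_exists[OF connected_circles finite_intersection] by blast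
  have card: "card (Pow {2..d}) = 2 ^ (d - 1)" by (simp add: card_Pow)
  have len': "curve_length \<gamma> = 2 ^ (d - 1) * base_length"
    unfolding len sum_index_set base_length_def[symmetric] snd_conv by (simp add: card)
  have "1 / curve_length \<gamma> * curve_integral \<gamma> f = sphere_average f" if f: "f \<in> polys_upto t" for f
  proof -
    have cf: "continuous_on UNIV f" using f by (rule continuous_on_polys_upto)
    have "(\<Sum>z\<in>PiE {2..d} Z. 2 * pi * rad z d * integral {0..1} (\<lambda>x. f (c (\<epsilon>, z) x))) = base_length * sphere_average f"
      if \<epsilon>: "\<epsilon> \<in> Pow {2..d}" for \<epsilon>
    proof -
      have o: "orthogonal_transformation (turn \<epsilon> d)" using \<epsilon> by (intro orthogonal_turn) auto
      note ff = polys_upto_compose_linear[OF f orthogonal_transformation_linear[OF o]]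
      have "sphere_average (\<lambda>x. f (turn \<epsilon> d x)) = sphere_average f"
        using cone_integral_orthogonal[OF cf o] cf continuous_on_polys_upto[OF ff] by (simp add: sphere_average_cone_integral)
      then show ?thesis using base_exact[OF ff] circle_param_turn[of \<epsilon>] \<epsilon> by simp
    qed
    then have "curve_integral \<gamma> f = (\<Sum>\<epsilon>\<in>Pow {2..d}. base_length * sphere_average f)"
      unfolding int[OF cf] sum_index_set snd_conv by (rule sum.cong[OF refl])
    also have "\<dots> = curve_length \<gamma> * sphere_average f" unfolding len' by (simp add: card)
    finally show ?thesis using sc by (simp add: sphere_curve_def)
  qed
  then have "design_curve t \<gamma>" using sc by (simp add: design_curve_def)
  moreover have "\<exists>\<C>. (\<forall>C\<in>\<C>. euclidean_circle C) \<and> path_image \<gamma> = \<Union>\<C>"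
    unfolding img by (intro exI[of _ "(\<lambda>i. range (c i)) ` index_set"]) (auto intro: euclidean_circle_range)
  ultimately show ?thesis using len' by (intro exI[of _ \<gamma>] conjI)
qed

end

theorem theorem6p1:
  fixes d :: nat
  assumes "d \<ge> 2" and "CARD('n::finite) = d + 1"
  shows "\<exists>\<gamma> :: nat \<Rightarrow> real \<Rightarrow> real ^ 'n.
    (\<forall>t\<ge>1. design_curve t (\<gamma> t)) \<and>
    (\<exists>C>0. \<forall>t\<ge>1. curve_length (\<gamma> t) \<le> C * real t powr (real d * (real d - 1) / 2)) \<and>
    (\<forall>t\<ge>1. \<exists>\<C>. (\<forall>c\<in>\<C>. euclidean_circle c) \<and> path_image (\<gamma> t) = \<Union>\<C>)"
proof -
  have "\<exists>e. bij_betw e {..d} (UNIV :: 'n set)"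
    using assms(2) by (intro finite_same_card_bij) auto
  then obtain e where e: "bij_betw e {..d} (UNIV :: 'n set)" ..
  have "\<forall>k. \<exists>C. 0 < C \<and> (\<forall>t\<ge>1. \<exists>Z. quadrature_nodes (k + 1) t Z \<and> real (card Z) \<le> C * real t ^ (k + 1))"
    using quadrature_nodes_exist by blast
  from choice[OF this] obtain B where B: "\<And>k. 0 < B k"
    and nodes: "\<And>k t. t \<ge> 1 \<Longrightarrow> \<exists>Z. quadrature_nodes (k + 1) t Z \<and> real (card Z) \<le> B k * real t ^ (k + 1)"
    by blast
  define C where "C = 2 ^ (d - 1) * (2 * pi * (\<Prod>j=2..d. B (j - 2)))"
  have C: "C > 0" unfolding C_def using B by (intro mult_pos_pos prod_pos) auto
  have "\<exists>\<gamma> :: real \<Rightarrow> real ^ 'n. design_curve t \<gamma> \<and>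
     curve_length \<gamma> \<le> C * real t powr (real d * (real d - 1) / 2) \<and>
     (\<exists>\<C>. (\<forall>c\<in>\<C>. euclidean_circle c) \<and> path_image \<gamma> = \<Union>\<C>)" if t: "t \<ge> 1" for t
  proof -
    have "\<forall>k. \<exists>Z. quadrature_nodes (k + 1) t Z \<and> real (card Z) \<le> B k * real t ^ (k + 1)"
      using nodes[OF t] by blast
    from choice[OF this] obtain Y where Y: "\<And>k. quadrature_nodes (k + 1) t (Y k)"
      "\<And>k. real (card (Y k)) \<le> B k * real t ^ (k + 1)" by blast
    define Z where "Z k = Y (k - 2)" for k
    have Z: "quadrature_nodes (k - 1) t (Z k)" if "k \<in> {2..d}" for k
    proof -
      have "k - 2 + 1 = k - 1" using that by auto
      then show ?thesis using Y(1)[of "k - 2"] by (simp only: Z_def)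
    qed
    have Z_props: "finite (Z k)" "0 \<in> Z k" "\<And>z. z \<in> Z k \<Longrightarrow> \<bar>z\<bar> < 1" if "k \<in> {2..d}" for k
      using Z[OF that] by (auto simp: quadrature_nodes_def abs_less_iff)
    \<comment> \<open>The sine of the turning angle; the number \<open>1 / 2\<close> only makes sure that it is positive.\<close>
    define S where "S = insert (1 / 2) (abs ` (\<Union>k\<in>{2..d}. Z k))"
    have S: "finite S" "S \<noteq> {}" unfolding S_def using Z_props(1) by auto
    define sa where "sa = Max S"
    have "x < 1" if "x \<in> S" for x using that Z_props(3) by (auto simp: S_def)
    then have sa1: "sa < 1" using Max_in[OF S] unfolding sa_def by blast
    have Smax: "x \<le> sa" if "x \<in> S" for x using Max_ge[OF S(1) that] by (simp add: sa_def)
    have sa: "1 / 2 \<le> sa" "\<And>k z. k \<in> {2..d} \<Longrightarrow> z \<in> Z k \<Longrightarrow> \<bar>z\<bar> \<le> sa"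
      by (rule Smax, unfold S_def, blast)+
    define ca where "ca = sqrt (1 - sa\<^sup>2)"
    have sa2: "sa\<^sup>2 < 1" using sa(1) sa1 by (simp add: abs_square_less_1)
    have ca: "0 < ca" "ca\<^sup>2 + sa\<^sup>2 = 1" using sa2 by (simp_all add: ca_def)
    interpret latitude_design d e Z ca sa t
    proof
      fix k assume k: "k \<in> {2..d}"
      show "finite (Z k)" "0 \<in> Z k" "quadrature_nodes (k - 1) t (Z k)" using Z Z_props k by auto
      show "\<bar>z\<bar> \<le> sa" if "z \<in> Z k" for z using sa(2)[OF k that] .
    qed (use assms e sa(1) ca in auto)
    obtain \<gamma> :: "real \<Rightarrow> real ^ 'n" where \<gamma>: "design_curve t \<gamma>" "curve_length \<gamma> = 2 ^ (d - 1) * base_length"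
      "\<exists>\<C>. (\<forall>c\<in>\<C>. euclidean_circle c) \<and> path_image \<gamma> = \<Union>\<C>"
      using design_curve_exists by blast
    have "(\<Prod>j=2..d. \<Sum>z\<in>Z j. sqrt (1 - z\<^sup>2)) \<le> (\<Prod>j=2..d. B (j - 2) * real t ^ (j - 1))"
    proof (intro prod_mono conjI)
      fix j assume j: "j \<in> {2..d}"
      have sq: "0 \<le> sqrt (1 - z\<^sup>2) \<and> sqrt (1 - z\<^sup>2) \<le> 1" if "z \<in> Z j" for z
        using Z_less[OF j that] by simp
      show "0 \<le> (\<Sum>z\<in>Z j. sqrt (1 - z\<^sup>2))" using sq by (intro sum_nonneg) auto
      have "(\<Sum>z\<in>Z j. sqrt (1 - z\<^sup>2)) \<le> (\<Sum>z\<in>Z j. 1)" using sq by (intro sum_mono) auto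
      also have "\<dots> = real (card (Y (j - 2)))" by (simp add: Z_def)
      also have "\<dots> \<le> B (j - 2) * real t ^ (j - 2 + 1)" by (rule Y(2))
      also have "j - 2 + 1 = j - 1" using j by auto
      finally show "(\<Sum>z\<in>Z j. sqrt (1 - z\<^sup>2)) \<le> B (j - 2) * real t ^ (j - 1)" .
    qed
    also have "\<dots> = (\<Prod>j=2..d. B (j - 2)) * real t ^ (\<Sum>j=2..d. j - 1)"
      by (simp add: prod.distrib power_sum)
    finally have "curve_length \<gamma> \<le> 2 ^ (d - 1) * (2 * pi * ((\<Prod>j=2..d. B (j - 2)) * real t ^ (\<Sum>j=2..d. j - 1)))"
      unfolding \<gamma>(2) base_length_prod by (intro mult_left_mono) auto
    also have "\<dots> = C * real t ^ (\<Sum>j=2..d. j - 1)" by (simp add: C_def)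
    also have "real t ^ (\<Sum>j=2..d. j - 1) = real t powr (real d * (real d - 1) / 2)"
    proof -
      define m where "m = (\<Sum>j=2..d. j - 1)"
      have "2 * m = d * (d - 1)"
        unfolding m_def using assms(1)
      proof (induction d rule: nat_induct_at_least)
        case (Suc d)
        then show ?case by (cases d) (simp_all add: algebra_simps)
      qed simp
      then have "real (2 * m) = real (d * (d - 1))" by (simp only:)
      then have "real m = real d * (real d - 1) / 2" using assms(1) by (simp add: of_nat_diff)
      moreover have "real t ^ m = real t powr real m" using t by (simp add: powr_realpow)
      ultimately show ?thesis unfolding m_def by (simp only:)
    qed
    finally show ?thesis using \<gamma>(1,3) by blast
  qed
  then obtain \<gamma> where \<gamma>: "\<And>t. t \<ge> 1 \<Longrightarrow> design_curve t (\<gamma> t :: real \<Rightarrow> real ^ 'n) \<and>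
     curve_length (\<gamma> t) \<le> C * real t powr (real d * (real d - 1) / 2) \<and>
     (\<exists>\<C>. (\<forall>c\<in>\<C>. euclidean_circle c) \<and> path_image (\<gamma> t) = \<Union>\<C>)" by metis
  then show ?thesis using C by (intro exI[of _ \<gamma>]) blast
qed

end
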